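(* (a) For all integers $d\ge 1$ with $N=d$ and all $k\ge 1$ in the univariate case $n=1$ (for $d\geq 2$, so that the surface $\mathcal{G}_{1,d}\subset\mathbb{P}^d$ is two-dimensional, and trivially for $d=1$, where $\mathcal{G}_{1,1}=\mathbb{P}^1$), one has $$\dim\bigl(\mathrm{Sec}_k(\mathcal{G}_{1,d})\bigr)=\min\{\,d,\;3k-1\,\}.$$ Hence all moment varieties of mixtures of univariate Gaussians are algebraically identifiable: whenever $d\ge 3k-1$, the polynomial map sending the $3k-1$ model parameters of a mixture of $k$ univariate Gaussians to its moments of order $\le d$ is generically finite-to-one. (b) The same is false for $n\ge 3$, $d=3$ and $k=2$: for every $n\ge 3$, with $N=\binom{n+3}{3}-1$, $$\min\{\,N,\; n(n+3)+1\,\}-\dim\bigl(\mathrm{Sec}_2(\mathcal{G}_{n,3})\bigr)=2 .$$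
   Context: Work over $\mathbb{C}$. Let $n,d,k\ge 1$ and $N=\binom{n+d}{d}-1$. The coordinates on $\mathbb{P}^N$ are the moments $m_{i_1\cdots i_n}$ with $i_1+\cdots+i_n\le d$, and $\mathbb{A}^N=\{m_{0\cdots0}=1\}\subset\mathbb{P}^N$. Consider the map from the space of model parameters to $\mathbb{A}^N$ given by the identity of generating functions (truncated to total degree $\le d$) $$\sum_{i_1,\dots,i_n\ge 0}\frac{m_{i_1\cdots i_n}}{i_1!\cdots i_n!}t_1^{i_1}\cdots t_n^{i_n}=\sum_{\ell=1}^k\lambda_\ell\exp(t_1\mu_{\ell1}+\cdots+t_n\mu_{\ell n})\exp\Bigl(\tfrac12\sum_{i,j=1}^n\sigma_{\ell ij}t_it_j\Bigr).$$ The model parameters are the mean vectors $(\mu_{\ell 1},\dots,\mu_{\ell n})$, the symmetric covariance matrices $(\sigma_{\ell ij})$, and the mixture parameters $\lambda_\ell$ subject to $\lambda_1+\cdots+\lambda_k=1$; for given $k,n$ there are $kn(n+3)/2+k-1$ of them. The variety $\mathrm{Sec}_k(\mathcal{G}_{n,d})\subset\mathbb{P}^N$ is the Zariski closure of the image of this map; for $k=1$ it is the Gaussian moment variety $\mathcal{G}_{n,d}$, which has dimension $n(n+3)/2$ for $d\ge2$. One always has $\dim \mathrm{Sec}_k(\mathcal{G}_{n,d})\le\min\{N,\,kn(n+3)/2+k-1\}$; the right-hand side is called the expected dimension. *)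

theory Defs
  imports
    "HOL-Analysis.Analysis"
    "HOL-Library.Poly_Mapping"
    "HOL-Library.Extended_Nat"
begin

section \<open>Multivariate polynomials\<close>

text \<open>
  An exponent vector is a finitely supported map \<open>'v \<Rightarrow>\<^sub>0 nat\<close>; a polynomial with variables
  in \<open>'v\<close> is a finitely supported map from exponent vectors to coefficients, whose ring structure
  is the convolution ring of \<^theory>\<open>HOL-Library.Poly_Mapping\<close>.
\<close>

type_synonym 'v cpoly = "('v \<Rightarrow>\<^sub>0 nat) \<Rightarrow>\<^sub>0 complex"

definition mdeg :: "('v \<Rightarrow>\<^sub>0 nat) \<Rightarrow> nat" where
  "mdeg a = (\<Sum>i\<in>Poly_Mapping.keys a. Poly_Mapping.lookup a i)"

definition monom_eval :: "('v \<Rightarrow>\<^sub>0 nat) \<Rightarrow> ('v \<Rightarrow> complex) \<Rightarrow> complex" where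
  "monom_eval a x = (\<Prod>i\<in>Poly_Mapping.keys a. x i ^ Poly_Mapping.lookup a i)"

definition cpoly_eval :: "'v cpoly \<Rightarrow> ('v \<Rightarrow> complex) \<Rightarrow> complex" where
  "cpoly_eval f x = (\<Sum>a\<in>Poly_Mapping.keys f. Poly_Mapping.lookup f a * monom_eval a x)"

definition homogeneous_polys :: "'v set \<Rightarrow> 'v cpoly set" where
  "homogeneous_polys I =
     {f. \<exists>e. \<forall>a\<in>Poly_Mapping.keys f. Poly_Mapping.keys a \<subseteq> I \<and> mdeg a = e}"

lemma monom_eval_superset:
  assumes "finite S" "Poly_Mapping.keys a \<subseteq> S"
  shows "monom_eval a x = (\<Prod>i\<in>S. x i ^ Poly_Mapping.lookup a i)"
  unfolding monom_eval_def
  by (rule prod.mono_neutral_left) (use assms in \<open>auto simp: in_keys_iff\<close>)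

lemma keys_add_nat:
  fixes a b :: "'v \<Rightarrow>\<^sub>0 nat"
  shows "Poly_Mapping.keys (a + b) = Poly_Mapping.keys a \<union> Poly_Mapping.keys b"
  by (auto simp: in_keys_iff lookup_add)

lemma monom_eval_add: "monom_eval (a + b) x = monom_eval a x * monom_eval b x"
proof -
  let ?S = "Poly_Mapping.keys a \<union> Poly_Mapping.keys b"
  have "monom_eval (a + b) x = (\<Prod>i\<in>?S. x i ^ Poly_Mapping.lookup (a + b) i)"
    by (rule monom_eval_superset) (auto simp: keys_add_nat)
  also have "\<dots> = (\<Prod>i\<in>?S. x i ^ Poly_Mapping.lookup a i) * (\<Prod>i\<in>?S. x i ^ Poly_Mapping.lookup b i)"
    by (simp add: lookup_add power_add prod.distrib)
  also have "\<dots> = monom_eval a x * monom_eval b x"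
    by (simp add: monom_eval_superset[of ?S a x] monom_eval_superset[of ?S b x])
  finally show ?thesis .
qed

lemma mdeg_add: "mdeg (a + b) = mdeg a + mdeg b"
proof -
  let ?S = "Poly_Mapping.keys a \<union> Poly_Mapping.keys b"
  have *: "mdeg c = (\<Sum>i\<in>?S. Poly_Mapping.lookup c i)" if "Poly_Mapping.keys c \<subseteq> ?S" for c
    unfolding mdeg_def by (rule sum.mono_neutral_left) (use that in \<open>auto simp: in_keys_iff\<close>)
  show ?thesis
    by (simp add: *[of a] *[of b] *[of "a + b"] keys_add_nat lookup_add sum.distrib)
qed

lemma cpoly_eval_superset:
  assumes "finite S" "Poly_Mapping.keys f \<subseteq> S"
  shows "cpoly_eval f x = (\<Sum>a\<in>S. Poly_Mapping.lookup f a * monom_eval a x)"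
  unfolding cpoly_eval_def
  by (rule sum.mono_neutral_left) (use assms in \<open>auto simp: in_keys_iff\<close>)

lemma cpoly_eval_zero [simp]: "cpoly_eval 0 x = 0"
  by (simp add: cpoly_eval_def)

lemma cpoly_eval_single: "cpoly_eval (Poly_Mapping.single a c) x = c * monom_eval a x"
  by (simp add: cpoly_eval_def)

lemma cpoly_eval_add: "cpoly_eval (f + g) x = cpoly_eval f x + cpoly_eval g x"
proof -
  let ?S = "Poly_Mapping.keys f \<union> Poly_Mapping.keys g"
  have "cpoly_eval (f + g) x = (\<Sum>a\<in>?S. Poly_Mapping.lookup (f + g) a * monom_eval a x)"
    by (rule cpoly_eval_superset) (use keys_add[of f g] in auto)
  then show ?thesis
    by (simp add: cpoly_eval_superset[of ?S f x] cpoly_eval_superset[of ?S g x]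
        lookup_add sum.distrib algebra_simps)
qed

lemma cpoly_eval_sum: "cpoly_eval (sum f A) x = (\<Sum>a\<in>A. cpoly_eval (f a) x)"
  by (induction A rule: infinite_finite_induct) (auto simp: cpoly_eval_add)

lemma cpoly_expand:
  "f = (\<Sum>a\<in>Poly_Mapping.keys f. Poly_Mapping.single a (Poly_Mapping.lookup f a))"
  by (rule poly_mapping_eqI)
     (auto simp: lookup_sum lookup_single when_def in_keys_iff)

lemma cpoly_eval_mult: "cpoly_eval (f * g) x = cpoly_eval f x * cpoly_eval g x"
proof -
  let ?s = "\<lambda>f a. Poly_Mapping.single a (Poly_Mapping.lookup f a)"
  have "f * g = (\<Sum>a\<in>Poly_Mapping.keys f. ?s f a) * (\<Sum>b\<in>Poly_Mapping.keys g. ?s g b)"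
    using cpoly_expand[of f] cpoly_expand[of g] by simp
  also have "\<dots> = (\<Sum>a\<in>Poly_Mapping.keys f. \<Sum>b\<in>Poly_Mapping.keys g.
      Poly_Mapping.single (a + b) (Poly_Mapping.lookup f a * Poly_Mapping.lookup g b))"
    by (simp add: sum_product mult_single)
  finally have "cpoly_eval (f * g) x = (\<Sum>a\<in>Poly_Mapping.keys f. \<Sum>b\<in>Poly_Mapping.keys g.
      (Poly_Mapping.lookup f a * monom_eval a x) * (Poly_Mapping.lookup g b * monom_eval b x))"
    by (simp add: cpoly_eval_sum cpoly_eval_single monom_eval_add mult_ac)
  then show ?thesis
    by (simp add: cpoly_eval_def sum_product)
qed

lemma homogeneous_polys_mult:
  assumes "f \<in> homogeneous_polys I" "g \<in> homogeneous_polys I"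
  shows "f * g \<in> homogeneous_polys I"
proof -
  obtain d e where d: "\<forall>a\<in>Poly_Mapping.keys f. Poly_Mapping.keys a \<subseteq> I \<and> mdeg a = d"
    and e: "\<forall>a\<in>Poly_Mapping.keys g. Poly_Mapping.keys a \<subseteq> I \<and> mdeg a = e"
    using assms by (auto simp: homogeneous_polys_def)
  have "Poly_Mapping.keys c \<subseteq> I \<and> mdeg c = d + e" if c: "c \<in> Poly_Mapping.keys (f * g)" for c
  proof -
    obtain a b where "c = a + b" "a \<in> Poly_Mapping.keys f" "b \<in> Poly_Mapping.keys g"
      using keys_mult[of f g] c by blast
    then show ?thesis using d e by (simp add: keys_add_nat mdeg_add)
  qed
  then show ?thesis by (auto simp: homogeneous_polys_def)
qed

lemma one_in_homogeneous_polys: "1 \<in> homogeneous_polys I"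
  by (auto simp: homogeneous_polys_def)

lemma cpoly_eval_one [simp]: "cpoly_eval 1 x = 1"
  by (simp add: cpoly_eval_def monom_eval_def)

section \<open>Projective space with the Zariski topology\<close>

text \<open>
  The homogeneous coordinates are indexed by a set \<open>I\<close>; vectors vanish outside \<open>I\<close>, so that
  for finite \<open>I\<close> this is the projective space of dimension \<open>card I - 1\<close>.
\<close>

definition homog_vectors :: "'v set \<Rightarrow> ('v \<Rightarrow> complex) set" where
  "homog_vectors I = {x. (\<forall>i. i \<notin> I \<longrightarrow> x i = 0) \<and> (\<exists>i. x i \<noteq> 0)}"

definition proj_rel :: "'v set \<Rightarrow> (('v \<Rightarrow> complex) \<times> ('v \<Rightarrow> complex)) set" where
  "proj_rel I = {(x, y). x \<in> homog_vectors I \<and> y \<in> homog_vectors I \<and>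
                         (\<exists>c. c \<noteq> 0 \<and> y = (\<lambda>i. c * x i))}"

definition proj_space :: "'v set \<Rightarrow> ('v \<Rightarrow> complex) set set" where
  "proj_space I = homog_vectors I // proj_rel I"

definition proj_point :: "'v set \<Rightarrow> ('v \<Rightarrow> complex) \<Rightarrow> ('v \<Rightarrow> complex) set" where
  "proj_point I x = proj_rel I `` {x}"

definition proj_zeros :: "'v set \<Rightarrow> 'v cpoly set \<Rightarrow> ('v \<Rightarrow> complex) set set" where
  "proj_zeros I F = {p \<in> proj_space I. \<forall>f\<in>F. \<forall>x\<in>p. cpoly_eval f x = 0}"

definition zariski_topology :: "'v set \<Rightarrow> ('v \<Rightarrow> complex) set topology" where
  "zariski_topology I = topology (\<lambda>U. U \<subseteq> proj_space I \<and>
     (\<exists>F \<subseteq> homogeneous_polys I. proj_space I - U = proj_zeros I F))"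

lemma equiv_proj_rel: "equiv (homog_vectors I) (proj_rel I)"
proof (rule equivI)
  show "refl_on (homog_vectors I) (proj_rel I)"
    by (auto simp: refl_on_def proj_rel_def intro: exI[of _ 1])
  show "proj_rel I \<subseteq> homog_vectors I \<times> homog_vectors I"
    by (auto simp: proj_rel_def)
  show "sym (proj_rel I)"
  proof (rule symI)
    fix x y assume "(x, y) \<in> proj_rel I"
    then obtain c where "x \<in> homog_vectors I" "y \<in> homog_vectors I" "c \<noteq> 0" "y = (\<lambda>i. c * x i)"
      by (auto simp: proj_rel_def)
    then show "(y, x) \<in> proj_rel I"
      unfolding proj_rel_def
      by (auto intro!: exI[of _ "inverse c"])
  qed
  show "trans (proj_rel I)"
  proof (rule transI)
    fix x y z assume "(x, y) \<in> proj_rel I" "(y, z) \<in> proj_rel I"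
    then obtain c d where "x \<in> homog_vectors I" "z \<in> homog_vectors I" "c \<noteq> 0" "d \<noteq> 0"
      "y = (\<lambda>i. c * x i)" "z = (\<lambda>i. d * y i)"
      by (auto simp: proj_rel_def)
    then show "(x, z) \<in> proj_rel I"
      unfolding proj_rel_def by (auto intro!: exI[of _ "d * c"])
  qed
qed

lemma monom_eval_scale: "monom_eval a (\<lambda>i. c * x i) = c ^ mdeg a * monom_eval a x"
  by (simp add: monom_eval_def mdeg_def power_mult_distrib prod.distrib power_sum)

lemma homogeneous_eval_scale:
  assumes "f \<in> homogeneous_polys I"
  obtains e where "\<And>c x. cpoly_eval f (\<lambda>i. c * x i) = c ^ e * cpoly_eval f x"
proof -
  obtain e where "\<forall>a\<in>Poly_Mapping.keys f. mdeg a = e"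
    using assms by (auto simp: homogeneous_polys_def)
  then have "cpoly_eval f (\<lambda>i. c * x i) = c ^ e * cpoly_eval f x" for c x
    by (auto simp: cpoly_eval_def monom_eval_scale sum_distrib_left intro!: sum.cong)
  then show ?thesis by (rule that)
qed

lemma homogeneous_zero_on_class:
  assumes f: "f \<in> homogeneous_polys I" and p: "p \<in> proj_space I" and x: "x \<in> p" "y \<in> p"
    and zero: "cpoly_eval f x = 0"
  shows "cpoly_eval f y = 0"
proof -
  have "(x, y) \<in> proj_rel I"
    using quotient_eq_iff[OF equiv_proj_rel, of p I p x y] p x by (simp add: proj_space_def)
  then obtain c where "y = (\<lambda>i. c * x i)" by (auto simp: proj_rel_def)
  moreover obtain e where "\<And>c x. cpoly_eval f (\<lambda>i. c * x i) = c ^ e * cpoly_eval f x"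
    using homogeneous_eval_scale[OF f] by blast
  ultimately show ?thesis using zero by simp
qed

lemma proj_space_nonempty_class: "p \<in> proj_space I \<Longrightarrow> p \<noteq> {}"
  using in_quotient_imp_non_empty[OF equiv_proj_rel] by (auto simp: proj_space_def)

lemma proj_zeros_Un:
  assumes F: "F \<subseteq> homogeneous_polys I" and G: "G \<subseteq> homogeneous_polys I"
  shows "proj_zeros I F \<union> proj_zeros I G = proj_zeros I {f * g |f g. f \<in> F \<and> g \<in> G}"
    (is "_ = proj_zeros I ?H")
proof (intro equalityI subsetI)
  fix p assume "p \<in> proj_zeros I F \<union> proj_zeros I G"
  then show "p \<in> proj_zeros I ?H" by (auto simp: proj_zeros_def cpoly_eval_mult)
next
  fix p assume p: "p \<in> proj_zeros I ?H"
  then have ps: "p \<in> proj_space I" by (simp add: proj_zeros_def)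
  show "p \<in> proj_zeros I F \<union> proj_zeros I G"
  proof (rule ccontr)
    assume "p \<notin> proj_zeros I F \<union> proj_zeros I G"
    then obtain f x g y where "f \<in> F" "x \<in> p" "cpoly_eval f x \<noteq> 0"
      "g \<in> G" "y \<in> p" "cpoly_eval g y \<noteq> 0"
      using ps by (auto simp: proj_zeros_def)
    moreover from this have "cpoly_eval g x \<noteq> 0"
      using homogeneous_zero_on_class[of g I p x y] G ps by auto
    ultimately show False using p by (force simp: proj_zeros_def cpoly_eval_mult)
  qed
qed

lemma istopology_zariski:
  "istopology (\<lambda>U. U \<subseteq> proj_space I \<and>
     (\<exists>F \<subseteq> homogeneous_polys I. proj_space I - U = proj_zeros I F))"
  unfolding istopology_def
proof (intro conjI allI impI)
  fix S T
  assume S: "S \<subseteq> proj_space I \<and> (\<exists>F\<subseteq>homogeneous_polys I. proj_space I - S = proj_zeros I F)"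
    and T: "T \<subseteq> proj_space I \<and> (\<exists>F\<subseteq>homogeneous_polys I. proj_space I - T = proj_zeros I F)"
  then obtain F G where F: "F \<subseteq> homogeneous_polys I" "proj_space I - S = proj_zeros I F"
    and G: "G \<subseteq> homogeneous_polys I" "proj_space I - T = proj_zeros I G" by auto
  have "proj_space I - S \<inter> T = proj_zeros I {f * g |f g. f \<in> F \<and> g \<in> G}"
    using F G proj_zeros_Un[OF F(1) G(1)] by auto
  moreover have "{f * g |f g. f \<in> F \<and> g \<in> G} \<subseteq> homogeneous_polys I"
    using F G by (auto intro: homogeneous_polys_mult)
  ultimately show "\<exists>F\<subseteq>homogeneous_polys I. proj_space I - S \<inter> T = proj_zeros I F" by blast
  show "S \<inter> T \<subseteq> proj_space I" using S by auto
next
  fix K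
  assume K: "\<forall>U\<in>K. U \<subseteq> proj_space I \<and>
    (\<exists>F\<subseteq>homogeneous_polys I. proj_space I - U = proj_zeros I F)"
  then show "\<Union>K \<subseteq> proj_space I" by auto
  from K obtain F where F: "\<And>U. U \<in> K \<Longrightarrow> F U \<subseteq> homogeneous_polys I"
    "\<And>U. U \<in> K \<Longrightarrow> proj_space I - U = proj_zeros I (F U)" by metis
  have "proj_space I - \<Union>K = proj_zeros I (\<Union>U\<in>K. F U)"
  proof (intro equalityI subsetI)
    fix p assume p: "p \<in> proj_space I - \<Union>K"
    then have "p \<in> proj_zeros I (F U)" if "U \<in> K" for U using F(2)[OF that] that by auto
    then show "p \<in> proj_zeros I (\<Union>U\<in>K. F U)" using p by (auto simp: proj_zeros_def)
  next
    fix p assume p: "p \<in> proj_zeros I (\<Union>U\<in>K. F U)"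
    then have "p \<in> proj_zeros I (F U)" if "U \<in> K" for U using that by (auto simp: proj_zeros_def)
    then have "p \<notin> U" if "U \<in> K" for U using F(2)[OF that] that by auto
    then show "p \<in> proj_space I - \<Union>K" using p by (auto simp: proj_zeros_def)
  qed
  moreover have "(\<Union>U\<in>K. F U) \<subseteq> homogeneous_polys I" using F(1) by auto
  ultimately show "\<exists>F\<subseteq>homogeneous_polys I. proj_space I - \<Union>K = proj_zeros I F" by blast
qed

lemma openin_zariski:
  "openin (zariski_topology I) U \<longleftrightarrow> U \<subseteq> proj_space I \<and>
     (\<exists>F \<subseteq> homogeneous_polys I. proj_space I - U = proj_zeros I F)"
  by (simp add: zariski_topology_def topology_inverse'[OF istopology_zariski])

lemma topspace_zariski [simp]: "topspace (zariski_topology I) = proj_space I"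
proof (rule equalityI)
  show "topspace (zariski_topology I) \<subseteq> proj_space I"
    using openin_topspace[of "zariski_topology I"] unfolding openin_zariski by blast
  have "proj_zeros I {1} = {}"
    using proj_space_nonempty_class by (auto simp: proj_zeros_def)
  then have "openin (zariski_topology I) (proj_space I)"
    unfolding openin_zariski using one_in_homogeneous_polys[of I]
    by (intro conjI exI[of _ "{1}"]) auto
  then show "proj_space I \<subseteq> topspace (zariski_topology I)" by (rule openin_subset)
qed

lemma closedin_zariski:
  "closedin (zariski_topology I) Z \<longleftrightarrow> (\<exists>F \<subseteq> homogeneous_polys I. Z = proj_zeros I F)"
proof -
  have "proj_space I - (proj_space I - Z) = Z" if "Z \<subseteq> proj_space I" using that by auto
  moreover have "proj_zeros I F \<subseteq> proj_space I" for F by (auto simp: proj_zeros_def)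
  ultimately show ?thesis unfolding closedin_def openin_zariski by auto
qed

section \<open>Dimension and generically finite maps\<close>

definition irreducible_in :: "'a topology \<Rightarrow> 'a set \<Rightarrow> bool" where
  "irreducible_in X Z \<longleftrightarrow> Z \<noteq> {} \<and> Z \<subseteq> topspace X \<and>
     (\<forall>A B. closedin X A \<and> closedin X B \<and> Z \<subseteq> A \<union> B \<longrightarrow> Z \<subseteq> A \<or> Z \<subseteq> B)"

definition krull_dim :: "'a topology \<Rightarrow> enat" where
  "krull_dim X = Sup {enat r | r. \<exists>Z :: nat \<Rightarrow> 'a set.
     (\<forall>i\<le>r. closedin X (Z i) \<and> irreducible_in X (Z i)) \<and> (\<forall>i<r. Z i \<subset> Z (Suc i))}"

definition variety_dim :: "'v set \<Rightarrow> ('v \<Rightarrow> complex) set set \<Rightarrow> enat" where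
  "variety_dim I V = krull_dim (subtopology (zariski_topology I) V)"

definition generically_finite_to_one :: "'a set \<Rightarrow> 'b topology \<Rightarrow> ('a \<Rightarrow> 'b) \<Rightarrow> bool" where
  "generically_finite_to_one P Y f \<longleftrightarrow>
     (let W = subtopology Y (Y closure_of (f ` P)) in
      \<exists>U. openin W U \<and> W closure_of U = topspace W \<and>
          (\<forall>y\<in>U. finite {x \<in> P. f x = y}))"

section \<open>Moments of Gaussian mixtures\<close>

text \<open>
  Model parameters are triples \<open>(w, \<mu>, \<sigma>)\<close> of mixture weights, means and covariances. The
  entries outside the relevant index range are set to \<open>0\<close>, which makes the parameters with
  \<open>k\<close> components in dimension \<open>n\<close> a complex affine space of dimension
  \<open>k * n * (n + 3) / 2 + k - 1\<close>.
\<close>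

type_synonym gauss_param =
  "(nat \<Rightarrow> complex) \<times> (nat \<Rightarrow> nat \<Rightarrow> complex) \<times> (nat \<Rightarrow> nat \<Rightarrow> nat \<Rightarrow> complex)"

definition gauss_params :: "nat \<Rightarrow> nat \<Rightarrow> gauss_param set" where
  "gauss_params n k = {(w, \<mu>, \<sigma>).
     (\<forall>l. \<not> l < k \<longrightarrow> w l = 0) \<and> (\<Sum>l<k. w l) = 1 \<and>
     (\<forall>l i. \<not> (l < k \<and> i < n) \<longrightarrow> \<mu> l i = 0) \<and>
     (\<forall>l i j. \<not> (l < k \<and> i < n \<and> j < n) \<longrightarrow> \<sigma> l i j = 0) \<and>
     (\<forall>l i j. \<sigma> l i j = \<sigma> l j i)}"

definition linear_form :: "nat \<Rightarrow> (nat \<Rightarrow> complex) \<Rightarrow> nat cpoly" where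
  "linear_form n m = (\<Sum>i<n. Poly_Mapping.single (Poly_Mapping.single i 1) (m i))"

definition half_quadratic_form :: "nat \<Rightarrow> (nat \<Rightarrow> nat \<Rightarrow> complex) \<Rightarrow> nat cpoly" where
  "half_quadratic_form n s = (\<Sum>i<n. \<Sum>j<n.
     Poly_Mapping.single (Poly_Mapping.single i 1 + Poly_Mapping.single j 1) (s i j / 2))"

text \<open>
  The exponential series cut off after the \<open>d\<close>-th power. For \<open>f\<close> without constant term,
  \<open>f ^ j\<close> has only terms of degree at least \<open>j\<close>, so the coefficients of degree at most \<open>d\<close>
  agree with those of the full power series \<open>exp f\<close>; likewise for products of such series.
\<close>

definition trunc_exp :: "nat \<Rightarrow> nat cpoly \<Rightarrow> nat cpoly" where
  "trunc_exp d f = (\<Sum>j\<le>d. Poly_Mapping.single 0 (1 / fact j) * f ^ j)"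

definition mixture_gen_fun :: "nat \<Rightarrow> nat \<Rightarrow> nat \<Rightarrow> gauss_param \<Rightarrow> nat cpoly" where
  "mixture_gen_fun n d k = (\<lambda>(w, \<mu>, \<sigma>). \<Sum>l<k. Poly_Mapping.single 0 (w l) *
     trunc_exp d (linear_form n (\<mu> l)) * trunc_exp d (half_quadratic_form n (\<sigma> l)))"

definition moment_indices :: "nat \<Rightarrow> nat \<Rightarrow> (nat \<Rightarrow>\<^sub>0 nat) set" where
  "moment_indices n d = {a. Poly_Mapping.keys a \<subseteq> {..<n} \<and> mdeg a \<le> d}"

definition moments :: "nat \<Rightarrow> nat \<Rightarrow> nat \<Rightarrow> gauss_param \<Rightarrow> (nat \<Rightarrow>\<^sub>0 nat) \<Rightarrow> complex" where
  "moments n d k \<theta> a =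
     (if a \<in> moment_indices n d
      then (\<Prod>i<n. fact (Poly_Mapping.lookup a i)) * Poly_Mapping.lookup (mixture_gen_fun n d k \<theta>) a
      else 0)"

definition moment_map :: "nat \<Rightarrow> nat \<Rightarrow> nat \<Rightarrow> gauss_param \<Rightarrow> ((nat \<Rightarrow>\<^sub>0 nat) \<Rightarrow> complex) set" where
  "moment_map n d k \<theta> = proj_point (moment_indices n d) (moments n d k \<theta>)"

definition gauss_secant :: "nat \<Rightarrow> nat \<Rightarrow> nat \<Rightarrow> ((nat \<Rightarrow>\<^sub>0 nat) \<Rightarrow> complex) set set" where
  "gauss_secant k n d =
     zariski_topology (moment_indices n d) closure_of (moment_map n d k ` gauss_params n k)"

text \<open>
  The moment of order zero is \<open>1\<close>, so the moment map lands in the affine chart where the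
  coordinate with index \<open>0\<close> equals \<open>1\<close>; on it, moment vectors and projective points
  correspond bijectively.
\<close>

lemma lookup_mult_zero:
  fixes f g :: "nat cpoly"
  shows "Poly_Mapping.lookup (f * g) 0 = Poly_Mapping.lookup f 0 * Poly_Mapping.lookup g 0"
proof -
  have "monom_eval a (\<lambda>_::nat. 0) = (if a = 0 then 1 else 0)" for a
    by (auto simp: monom_eval_def in_keys_iff poly_mapping_eq_iff fun_eq_iff)
  then have "cpoly_eval h (\<lambda>_. 0) = Poly_Mapping.lookup h 0" for h :: "nat cpoly"
    by (auto simp: cpoly_eval_def if_distrib[of "(*) _"] in_keys_iff cong: if_cong)
  then show ?thesis using cpoly_eval_mult[of f g "\<lambda>_. 0"] by simp
qed

lemma lookup_power_zero:
  fixes f :: "nat cpoly"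
  shows "Poly_Mapping.lookup (f ^ j) 0 = Poly_Mapping.lookup f 0 ^ j"
  by (induction j) (simp_all add: lookup_mult_zero)

lemma lookup_trunc_exp_zero:
  assumes "Poly_Mapping.lookup f 0 = 0"
  shows "Poly_Mapping.lookup (trunc_exp d f) 0 = 1"
proof -
  have "Poly_Mapping.lookup (trunc_exp d f) 0 = (\<Sum>j\<le>d. if j = 0 then 1 else 0)"
    unfolding trunc_exp_def lookup_sum
    by (rule sum.cong) (auto simp: lookup_mult_zero lookup_power_zero assms)
  then show ?thesis by simp
qed

lemma moments_zero:
  assumes "\<theta> \<in> gauss_params n k"
  shows "moments n d k \<theta> 0 = 1"
proof -
  obtain w \<mu> \<sigma> where \<theta>: "\<theta> = (w, \<mu>, \<sigma>)" by (cases \<theta>)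
  have neq: "Poly_Mapping.single i (1::nat) + a \<noteq> 0" for i :: nat and a
    by (metis add_is_0 lookup_add lookup_single_eq lookup_zero one_neq_zero)
  have "Poly_Mapping.lookup (linear_form n (\<mu> l)) 0 = 0" for l
    using neq[of _ 0] by (auto simp: linear_form_def lookup_sum lookup_single when_def)
  moreover have "Poly_Mapping.lookup (half_quadratic_form n (\<sigma> l)) 0 = 0" for l
    using neq by (auto simp: half_quadratic_form_def lookup_sum lookup_single when_def)
  ultimately have "Poly_Mapping.lookup (mixture_gen_fun n d k \<theta>) 0 = (\<Sum>l<k. w l)"
    by (simp add: mixture_gen_fun_def \<theta> lookup_sum lookup_mult_zero lookup_trunc_exp_zero)
  then show ?thesis
    using assms by (simp add: moments_def moment_indices_def mdeg_def gauss_params_def \<theta>)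
qed

lemma moments_in_homog_vectors:
  assumes "\<theta> \<in> gauss_params n k"
  shows "moments n d k \<theta> \<in> homog_vectors (moment_indices n d)"
proof -
  have "\<exists>a. moments n d k \<theta> a \<noteq> 0"
    using moments_zero[OF assms, of d] by (intro exI[of _ 0]) simp
  then show ?thesis by (simp add: homog_vectors_def moments_def)
qed

lemma moment_map_in_proj_space:
  assumes "\<theta> \<in> gauss_params n k"
  shows "moment_map n d k \<theta> \<in> proj_space (moment_indices n d)"
  using moments_in_homog_vectors[OF assms]
  by (auto simp: moment_map_def proj_point_def proj_space_def intro: quotientI)

lemma moment_map_eq_iff:
  assumes "\<theta> \<in> gauss_params n k" "\<theta>' \<in> gauss_params n k"
  shows "moment_map n d k \<theta> = moment_map n d k \<theta>' \<longleftrightarrow> moments n d k \<theta> = moments n d k \<theta>'"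
proof
  assume "moment_map n d k \<theta> = moment_map n d k \<theta>'"
  then have "(moments n d k \<theta>, moments n d k \<theta>') \<in> proj_rel (moment_indices n d)"
    unfolding moment_map_def proj_point_def
    using eq_equiv_class[OF _ equiv_proj_rel moments_in_homog_vectors[OF assms(2)]] by blast
  then obtain c where c: "moments n d k \<theta>' = (\<lambda>i. c * moments n d k \<theta> i)"
    by (auto simp: proj_rel_def)
  then have "c = 1"
    using moments_zero[OF assms(1), of d] moments_zero[OF assms(2), of d] by (metis mult.right_neutral)
  with c show "moments n d k \<theta> = moments n d k \<theta>'" by simp
qed (simp add: moment_map_def)

end

theory Submission
  imports Defs "HOL-Computational_Algebra.Polynomial"
begin

text \<open>
  Dimensions are computed by counting algebraically independent functions. Let \<open>V\<close> be the closure
  of the image of a polynomial map \<open>\<phi>\<close> from an affine space of dimension \<open>r\<close> into the chart where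
  one homogeneous coordinate is \<open>1\<close>.

  For the upper bound, take a strictly increasing chain of irreducible closed subsets of \<open>V\<close> and
  look at the affine cones over them. A form that vanishes on one member of the chain but not on the
  next is independent of whatever was independent on the smaller one (\<open>alg_indep_on_extend\<close>), so a
  chain with \<open>q\<close> steps yields \<open>q + 1\<close> independent functions on the cone over \<open>V\<close>. That cone is
  dominated by the \<open>r\<close> parameters and one scaling factor, and \<open>r + 2\<close> polynomials in \<open>r + 1\<close> variables
  satisfy a relation, because they have more monomials of bounded degree than there are monomials in
  the variables (\<open>polyfuns_dependent\<close>). Hence \<open>q \<le> r\<close>.

  For the lower bound, suppose that \<open>r\<close> linear forms pull back along \<open>\<phi>\<close> to functions whose
  differentials at one point form a triangular matrix with nonzero diagonal. Then the images of the
  coordinate subspaces through that point have closures which form a strict chain of length \<open>r\<close>: each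
  carries one more independent function than the preceding one (\<open>alg_indep_on_linear_part\<close>). If, in
  addition, \<open>r\<close> is the number of all parameters, every parameter is algebraic over the values of the
  linear forms, and this gives finiteness of the general fibre.

  In the univariate case a linear form on the moments is a polynomial \<open>A\<close> of degree at most \<open>d\<close>, and
  its value on the mixture is the expectation of \<open>A\<close>. At variance zero the derivatives of this
  expectation with respect to weight, mean and variance of a component with mean \<open>\<mu>\<close> are multiples of
  \<open>A \<mu>\<close>, \<open>A' \<mu>\<close> and \<open>A'' \<mu>\<close>. The differential is therefore the matrix of Hermite interpolation with
  triple nodes at the means, which is triangular in the Newton basis; in geometric terms, osculating
  planes of a rational normal curve at different points are as independent as their number permits.

  For mixtures of two Gaussians and moments of order three, centring at the common mean \<open>M\<close> brings the
  generating function into the form \<open>exp M * (1 + S + D * R)\<close> modulo degree four, with \<open>D\<close> the difference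
  of the means, \<open>S\<close> half the covariance form of the mixture and \<open>R\<close> a quadratic form. All linear \<open>M\<close>, \<open>D\<close> and quadratic
  \<open>S\<close>, \<open>R\<close> occur, already with equal weights: the mixing weight is one superfluous parameter. Since
  only the product \<open>D * R\<close> matters, the scaling of \<open>D\<close> against \<open>R\<close> is a second one. Fixing one
  coefficient of \<open>D\<close> leaves \<open>n * (n + 3) - 1\<close> parameters, and at a suitable point each of them is, to
  first order, a multiple of one of the moments.
\<close>

section \<open>Polynomial functions\<close>

text \<open>
  Working with functions instead of formal polynomials makes composition trivial; that a polynomial
  is nonzero is always expressed by a point where its value is nonzero.
\<close>
inductive polyfun :: "'v set \<Rightarrow> (('v \<Rightarrow> complex) \<Rightarrow> complex) \<Rightarrow> bool" for V where
  const: "polyfun V (\<lambda>x. c)"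
| var: "i \<in> V \<Longrightarrow> polyfun V (\<lambda>x. x i)"
| add: "polyfun V f \<Longrightarrow> polyfun V g \<Longrightarrow> polyfun V (\<lambda>x. f x + g x)"
| mult: "polyfun V f \<Longrightarrow> polyfun V g \<Longrightarrow> polyfun V (\<lambda>x. f x * g x)"

named_theorems polyfun_intros
declare polyfun.intros [polyfun_intros]

lemma polyfun_divide [polyfun_intros]: "polyfun V f \<Longrightarrow> polyfun V (\<lambda>x. f x / c)"
  using polyfun.mult[OF _ polyfun.const[of V "1 / c"], of f] by simp

lemma polyfun_diff [polyfun_intros]:
  "polyfun V f \<Longrightarrow> polyfun V g \<Longrightarrow> polyfun V (\<lambda>x. f x - g x)"
  using polyfun.add[OF _ polyfun.mult[OF polyfun.const[of V "- 1"]], of f g] by simp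

lemma polyfun_sum [polyfun_intros]:
  "(\<And>i. i \<in> A \<Longrightarrow> polyfun V (f i)) \<Longrightarrow> polyfun V (\<lambda>x. \<Sum>i\<in>A. f i x)"
  by (induction A rule: infinite_finite_induct) (auto intro!: polyfun.intros)

lemma polyfun_prod [polyfun_intros]:
  "(\<And>i. i \<in> A \<Longrightarrow> polyfun V (f i)) \<Longrightarrow> polyfun V (\<lambda>x. \<Prod>i\<in>A. f i x)"
  by (induction A rule: infinite_finite_induct) (auto intro!: polyfun.intros)

lemma polyfun_power [polyfun_intros]: "polyfun V f \<Longrightarrow> polyfun V (\<lambda>x. f x ^ n)"
  by (induction n) (auto intro!: polyfun.intros)

lemma polyfun_mono: "polyfun V f \<Longrightarrow> V \<subseteq> W \<Longrightarrow> polyfun W f"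
  by (induction rule: polyfun.induct) (auto intro!: polyfun.intros)

lemma polyfun_cong: "polyfun V f \<Longrightarrow> (\<And>i. i \<in> V \<Longrightarrow> x i = y i) \<Longrightarrow> f x = f y"
  by (induction rule: polyfun.induct) auto

lemma polyfun_compose:
  "polyfun W f \<Longrightarrow> (\<And>i. i \<in> W \<Longrightarrow> polyfun V (\<lambda>x. g x i)) \<Longrightarrow> polyfun V (\<lambda>x. f (g x))"
  by (induction rule: polyfun.induct) (auto intro!: polyfun.intros)

lemma polyfun_along_curve:
  assumes "polyfun V f" "\<And>i. i \<in> V \<Longrightarrow> \<exists>p. \<forall>t. \<gamma> t i = poly p t"
  shows "\<exists>q. \<forall>t. f (\<gamma> t) = poly q t"
  using assms
proof (induction rule: polyfun.induct)
  case (const c)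
  show ?case by (intro exI[of _ "[:c:]"]) simp
next
  case (add f g)
  then show ?case by (metis poly_add)
next
  case (mult f g)
  then show ?case by (metis poly_mult)
qed auto

lemma line_coordinate_poly: "\<exists>p. \<forall>t. a + t * b = poly p t" for a b :: complex
  by (rule exI[of _ "[:a, b:]"]) simp

text \<open>
  On a polynomial curve two functions become univariate polynomials, so finitely many parameters are
  to be avoided. The extra point \<open>c\<close> can be used to stay away from one exceptional parameter.
\<close>
lemma common_nonzero_on_curve:
  assumes f: "polyfun V f" and g: "polyfun V g" and \<gamma>: "\<And>i. i \<in> V \<Longrightarrow> \<exists>p. \<forall>t. \<gamma> t i = poly p t"
    and nz: "f (\<gamma> a) \<noteq> 0" "g (\<gamma> b) \<noteq> 0"
  shows "\<exists>t. t \<noteq> c \<and> f (\<gamma> t) \<noteq> 0 \<and> g (\<gamma> t) \<noteq> 0"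
proof -
  obtain p where p: "\<And>t. f (\<gamma> t) = poly p t"
    using polyfun_along_curve[OF f, of \<gamma>] \<gamma> by blast
  obtain q where q: "\<And>t. g (\<gamma> t) = poly q t"
    using polyfun_along_curve[OF g, of \<gamma>] \<gamma> by blast
  have "p \<noteq> 0" "q \<noteq> 0" using nz p q by auto
  then have "p * q * [:- c, 1:] \<noteq> 0" by (intro no_zero_divisors) auto
  then obtain t where "poly (p * q * [:- c, 1:]) t \<noteq> 0"
    using poly_all_0_iff_0 by blast
  then show ?thesis using p q by auto
qed

lemma polyfun_mult_nonzero:
  assumes f: "polyfun V f" and g: "polyfun V g" and nz: "f x \<noteq> 0" "g y \<noteq> 0"
  shows "\<exists>z. f z \<noteq> 0 \<and> g z \<noteq> 0"
  using common_nonzero_on_curve[OF f g, of "\<lambda>t i. x i + t * (y i - x i)" 0 1 0]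
    line_coordinate_poly nz by auto

lemma polyfun_prod_nonzero:
  assumes "finite J" "\<And>j. j \<in> J \<Longrightarrow> polyfun V (f j)" "\<And>j. j \<in> J \<Longrightarrow> \<exists>x. f j x \<noteq> 0"
  shows "\<exists>x. (\<Prod>j\<in>J. f j x) \<noteq> 0"
  using assms
proof (induction J)
  case (insert j J)
  then obtain x y where "(\<Prod>j\<in>J. f j x) \<noteq> 0" "f j y \<noteq> 0" by blast
  then obtain z where "(\<Prod>j\<in>J. f j z) \<noteq> 0" "f j z \<noteq> 0"
    using polyfun_mult_nonzero[OF polyfun_prod[of J V f], of "f j" x y] insert by auto
  then show ?case using insert by auto
qed simp

definition exponents :: "'v set \<Rightarrow> nat \<Rightarrow> ('v \<Rightarrow>\<^sub>0 nat) set" where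
  "exponents V K = {a. Poly_Mapping.keys a \<subseteq> V \<and> mdeg a \<le> K}"

text \<open>
  The degree bound is attached to a formal representative, so that a function of bounded degree is
  determined by finitely many coefficients.
\<close>
definition polyfun_deg :: "'v set \<Rightarrow> nat \<Rightarrow> (('v \<Rightarrow> complex) \<Rightarrow> complex) \<Rightarrow> bool" where
  "polyfun_deg V K f \<longleftrightarrow> (\<exists>p. Poly_Mapping.keys p \<subseteq> exponents V K \<and> f = cpoly_eval p)"

lemma lookup_le_mdeg: "Poly_Mapping.lookup a i \<le> mdeg a"
proof (cases "i \<in> Poly_Mapping.keys a")
  case True
  then show ?thesis unfolding mdeg_def by (intro member_le_sum) auto
qed (simp add: in_keys_iff)

lemma
  assumes "finite V"
  shows finite_exponents: "finite (exponents V K)"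
    and card_exponents_le: "card (exponents V K) \<le> (K + 1) ^ card V"
proof -
  let ?F = "V \<rightarrow>\<^sub>E {..K}"
  have inj: "inj_on (\<lambda>a. restrict (Poly_Mapping.lookup a) V) (exponents V K)"
  proof (rule inj_onI, rule poly_mapping_eqI)
    fix a b i
    assume ab: "a \<in> exponents V K" "b \<in> exponents V K"
      and eq: "restrict (Poly_Mapping.lookup a) V = restrict (Poly_Mapping.lookup b) V"
    show "Poly_Mapping.lookup a i = Poly_Mapping.lookup b i"
    proof (cases "i \<in> V")
      case True
      then show ?thesis using fun_cong[OF eq, of i] by simp
    next
      case False
      then have "i \<notin> Poly_Mapping.keys a" "i \<notin> Poly_Mapping.keys b"
        using ab by (auto simp: exponents_def)
      then show ?thesis by (simp add: in_keys_iff)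
    qed
  qed
  have sub: "(\<lambda>a. restrict (Poly_Mapping.lookup a) V) ` exponents V K \<subseteq> ?F"
    by (auto simp: exponents_def intro: order_trans[OF lookup_le_mdeg])
  have fin: "finite ?F" using assms by (intro finite_PiE) auto
  show "finite (exponents V K)" by (rule finite_imageD[OF finite_subset[OF sub fin] inj])
  show "card (exponents V K) \<le> (K + 1) ^ card V"
    using card_inj_on_le[OF inj sub fin] assms by (simp add: card_PiE)
qed

lemma polyfun_deg_mono: "polyfun_deg V K f \<Longrightarrow> K \<le> L \<Longrightarrow> polyfun_deg V L f"
  unfolding polyfun_deg_def exponents_def by fastforce

lemma polyfun_deg_const: "polyfun_deg V K (\<lambda>x. c)"
  unfolding polyfun_deg_def
  by (intro exI[of _ "Poly_Mapping.single 0 c"])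
     (auto simp: exponents_def mdeg_def cpoly_eval_single monom_eval_def)

lemma polyfun_deg_add:
  assumes "polyfun_deg V K f" "polyfun_deg V K g"
  shows "polyfun_deg V K (\<lambda>x. f x + g x)"
proof -
  obtain p q where "Poly_Mapping.keys p \<subseteq> exponents V K" "f = cpoly_eval p"
    "Poly_Mapping.keys q \<subseteq> exponents V K" "g = cpoly_eval q"
    using assms by (auto simp: polyfun_deg_def)
  then show ?thesis unfolding polyfun_deg_def
    using keys_add[of p q] by (intro exI[of _ "p + q"]) (auto simp: cpoly_eval_add fun_eq_iff)
qed

lemma polyfun_deg_mult:
  assumes "polyfun_deg V K f" "polyfun_deg V L g"
  shows "polyfun_deg V (K + L) (\<lambda>x. f x * g x)"
proof -
  obtain p q where p: "Poly_Mapping.keys p \<subseteq> exponents V K" "f = cpoly_eval p"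
    and q: "Poly_Mapping.keys q \<subseteq> exponents V L" "g = cpoly_eval q"
    using assms by (auto simp: polyfun_deg_def)
  have "a + b \<in> exponents V (K + L)" if "a \<in> exponents V K" "b \<in> exponents V L" for a b
    using that by (simp add: exponents_def keys_add_nat mdeg_add)
  then have "Poly_Mapping.keys (p * q) \<subseteq> exponents V (K + L)"
    using keys_mult[of p q] p(1) q(1) by blast
  then show ?thesis unfolding polyfun_deg_def
    using p q by (intro exI[of _ "p * q"]) (auto simp: cpoly_eval_mult fun_eq_iff)
qed

lemma polyfun_deg_power:
  "polyfun_deg V K f \<Longrightarrow> polyfun_deg V (n * K) (\<lambda>x. f x ^ n)"
  by (induction n) (auto intro: polyfun_deg_const polyfun_deg_mult)

lemma polyfun_deg_prod:
  "(\<And>i. i \<in> A \<Longrightarrow> polyfun_deg V K (f i)) \<Longrightarrow>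
   polyfun_deg V (card A * K) (\<lambda>x. \<Prod>i\<in>A. f i x)"
  by (induction A rule: infinite_finite_induct)
     (auto intro: polyfun_deg_const polyfun_deg_mult)

lemma polyfun_imp_deg:
  assumes "polyfun V f" shows "\<exists>K. polyfun_deg V K f"
  using assms
proof (induction rule: polyfun.induct)
  case (const c)
  show ?case using polyfun_deg_const by blast
next
  case (var i)
  then have "polyfun_deg V 1 (\<lambda>x. x i)" unfolding polyfun_deg_def
    by (intro exI[of _ "Poly_Mapping.single (Poly_Mapping.single i 1) 1"])
       (auto simp: exponents_def mdeg_def cpoly_eval_single monom_eval_def)
  then show ?case by blast
next
  case (add f g)
  then obtain K L where "polyfun_deg V K f" "polyfun_deg V L g" by blast
  then have "polyfun_deg V (max K L) f" "polyfun_deg V (max K L) g"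
    by (auto intro: polyfun_deg_mono)
  then show ?case using polyfun_deg_add by blast
next
  case (mult f g)
  then show ?case using polyfun_deg_mult by blast
qed

lemma polyfun_cpoly_eval:
  assumes "\<And>a. a \<in> Poly_Mapping.keys p \<Longrightarrow> Poly_Mapping.keys a \<subseteq> V"
  shows "polyfun V (cpoly_eval p)"
  unfolding cpoly_eval_def monom_eval_def
  using assms by (intro polyfun_intros) auto

lemma polyfun_cpoly_rep:
  assumes "polyfun V f"
  obtains p where "\<And>a. a \<in> Poly_Mapping.keys p \<Longrightarrow> Poly_Mapping.keys a \<subseteq> V" "f = cpoly_eval p"
  using polyfun_imp_deg[OF assms] unfolding polyfun_deg_def exponents_def by blast

lemma polyfun_homogeneous:
  "f \<in> homogeneous_polys I \<Longrightarrow> polyfun I (cpoly_eval f)"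
  by (rule polyfun_cpoly_eval) (auto simp: homogeneous_polys_def)

text \<open>
  Zariski closed sets are cut out by homogeneous polynomials only. This decomposition carries
  statements about them over to all polynomial functions on the affine cone.
\<close>
lemma polyfun_homogeneous_components:
  assumes "polyfun I f"
  obtains D H where "\<And>e. H e \<in> homogeneous_polys I"
    "\<And>e c x. cpoly_eval (H e) (\<lambda>i. c * x i) = c ^ e * cpoly_eval (H e) x"
    "\<And>x. f x = (\<Sum>e\<le>D. cpoly_eval (H e) x)"
proof -
  obtain p where p: "\<And>a. a \<in> Poly_Mapping.keys p \<Longrightarrow> Poly_Mapping.keys a \<subseteq> I" "f = cpoly_eval p"
    using polyfun_cpoly_rep[OF assms] by blast
  define A where "A e = {a \<in> Poly_Mapping.keys p. mdeg a = e}" for e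
  define H where "H e = (\<Sum>a\<in>A e. Poly_Mapping.single a (Poly_Mapping.lookup p a))" for e
  have finA: "finite (A e)" for e by (simp add: A_def)
  have ev: "cpoly_eval (H e) x = (\<Sum>a\<in>A e. Poly_Mapping.lookup p a * monom_eval a x)" for e x
    by (simp add: H_def cpoly_eval_sum cpoly_eval_single)
  have keys_H: "Poly_Mapping.keys (H e) \<subseteq> A e" for e
    unfolding H_def using finA[of e]
    by (auto simp: in_keys_iff lookup_sum lookup_single when_def split: if_splits)
  have "Poly_Mapping.keys a \<subseteq> I \<and> mdeg a = e" if "a \<in> Poly_Mapping.keys (H e)" for a e
    using keys_H[of e] that p(1)[of a] by (auto simp: A_def)
  then have 1: "H e \<in> homogeneous_polys I" for e
    unfolding homogeneous_polys_def by blast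
  have 2: "cpoly_eval (H e) (\<lambda>i. c * x i) = c ^ e * cpoly_eval (H e) x" for e c x
    by (auto simp: ev monom_eval_scale sum_distrib_left A_def intro!: sum.cong)
  obtain D where D: "\<And>a. a \<in> Poly_Mapping.keys p \<Longrightarrow> mdeg a \<le> D"
    using finite_nat_set_iff_bounded_le[of "mdeg ` Poly_Mapping.keys p"] by auto
  have "f x = (\<Sum>e\<le>D. cpoly_eval (H e) x)" for x
  proof -
    have "(\<Sum>e\<le>D. cpoly_eval (H e) x) =
        (\<Sum>e\<le>D. \<Sum>a\<in>{a \<in> Poly_Mapping.keys p. mdeg a = e}. Poly_Mapping.lookup p a * monom_eval a x)"
      by (simp add: ev A_def)
    also have "\<dots> = (\<Sum>a\<in>Poly_Mapping.keys p. Poly_Mapping.lookup p a * monom_eval a x)"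
      by (rule sum.group) (use D in auto)
    finally show ?thesis by (simp add: p(2) cpoly_eval_def)
  qed
  with 1 2 show ?thesis by (rule that)
qed

text \<open>
  On the chart where the coordinate \<open>i0\<close> is \<open>1\<close>, padding every monomial with a power of that
  coordinate changes no values.
\<close>
lemma polyfun_homogenize:
  assumes "polyfun I f" "i0 \<in> I"
  obtains h where "h \<in> homogeneous_polys I" "\<And>x. x i0 = 1 \<Longrightarrow> cpoly_eval h x = f x"
proof -
  obtain p where p: "\<And>a. a \<in> Poly_Mapping.keys p \<Longrightarrow> Poly_Mapping.keys a \<subseteq> I" "f = cpoly_eval p"
    using polyfun_cpoly_rep[OF assms(1)] by blast
  obtain D where D: "\<And>a. a \<in> Poly_Mapping.keys p \<Longrightarrow> mdeg a \<le> D"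
    using finite_nat_set_iff_bounded_le[of "mdeg ` Poly_Mapping.keys p"] by auto
  define b where "b a = a + Poly_Mapping.single i0 (D - mdeg a)" for a
  define h where "h = (\<Sum>a\<in>Poly_Mapping.keys p. Poly_Mapping.single (b a) (Poly_Mapping.lookup p a))"
  have single: "mdeg (Poly_Mapping.single i0 n) = n"
    "monom_eval (Poly_Mapping.single i0 n) x = x i0 ^ n" for n and x :: "'a \<Rightarrow> complex"
    by (simp_all add: mdeg_def monom_eval_def)
  have "Poly_Mapping.keys c \<subseteq> I \<and> mdeg c = D" if c: "c \<in> Poly_Mapping.keys h" for c
  proof -
    have "Poly_Mapping.lookup h c = 0" if "c \<notin> b ` Poly_Mapping.keys p"
      unfolding h_def lookup_sum by (rule sum.neutral) (use that in \<open>auto simp: lookup_single\<close>)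
    then obtain a where a: "a \<in> Poly_Mapping.keys p" "c = b a"
      using c by (cases "c \<in> b ` Poly_Mapping.keys p") (auto simp: in_keys_iff)
    then show ?thesis using p(1)[OF a(1)] D[OF a(1)] assms(2)
      by (auto simp: b_def mdeg_add single keys_add_nat split: if_splits)
  qed
  then have "h \<in> homogeneous_polys I" by (auto simp: homogeneous_polys_def)
  moreover have "cpoly_eval h x = f x" if "x i0 = 1" for x
    unfolding h_def p(2) cpoly_eval_sum cpoly_eval_single b_def monom_eval_add single that
    by (simp add: cpoly_eval_def)
  ultimately show ?thesis by (rule that)
qed

lemma polyfun_expand_in_variable:
  assumes "polyfun (insert z V) f"
  obtains D Q where "\<And>i. polyfun V (Q i)" "\<And>x. f x = (\<Sum>i\<le>D. Q i x * x z ^ i)"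
proof -
  have "\<exists>D Q. (\<forall>i. polyfun V (Q i)) \<and> (\<forall>i>D. \<forall>x. Q i x = 0) \<and>
          (\<forall>x. f x = (\<Sum>i\<le>D. Q i x * x z ^ i))"
    using assms
  proof (induction rule: polyfun.induct)
    case (const c)
    show ?case
      by (intro exI[of _ 0] exI[of _ "\<lambda>i x. if i = 0 then c else 0"])
         (auto simp: polyfun.const)
  next
    case (var j)
    show ?case
    proof (cases "j = z")
      case True
      have "polyfun V (\<lambda>x. if i = 1 then 1 else 0)" for i :: nat
        by (rule polyfun.const)
      with True show ?thesis
        by (intro exI[of _ 1] exI[of _ "\<lambda>i x. if i = 1 then 1 else 0"]) auto
    next
      case False
      then have "polyfun V (\<lambda>x. if i = 0 then x j else 0)" for i :: nat
        using var by (cases "i = 0") (auto intro: polyfun.intros)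
      then show ?thesis
        by (intro exI[of _ 0] exI[of _ "\<lambda>i x. if i = 0 then x j else 0"]) auto
    qed
  next
    case (add f g)
    from add.IH(1) obtain D Q where Q: "\<forall>i. polyfun V (Q i)" "\<forall>i>D. \<forall>x. Q i x = 0"
        "\<forall>x. f x = (\<Sum>i\<le>D. Q i x * x z ^ i)" by (elim exE conjE)
    from add.IH(2) obtain E R where R: "\<forall>i. polyfun V (R i)" "\<forall>i>E. \<forall>x. R i x = 0"
        "\<forall>x. g x = (\<Sum>i\<le>E. R i x * x z ^ i)" by (elim exE conjE)
    have "f x = (\<Sum>i\<le>max D E. Q i x * x z ^ i)" for x
      unfolding Q(3)[rule_format] by (rule sum.mono_neutral_left) (use Q(2) in auto)
    moreover have "g x = (\<Sum>i\<le>max D E. R i x * x z ^ i)" for x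
      unfolding R(3)[rule_format] by (rule sum.mono_neutral_left) (use R(2) in auto)
    ultimately show ?case
      using Q(1,2) R(1,2)
      by (intro exI[of _ "max D E"] exI[of _ "\<lambda>i x. Q i x + R i x"])
         (auto simp: sum.distrib algebra_simps intro: polyfun.add)
  next
    case (mult f g)
    from mult.IH(1) obtain D Q where Q: "\<forall>i. polyfun V (Q i)" "\<forall>i>D. \<forall>x. Q i x = 0"
        "\<forall>x. f x = (\<Sum>i\<le>D. Q i x * x z ^ i)" by (elim exE conjE)
    from mult.IH(2) obtain E R where R: "\<forall>i. polyfun V (R i)" "\<forall>i>E. \<forall>x. R i x = 0"
        "\<forall>x. g x = (\<Sum>i\<le>E. R i x * x z ^ i)" by (elim exE conjE)
    let ?S = "\<lambda>i x. \<Sum>k\<le>i. Q k x * R (i - k) x"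
    have "f x * g x = (\<Sum>i\<le>D + E. ?S i x * x z ^ i)" for x
      unfolding Q(3)[rule_format] R(3)[rule_format]
      by (rule polynomial_product) (use Q(2) R(2) in auto)
    moreover have "polyfun V (?S i)" for i
      using Q(1) R(1) by (intro polyfun_intros) auto
    moreover have "?S i x = 0" if "i > D + E" for i x
    proof (rule sum.neutral, intro ballI)
      fix k assume "k \<in> {..i}"
      then have "k > D \<or> i - k > E" using that by auto
      then show "Q k x * R (i - k) x = 0" using Q(2) R(2) by auto
    qed
    ultimately show ?case by (intro exI[of _ "D + E"] exI[of _ ?S]) auto
  qed
  then show ?thesis using that by blast
qed

section \<open>Algebraic dependence\<close>

lemma homogeneous_linear_system:
  fixes A :: "'t \<Rightarrow> 's \<Rightarrow> complex"
  assumes "finite T" "finite S" "card T < card S"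
  shows "\<exists>c. (\<exists>s\<in>S. c s \<noteq> 0) \<and> (\<forall>t\<in>T. (\<Sum>s\<in>S. A t s * c s) = 0)"
  using assms
proof (induction T arbitrary: S A)
  case empty
  then have "S \<noteq> {}" by auto
  then show ?case by (intro exI[of _ "\<lambda>_. 1"]) auto
next
  case (insert t T)
  show ?case
  proof (cases "\<forall>s\<in>S. A t s = 0")
    case True
    have "card T < card S" using insert by simp
    then obtain c where "\<exists>s\<in>S. c s \<noteq> 0" "\<forall>t\<in>T. (\<Sum>s\<in>S. A t s * c s) = 0"
      using insert.IH[of S A] insert.prems by blast
    then show ?thesis using True by (intro exI[of _ c]) auto
  next
    case False
    then obtain p where p: "p \<in> S" "A t p \<noteq> 0" by auto
    define B where "B t' s = A t' s - A t' p * A t s / A t p" for t' s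
    have "card T < card (S - {p})" using insert p by simp
    then obtain c where c: "\<exists>s\<in>S - {p}. c s \<noteq> 0" "\<forall>t\<in>T. (\<Sum>s\<in>S - {p}. B t s * c s) = 0"
      using insert.IH[of "S - {p}" B] insert.prems by blast
    define x where "x = - (\<Sum>s\<in>S - {p}. A t s * c s) / A t p"
    have split: "(\<Sum>s\<in>S. A t' s * (c(p := x)) s) = A t' p * x + (\<Sum>s\<in>S - {p}. A t' s * c s)" for t'
      using insert.prems p(1) by (simp add: sum.remove)
    have "(\<Sum>s\<in>S - {p}. B t' s * c s) = A t' p * x + (\<Sum>s\<in>S - {p}. A t' s * c s)" for t'
    proof -
      have "(\<Sum>s\<in>S - {p}. B t' s * c s) =
          (\<Sum>s\<in>S - {p}. A t' s * c s - A t' p / A t p * (A t s * c s))"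
        by (rule sum.cong) (simp_all add: B_def algebra_simps)
      then show ?thesis by (simp only: sum_subtractf x_def flip: sum_distrib_left) simp
    qed
    then have "\<forall>t'\<in>T. (\<Sum>s\<in>S. A t' s * (c(p := x)) s) = 0" using c(2) split by auto
    moreover have "(\<Sum>s\<in>S. A t s * (c(p := x)) s) = 0"
      unfolding split using p(2) by (simp add: x_def)
    ultimately show ?thesis using c(1) by (intro exI[of _ "c(p := x)"]) auto
  qed
qed

lemma digit_expansion:
  assumes "(N :: nat) < B ^ s"
  shows "(\<Sum>i<s. B ^ i * (N div B ^ i mod B)) = N"
  using assms
proof (induction s)
  case (Suc s)
  have *: "(\<Sum>i<s. B ^ i * (M div B ^ i mod B)) = M mod B ^ s" for M
  proof (induction s)
    case (Suc s)
    then show ?case by (simp add: mod_mult2_eq mult.commute[of B])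
  qed simp
  have "N div B ^ s < B" using Suc.prems
    by (simp add: less_mult_imp_div_less mult.commute)
  then show ?case using *[of N] by (simp add: mult.commute)
qed simp

text \<open>
  Let \<open>m = card V\<close>. Products of the \<open>m + 1\<close> functions with all exponents below \<open>B\<close> number
  \<open>B ^ (m + 1)\<close>, whereas the monomials that can occur in them number at most a constant times
  \<open>B ^ m\<close>; for large \<open>B\<close> they are linearly dependent. The products are indexed by a single number
  \<open>N\<close> whose digits to the base \<open>B\<close> are the exponents. With this indexing the relation is visibly
  a nonzero function: substituting \<open>t ^ (B ^ i)\<close> for the \<open>i\<close>-th variable turns the \<open>N\<close>-th product
  into \<open>t ^ N\<close>.
\<close>
lemma polyfuns_dependent:
  assumes V: "finite V" and h: "\<And>i. i \<le> card V \<Longrightarrow> polyfun V (h i)"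
  obtains P where "polyfun {..card V} P" "\<exists>y. P y \<noteq> 0" "\<And>x. P (\<lambda>i. h i x) = 0"
proof -
  define m where "m = card V"
  define s where "s = Suc m"
  have "\<exists>K. \<forall>i<s. polyfun_deg V K (h i)"
  proof -
    obtain K where K: "\<And>i. i < s \<Longrightarrow> polyfun_deg V (K i) (h i)"
      using polyfun_imp_deg[OF h] unfolding s_def m_def less_Suc_eq_le by metis
    have "polyfun_deg V (\<Sum>j<s. K j) (h i)" if "i < s" for i
      by (rule polyfun_deg_mono[OF K[OF that]]) (use that in \<open>auto intro: member_le_sum\<close>)
    then show ?thesis by blast
  qed
  then obtain K where K: "\<And>i. i < s \<Longrightarrow> polyfun_deg V K (h i)" by blast
  \<comment> \<open>chosen such that \<open>(s * K + 1) ^ m * B ^ m < B ^ s\<close>\<close>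
  define B where "B = (s * K + 1) ^ m + 1"
  define F where "F N y = (\<Prod>i<s. y i ^ (N div B ^ i mod B))" for N and y :: "nat \<Rightarrow> complex"
  have B: "0 < B" "(s * K + 1) ^ m < B" by (simp_all add: B_def)
  have "polyfun_deg V (s * (B * K)) (\<lambda>x. F N (\<lambda>i. h i x))" for N
  proof -
    have "polyfun_deg V (B * K) (\<lambda>x. h i x ^ (N div B ^ i mod B))" if "i < s" for i
      by (rule polyfun_deg_mono[OF polyfun_deg_power[OF K[OF that]]])
         (use B(1) in \<open>auto intro!: mult_right_mono less_imp_le\<close>)
    then show ?thesis
      using polyfun_deg_prod[of "{..<s}" V "B * K" "\<lambda>i x. h i x ^ (N div B ^ i mod B)"]
      by (auto simp: F_def)
  qed
  then obtain p where p: "\<And>N. Poly_Mapping.keys (p N) \<subseteq> exponents V (s * (B * K))"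
      "\<And>N. (\<lambda>x. F N (\<lambda>i. h i x)) = cpoly_eval (p N)"
    unfolding polyfun_deg_def by metis
  let ?T = "exponents V (s * (B * K))"
  have "card ?T \<le> (s * (B * K) + 1) ^ m"
    using card_exponents_le[OF V] by (simp add: m_def)
  also have "\<dots> \<le> ((s * K + 1) * B) ^ m"
    by (rule power_mono) (use B(1) in \<open>auto simp: algebra_simps\<close>)
  also have "\<dots> = (s * K + 1) ^ m * B ^ m" by (rule power_mult_distrib)
  also have "\<dots> < B * B ^ m" using B by (intro mult_strict_right_mono) auto
  also have "\<dots> = card {..<B ^ s}" by (simp add: s_def)
  finally have lt: "card ?T < card {..<B ^ s}" .
  obtain c where c: "\<exists>N\<in>{..<B ^ s}. c N \<noteq> 0"
      "\<forall>a\<in>?T. (\<Sum>N<B ^ s. Poly_Mapping.lookup (p N) a * c N) = 0"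
    using homogeneous_linear_system[OF finite_exponents[OF V] finite_lessThan lt,
      of "\<lambda>a N. Poly_Mapping.lookup (p N) a"] by blast
  define P where "P y = (\<Sum>N<B ^ s. c N * F N y)" for y
  have "P (\<lambda>i. h i x) = 0" for x
  proof -
    have "P (\<lambda>i. h i x) = (\<Sum>N<B ^ s. c N * cpoly_eval (p N) x)"
      using p(2) unfolding P_def by metis
    also have "\<dots> = (\<Sum>N<B ^ s. \<Sum>a\<in>?T. Poly_Mapping.lookup (p N) a * c N * monom_eval a x)"
      by (simp add: cpoly_eval_superset[OF finite_exponents[OF V] p(1)] sum_distrib_left mult_ac)
    also have "\<dots> = (\<Sum>a\<in>?T. (\<Sum>N<B ^ s. Poly_Mapping.lookup (p N) a * c N) * monom_eval a x)"
      by (subst sum.swap) (simp add: sum_distrib_right)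
    finally show ?thesis using c(2) by simp
  qed
  moreover have "polyfun {..m} P"
    unfolding P_def F_def by (intro polyfun_intros) (auto simp: s_def)
  moreover have "\<exists>y. P y \<noteq> 0"
  proof (rule ccontr)
    assume "\<not> (\<exists>y. P y \<noteq> 0)"
    then have z: "P y = 0" for y by simp
    define q where "q = (\<Sum>N<B ^ s. monom (c N) N)"
    have "poly q t = P (\<lambda>i. t ^ (B ^ i))" for t
    proof -
      have "F N (\<lambda>i. t ^ (B ^ i)) = t ^ N" if "N < B ^ s" for N
        using digit_expansion[OF that]
        by (simp add: F_def flip: power_mult power_sum)
      then show ?thesis by (simp add: q_def P_def poly_sum poly_monom)
    qed
    then have "q = 0" using z poly_all_0_iff_0[of q] by simp
    moreover have "coeff q N = c N" if "N < B ^ s" for N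
      using that by (simp add: q_def coeff_sum)
    ultimately show False using c(1) by auto
  qed
  ultimately show ?thesis using that unfolding m_def by blast
qed

section \<open>Closures in projective space and their cones\<close>

lemma proj_point_mem:
  "z \<in> proj_point I x \<longleftrightarrow> x \<in> homog_vectors I \<and> (\<exists>c. c \<noteq> 0 \<and> z = (\<lambda>i. c * x i))"
  by (auto simp: proj_point_def proj_rel_def homog_vectors_def)

lemma proj_point_in_proj_space: "x \<in> homog_vectors I \<Longrightarrow> proj_point I x \<in> proj_space I"
  unfolding proj_point_def proj_space_def by (rule quotientI)

lemma proj_space_cases:
  assumes "p \<in> proj_space I" "z \<in> p"
  shows "z \<in> homog_vectors I" "p = proj_point I z"
proof -
  obtain x where x: "x \<in> homog_vectors I" "p = proj_rel I `` {x}"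
    using assms(1) unfolding proj_space_def by (rule quotientE)
  then show "z \<in> homog_vectors I" using assms(2) by (auto simp: proj_rel_def)
  have "(x, z) \<in> proj_rel I" using x assms(2) by auto
  then show "p = proj_point I z"
    unfolding proj_point_def x(2) by (rule equiv_class_eq[OF equiv_proj_rel])
qed

lemma self_in_proj_point: "x \<in> homog_vectors I \<Longrightarrow> x \<in> proj_point I x"
  by (auto simp: proj_point_mem intro: exI[of _ 1])

lemma scale_in_class:
  assumes "p \<in> proj_space I" "z \<in> p" "c \<noteq> 0" shows "(\<lambda>i. c * z i) \<in> p"
  using proj_space_cases[OF assms(1,2)] assms(3) by (auto simp: proj_point_mem)

text \<open>
  The points of projective space are sets of vectors, so the affine cone over a set \<open>Z\<close> of points,
  without the origin, is just \<open>\<Union>Z\<close>.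
\<close>
abbreviation proj_closure :: "'v set \<Rightarrow> ('v \<Rightarrow> complex) set \<Rightarrow> ('v \<Rightarrow> complex) set set" where
  "proj_closure I S \<equiv> zariski_topology I closure_of (proj_point I ` S)"

lemma proj_point_in_zeros:
  assumes "x \<in> homog_vectors I" "F \<subseteq> homogeneous_polys I"
  shows "proj_point I x \<in> proj_zeros I F \<longleftrightarrow> (\<forall>f\<in>F. cpoly_eval f x = 0)"
proof
  assume "proj_point I x \<in> proj_zeros I F"
  then show "\<forall>f\<in>F. cpoly_eval f x = 0"
    using self_in_proj_point[OF assms(1)] by (auto simp: proj_zeros_def)
next
  assume z: "\<forall>f\<in>F. cpoly_eval f x = 0"
  have "cpoly_eval f y = 0" if "f \<in> F" "y \<in> proj_point I x" for f y
    using homogeneous_zero_on_class[OF _ proj_point_in_proj_space[OF assms(1)]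
        self_in_proj_point[OF assms(1)] that(2), of f] that z assms(2) by auto
  then show "proj_point I x \<in> proj_zeros I F"
    using proj_point_in_proj_space[OF assms(1)] by (auto simp: proj_zeros_def)
qed

lemma homogeneous_vanishes_on_closure:
  assumes S: "S \<subseteq> homog_vectors I" and f: "f \<in> homogeneous_polys I"
    and zero: "\<And>x. x \<in> S \<Longrightarrow> cpoly_eval f x = 0"
    and z: "z \<in> \<Union>(proj_closure I S)"
  shows "cpoly_eval f z = 0"
proof -
  have "proj_point I ` S \<subseteq> proj_zeros I {f}"
    using proj_point_in_zeros[of _ I "{f}"] S f zero by auto
  moreover have "closedin (zariski_topology I) (proj_zeros I {f})"
    unfolding closedin_zariski using f by blast
  ultimately have "proj_closure I S \<subseteq> proj_zeros I {f}" by (rule closure_of_minimal)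
  then show ?thesis using z by (auto simp: proj_zeros_def)
qed

text \<open>
  If \<open>f\<close> vanishes on all multiples of \<open>x\<close>, then it does so on a whole line through the origin, and
  hence each of its homogeneous components vanishes at \<open>x\<close>.
\<close>
lemma polyfun_vanishes_on_closure:
  assumes S: "S \<subseteq> homog_vectors I" and f: "polyfun I f"
    and zero: "\<And>x c. x \<in> S \<Longrightarrow> f (\<lambda>i. c * x i) = 0"
    and z: "z \<in> \<Union>(proj_closure I S)"
  shows "f z = 0"
proof -
  obtain D H where H: "\<And>e. H e \<in> homogeneous_polys I"
    "\<And>e c x. cpoly_eval (H e) (\<lambda>i. c * x i) = c ^ e * cpoly_eval (H e) x"
    "\<And>x. f x = (\<Sum>e\<le>D. cpoly_eval (H e) x)"
    by (rule polyfun_homogeneous_components[OF f]) (rule that)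
  have "cpoly_eval (H e) z = 0" if "e \<le> D" for e
  proof (rule homogeneous_vanishes_on_closure[OF S H(1) _ z])
    fix x assume x: "x \<in> S"
    define q where "q = (\<Sum>e\<le>D. monom (cpoly_eval (H e) x) e)"
    have "poly q c = 0" for c
      using zero[OF x, of c] by (simp add: q_def poly_sum poly_monom H(2,3) mult.commute)
    then have "q = 0" using poly_all_0_iff_0[of q] by blast
    moreover have "coeff q e = cpoly_eval (H e) x" using that by (simp add: q_def coeff_sum)
    ultimately show "cpoly_eval (H e) x = 0" by simp
  qed
  then show ?thesis by (simp add: H(3))
qed

lemma subset_Union_closure:
  assumes "S \<subseteq> homog_vectors I" "x \<in> S"
  shows "proj_point I x \<in> proj_closure I S" "x \<in> \<Union>(proj_closure I S)"
proof -
  have "proj_point I ` S \<subseteq> topspace (zariski_topology I)"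
    using assms(1) proj_point_in_proj_space by auto
  from closure_of_subset[OF this] show *: "proj_point I x \<in> proj_closure I S" using assms(2) by auto
  show "x \<in> \<Union>(proj_closure I S)"
    using * self_in_proj_point[of x I] assms by auto
qed

text \<open>
  A set in which any two points are joined by a polynomial curve is irreducible: two forms that do
  not vanish identically on it have a common nonzero on the curve that joins points where one of them
  is nonzero.
\<close>
lemma irreducible_closure:
  assumes S: "S \<subseteq> homog_vectors I" "S \<noteq> {}"
    and curve: "\<And>x y. x \<in> S \<Longrightarrow> y \<in> S \<Longrightarrow>
      \<exists>\<gamma>. (\<forall>i\<in>I. \<exists>p. \<forall>t. \<gamma> t i = poly p t) \<and> range \<gamma> \<subseteq> S \<and> \<gamma> 0 = x \<and> \<gamma> 1 = y"
  shows "irreducible_in (zariski_topology I) (proj_closure I S)"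
  unfolding irreducible_in_def
proof (intro conjI allI impI)
  show "proj_closure I S \<noteq> {}" using subset_Union_closure(1)[OF S(1)] S(2) by blast
  show "proj_closure I S \<subseteq> topspace (zariski_topology I)" by (rule closure_of_subset_topspace)
next
  fix A B
  assume AB: "closedin (zariski_topology I) A \<and> closedin (zariski_topology I) B \<and>
    proj_closure I S \<subseteq> A \<union> B"
  show "proj_closure I S \<subseteq> A \<or> proj_closure I S \<subseteq> B"
  proof (rule ccontr)
    assume "\<not> ?thesis"
    then have "\<not> proj_point I ` S \<subseteq> A" "\<not> proj_point I ` S \<subseteq> B"
      using AB closure_of_minimal by metis+
    then obtain x y where x: "x \<in> S" "proj_point I x \<notin> A" and y: "y \<in> S" "proj_point I y \<notin> B" by auto
    obtain F G where F: "F \<subseteq> homogeneous_polys I" "A = proj_zeros I F"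
      and G: "G \<subseteq> homogeneous_polys I" "B = proj_zeros I G"
      using AB unfolding closedin_zariski by blast
    obtain f where f: "f \<in> F" "cpoly_eval f x \<noteq> 0"
      using x S(1) proj_point_in_zeros[OF _ F(1)] F(2) by blast
    obtain g where g: "g \<in> G" "cpoly_eval g y \<noteq> 0"
      using y S(1) proj_point_in_zeros[OF _ G(1)] G(2) by blast
    obtain \<gamma> where \<gamma>: "\<forall>i\<in>I. \<exists>p. \<forall>t. \<gamma> t i = poly p t" "range \<gamma> \<subseteq> S" "\<gamma> 0 = x" "\<gamma> 1 = y"
      using curve[OF x(1) y(1)] by blast
    obtain t where t: "cpoly_eval f (\<gamma> t) \<noteq> 0" "cpoly_eval g (\<gamma> t) \<noteq> 0"
      using common_nonzero_on_curve[OF polyfun_homogeneous polyfun_homogeneous, of f I g \<gamma> 0 1]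
        f g F(1) G(1) \<gamma> by blast
    have "\<gamma> t \<in> S" using \<gamma>(2) by blast
    then have "proj_point I (\<gamma> t) \<in> A \<union> B"
      using subset_Union_closure(1)[OF S(1)] AB by blast
    moreover have "proj_point I (\<gamma> t) \<notin> A"
      using t f \<open>\<gamma> t \<in> S\<close> S(1) proj_point_in_zeros[OF _ F(1)] F(2) by blast
    moreover have "proj_point I (\<gamma> t) \<notin> B"
      using t g \<open>\<gamma> t \<in> S\<close> S(1) proj_point_in_zeros[OF _ G(1)] G(2) by blast
    ultimately show False by blast
  qed
qed

text \<open>
  The affine cone over an irreducible set is irreducible. Nonzero homogeneous components \<open>H d\<close> of \<open>f\<close>
  and \<open>K e\<close> of \<open>g\<close> have a common nonzero \<open>z\<close> by irreducibility; along the line through \<open>z\<close> the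
  functions \<open>f\<close> and \<open>g\<close> are then nonzero polynomials in one variable.
\<close>
lemma irreducible_cone_common_nonzero:
  assumes W: "irreducible_in (zariski_topology I) W"
    and f: "polyfun I f" and g: "polyfun I g"
    and nz: "x \<in> \<Union>W" "f x \<noteq> 0" "y \<in> \<Union>W" "g y \<noteq> 0"
  shows "\<exists>z\<in>\<Union>W. f z \<noteq> 0 \<and> g z \<noteq> 0"
proof -
  have WP: "W \<subseteq> proj_space I" using W by (auto simp: irreducible_in_def)
  obtain D H where H: "\<And>e. H e \<in> homogeneous_polys I"
    "\<And>e c x. cpoly_eval (H e) (\<lambda>i. c * x i) = c ^ e * cpoly_eval (H e) x"
    "\<And>x. f x = (\<Sum>e\<le>D. cpoly_eval (H e) x)"
    by (rule polyfun_homogeneous_components[OF f]) (rule that)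
  obtain E K where K: "\<And>e. K e \<in> homogeneous_polys I"
    "\<And>e c x. cpoly_eval (K e) (\<lambda>i. c * x i) = c ^ e * cpoly_eval (K e) x"
    "\<And>x. g x = (\<Sum>e\<le>E. cpoly_eval (K e) x)"
    by (rule polyfun_homogeneous_components[OF g]) (rule that)
  obtain d where d: "d \<le> D" "cpoly_eval (H d) x \<noteq> 0"
    using nz(2) unfolding H(3) by (auto dest: sum.not_neutral_contains_not_neutral)
  obtain e where e: "e \<le> E" "cpoly_eval (K e) y \<noteq> 0"
    using nz(4) unfolding K(3) by (auto dest: sum.not_neutral_contains_not_neutral)
  have "closedin (zariski_topology I) (proj_zeros I {H d})"
    "closedin (zariski_topology I) (proj_zeros I {K e})"
    unfolding closedin_zariski using H(1) K(1) by blast+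
  moreover have "\<not> W \<subseteq> proj_zeros I {H d}" "\<not> W \<subseteq> proj_zeros I {K e}"
    using nz d e by (auto simp: proj_zeros_def)
  ultimately have "\<not> W \<subseteq> proj_zeros I {H d} \<union> proj_zeros I {K e}"
    using W unfolding irreducible_in_def by blast
  then obtain p where p: "p \<in> W" "p \<notin> proj_zeros I {H d}" "p \<notin> proj_zeros I {K e}" by blast
  have pP: "p \<in> proj_space I" using p WP by blast
  then obtain z where z: "z \<in> p" using proj_space_nonempty_class by blast
  have zp: "z \<in> homog_vectors I" "p = proj_point I z" using proj_space_cases[OF pP z] by auto
  have "cpoly_eval (H d) z \<noteq> 0" "cpoly_eval (K e) z \<noteq> 0"
    using p(2,3) proj_point_in_zeros[OF zp(1)] H(1) K(1) zp(2) by auto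
  note nzz = this
  define q where "q = (\<Sum>e\<le>D. monom (cpoly_eval (H e) z) e)"
  define r where "r = (\<Sum>e\<le>E. monom (cpoly_eval (K e) z) e)"
  have "coeff q d \<noteq> 0" "coeff r e \<noteq> 0"
    using nzz d e by (simp_all add: q_def r_def coeff_sum)
  then have "q \<noteq> 0" "r \<noteq> 0" by auto
  then have "q * r * [:0, 1:] \<noteq> 0" by (intro no_zero_divisors) auto
  then obtain t where t: "poly (q * r * [:0, 1:]) t \<noteq> 0" using poly_all_0_iff_0 by blast
  have "f (\<lambda>i. t * z i) = poly q t" "g (\<lambda>i. t * z i) = poly r t"
    by (simp_all add: q_def r_def poly_sum poly_monom H(2,3) K(2,3) mult.commute)
  then have "f (\<lambda>i. t * z i) \<noteq> 0" "g (\<lambda>i. t * z i) \<noteq> 0" "t \<noteq> 0" using t by auto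
  moreover from \<open>t \<noteq> 0\<close> have "(\<lambda>i. t * z i) \<in> \<Union>W" using scale_in_class[OF pP z] p(1) by blast
  ultimately show ?thesis by blast
qed

section \<open>Algebraic independence on a set\<close>

definition alg_indep_on :: "'x set \<Rightarrow> nat \<Rightarrow> (nat \<Rightarrow> 'x \<Rightarrow> complex) \<Rightarrow> bool" where
  "alg_indep_on X s g \<longleftrightarrow>
     (\<forall>P. polyfun {..<s} P \<and> (\<exists>y. P y \<noteq> 0) \<longrightarrow> (\<exists>x\<in>X. P (\<lambda>i. g i x) \<noteq> 0))"

lemma alg_indep_onD:
  "alg_indep_on X s g \<Longrightarrow> polyfun {..<s} P \<Longrightarrow> P y \<noteq> 0 \<Longrightarrow> \<exists>x\<in>X. P (\<lambda>i. g i x) \<noteq> 0"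
  unfolding alg_indep_on_def by auto

text \<open>
  This is the step along a chain of irreducible closed sets. Expand \<open>P\<close> in its last variable, into
  which \<open>h\<close> is substituted, and divide by the largest possible power of it. The quotient \<open>R\<close>
  restricts on \<open>Z\<close>, where \<open>h = 0\<close>, to a nonzero polynomial in the functions \<open>g\<close>, so it is not
  identically zero there; irreducibility of \<open>W\<close> then yields a point where both \<open>R\<close> and \<open>h\<close> are nonzero.
\<close>
lemma alg_indep_on_extend:
  assumes ZW: "Z \<subseteq> W" and W: "irreducible_in (zariski_topology I) W"
    and indep: "alg_indep_on (\<Union>Z) s g" and g: "\<And>i. i < s \<Longrightarrow> polyfun I (g i)"
    and h: "polyfun I h" and hZ: "\<And>z. z \<in> \<Union>Z \<Longrightarrow> h z = 0" and hW: "w \<in> \<Union>W" "h w \<noteq> 0"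
  shows "alg_indep_on (\<Union>W) (Suc s) (g(s := h))"
  unfolding alg_indep_on_def
proof (intro allI impI)
  fix P :: "(nat \<Rightarrow> complex) \<Rightarrow> complex"
  assume P: "polyfun {..<Suc s} P \<and> (\<exists>y. P y \<noteq> 0)"
  then have "polyfun (insert s {..<s}) P" by (simp add: lessThan_Suc)
  then obtain D Q where Q: "\<And>i. polyfun {..<s} (Q i)" "\<And>y. P y = (\<Sum>i\<le>D. Q i y * y s ^ i)"
    by (rule polyfun_expand_in_variable) (rule that)
  have "\<exists>i. i \<le> D \<and> (\<exists>y. Q i y \<noteq> 0)"
  proof (rule ccontr)
    assume "\<not> ?thesis"
    then have "P y = 0" for y by (simp add: Q(2))
    then show False using P by blast
  qed
  then obtain a where a: "a \<le> D" "\<exists>y. Q a y \<noteq> 0" and min: "\<And>i y. i < a \<Longrightarrow> Q i y = 0"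
    using exists_least_iff[of "\<lambda>i. i \<le> D \<and> (\<exists>y. Q i y \<noteq> 0)"]
    by (metis le_trans less_imp_le)
  let ?G = "\<lambda>x. (\<lambda>i. (g(s := h)) i x)"
  define R where "R x = (\<Sum>i\<in>{a..D}. Q i (?G x) * h x ^ (i - a))" for x
  have factor: "P (?G x) = h x ^ a * R x" for x
  proof -
    have "P (?G x) = (\<Sum>i\<in>{a..D}. Q i (?G x) * h x ^ i)"
      unfolding Q(2) by (rule sum.mono_neutral_cong_right) (use min in auto)
    also have "\<dots> = (\<Sum>i\<in>{a..D}. h x ^ a * (Q i (?G x) * h x ^ (i - a)))"
      by (rule sum.cong) (simp_all flip: power_add)
    finally show ?thesis by (simp add: R_def sum_distrib_left)
  qed
  have QG: "Q i (?G x) = Q i (\<lambda>j. g j x)" for i x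
    by (rule polyfun_cong[OF Q(1)]) auto
  obtain y where "Q a y \<noteq> 0" using a(2) by blast
  from alg_indep_onD[OF indep Q(1) this]
  obtain z where z: "z \<in> \<Union>Z" "Q a (\<lambda>j. g j z) \<noteq> 0" by (rule bexE)
  have "R z = (\<Sum>i\<in>{a..D}. if i = a then Q a (\<lambda>j. g j z) else 0)"
    unfolding R_def QG using hZ[OF z(1)] by (intro sum.cong) auto
  then have "R z \<noteq> 0" using z(2) a(1) by simp
  moreover have "polyfun I R"
    unfolding R_def QG using g h by (intro polyfun_intros polyfun_compose[OF Q(1)]) auto
  moreover have "polyfun I (\<lambda>x. h x ^ a)" using h by (rule polyfun_power)
  moreover have "z \<in> \<Union>W" using z(1) ZW by blast
  ultimately obtain x where "x \<in> \<Union>W" "R x \<noteq> 0" "h x ^ a \<noteq> 0"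
    using irreducible_cone_common_nonzero[OF W, of R "\<lambda>x. h x ^ a" z w] hW by auto
  then show "\<exists>x\<in>\<Union>W. P (?G x) \<noteq> 0" using factor by auto
qed

text \<open>
  The start of the chain: the cone over a single point is a line, on which one coordinate takes all
  nonzero values.
\<close>
lemma alg_indep_on_coordinate:
  assumes p: "p \<in> proj_space I" "p \<in> Z" and z: "z \<in> p" "z i \<noteq> 0"
  shows "alg_indep_on (\<Union>Z) (Suc 0) (\<lambda>_ x. x i)"
  unfolding alg_indep_on_def
proof (intro allI impI)
  fix P :: "(nat \<Rightarrow> complex) \<Rightarrow> complex"
  assume P: "polyfun {..<Suc 0} P \<and> (\<exists>y. P y \<noteq> 0)"
  then obtain y where y: "P y \<noteq> 0" by blast
  have Peq: "P (\<lambda>_. y 0) = P y"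
    using P by (intro polyfun_cong[of "{..<Suc 0}" P]) auto
  have "\<exists>p. \<forall>t. t * z i = poly p t" by (rule exI[of _ "[:0, z i:]"]) simp
  moreover have "P (\<lambda>_. y 0 / z i * z i) \<noteq> 0" using z y Peq by simp
  ultimately obtain t where t: "t \<noteq> 0" "P (\<lambda>_. t * z i) \<noteq> 0"
    using common_nonzero_on_curve[of "{..<Suc 0}" P P "\<lambda>t _. t * z i" "y 0 / z i" "y 0 / z i" 0] P
    by auto
  have "(\<lambda>i. t * z i) \<in> \<Union>Z" using scale_in_class[OF p(1) z(1) t(1)] p(2) by blast
  then show "\<exists>x\<in>\<Union>Z. P (\<lambda>_. x i) \<noteq> 0" using t(2) by (intro bexI[of _ "\<lambda>i. t * z i"]) auto
qed

lemma chain_alg_indep: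
  assumes chain: "\<And>i. i \<le> r \<Longrightarrow> closedin (zariski_topology I) (Z i) \<and>
      irreducible_in (zariski_topology I) (Z i)" "\<And>i. i < r \<Longrightarrow> Z i \<subset> Z (Suc i)"
  shows "q \<le> r \<Longrightarrow> \<exists>g. (\<forall>i<Suc q. polyfun I (g i)) \<and> alg_indep_on (\<Union>(Z q)) (Suc q) g"
proof (induction q)
  case 0
  have "Z 0 \<noteq> {}" "Z 0 \<subseteq> proj_space I" using chain(1)[of 0] by (auto simp: irreducible_in_def)
  then obtain p where p: "p \<in> proj_space I" "p \<in> Z 0" by blast
  obtain z where z: "z \<in> p" using proj_space_nonempty_class[OF p(1)] by blast
  then obtain i where i: "z i \<noteq> 0" "i \<in> I"
    using proj_space_cases(1)[OF p(1) z] by (auto simp: homog_vectors_def)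
  have "alg_indep_on (\<Union>(Z 0)) (Suc 0) (\<lambda>_ x. x i)"
    by (rule alg_indep_on_coordinate[OF p z i(1)])
  moreover have "polyfun I (\<lambda>x. x i)" using i(2) by (rule polyfun.var)
  ultimately show ?case by (intro exI[of _ "\<lambda>_ x. x i"]) auto
next
  case (Suc q)
  then obtain g where g: "\<forall>i<Suc q. polyfun I (g i)" "alg_indep_on (\<Union>(Z q)) (Suc q) g" by auto
  have strict: "Z q \<subset> Z (Suc q)" using chain(2) Suc.prems by auto
  obtain F where F: "F \<subseteq> homogeneous_polys I" "Z q = proj_zeros I F"
    using chain(1)[of q] Suc.prems unfolding closedin_zariski by auto
  obtain p where p: "p \<in> Z (Suc q)" "p \<notin> Z q" using strict by blast
  have irr: "irreducible_in (zariski_topology I) (Z (Suc q))" using chain(1) Suc.prems by auto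
  then have "p \<in> proj_space I" using p(1) by (auto simp: irreducible_in_def)
  then obtain f w where f: "f \<in> F" "w \<in> p" "cpoly_eval f w \<noteq> 0"
    using p(2) unfolding F(2) proj_zeros_def by blast
  have h: "polyfun I (cpoly_eval f)" using f F(1) by (intro polyfun_homogeneous) auto
  have "alg_indep_on (\<Union>(Z (Suc q))) (Suc (Suc q)) (g(Suc q := cpoly_eval f))"
    by (rule alg_indep_on_extend[OF _ irr g(2) _ h, where w = w])
       (use strict g(1) f F(2) p(1) in \<open>auto simp: proj_zeros_def\<close>)
  moreover have "\<forall>i<Suc (Suc q). polyfun I ((g(Suc q := cpoly_eval f)) i)"
    using g(1) h by (auto simp: less_Suc_eq)
  ultimately show ?case by blast
qed

lemma alg_indep_on_bound:
  assumes indep: "alg_indep_on X s g" and g: "\<And>i. i < s \<Longrightarrow> polyfun I (g i)"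
    and V: "finite V" and \<Psi>: "\<And>i. i \<in> I \<Longrightarrow> polyfun V (\<lambda>u. \<Psi> u i)"
    and dominant: "\<And>f x. polyfun I f \<Longrightarrow> (\<And>u. f (\<Psi> u) = 0) \<Longrightarrow> x \<in> X \<Longrightarrow> f x = 0"
  shows "s \<le> card V"
proof (rule ccontr)
  assume "\<not> s \<le> card V"
  then have s: "card V < s" by simp
  have gV: "polyfun V (\<lambda>u. g i (\<Psi> u))" if "i \<le> card V" for i
    using that s g by (intro polyfun_compose[where f = "g i", OF _ \<Psi>]) auto
  obtain P where P: "polyfun {..card V} P" "\<exists>y. P y \<noteq> 0" "\<And>u. P (\<lambda>i. g i (\<Psi> u)) = 0"
    by (rule polyfuns_dependent[OF V, where h = "\<lambda>i u. g i (\<Psi> u)", OF gV]) (assumption, rule that)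
  have "polyfun {..<s} P" using P(1) s by (intro polyfun_mono[OF P(1)]) auto
  then obtain x where x: "x \<in> X" "P (\<lambda>i. g i x) \<noteq> 0"
    using alg_indep_onD[OF indep] P(2) by blast
  have "polyfun I (\<lambda>x. P (\<lambda>i. g i x))"
    using g s by (intro polyfun_compose[OF P(1)]) auto
  from dominant[OF this P(3) x(1)] x(2) show False by simp
qed

section \<open>The upper bound for the dimension\<close>

lemma irreducible_in_subtopology:
  assumes V: "closedin X V"
  shows "closedin (subtopology X V) Z \<and> irreducible_in (subtopology X V) Z \<longleftrightarrow>
    closedin X Z \<and> irreducible_in X Z \<and> Z \<subseteq> V"
proof -
  have c: "closedin (subtopology X V) A \<longleftrightarrow> closedin X A \<and> A \<subseteq> V" for A
    by (rule closedin_closed_subtopology[OF V])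
  have VX: "V \<subseteq> topspace X" by (rule closedin_subset[OF V])
  have "irreducible_in (subtopology X V) Z \<longleftrightarrow> irreducible_in X Z" if ZV: "Z \<subseteq> V"
  proof
    assume L: "irreducible_in (subtopology X V) Z"
    show "irreducible_in X Z"
      unfolding irreducible_in_def
    proof (intro conjI allI impI)
      show "Z \<noteq> {}" "Z \<subseteq> topspace X" using L ZV VX by (auto simp: irreducible_in_def)
      fix A B assume AB: "closedin X A \<and> closedin X B \<and> Z \<subseteq> A \<union> B"
      then have "closedin (subtopology X V) (A \<inter> V)" "closedin (subtopology X V) (B \<inter> V)"
        "Z \<subseteq> (A \<inter> V) \<union> (B \<inter> V)"
        using ZV V by (auto simp: c)
      then have "Z \<subseteq> A \<inter> V \<or> Z \<subseteq> B \<inter> V" using L unfolding irreducible_in_def by blast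
      then show "Z \<subseteq> A \<or> Z \<subseteq> B" by blast
    qed
  next
    assume "irreducible_in X Z"
    then show "irreducible_in (subtopology X V) Z"
      using ZV unfolding irreducible_in_def c by auto
  qed
  then show ?thesis using c by blast
qed

text \<open>
  The map \<open>\<Psi>\<close> parametrizes the cone over \<open>S\<close>, up to closure; its \<open>r + 1\<close> parameters include the
  scaling factor.
\<close>
theorem variety_dim_le:
  assumes S: "S \<subseteq> homog_vectors I"
    and V: "finite V" "card V = Suc r" and \<Psi>: "\<And>i. i \<in> I \<Longrightarrow> polyfun V (\<lambda>u. \<Psi> u i)"
    and dominant: "\<And>f x c. polyfun I f \<Longrightarrow> (\<And>u. f (\<Psi> u) = 0) \<Longrightarrow> x \<in> S \<Longrightarrow> f (\<lambda>i. c * x i) = 0"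
  shows "variety_dim I (proj_closure I S) \<le> enat r"
  unfolding variety_dim_def krull_dim_def
proof (rule Sup_least, clarify)
  fix q and Z :: "nat \<Rightarrow> ('a \<Rightarrow> complex) set set"
  let ?C = "proj_closure I S"
  assume Z: "\<forall>i\<le>q. closedin (subtopology (zariski_topology I) ?C) (Z i) \<and>
      irreducible_in (subtopology (zariski_topology I) ?C) (Z i)"
    and strict: "\<forall>i<q. Z i \<subset> Z (Suc i)"
  have "closedin (zariski_topology I) ?C" by (rule closedin_closure_of)
  then have Z': "closedin (zariski_topology I) (Z i)" "irreducible_in (zariski_topology I) (Z i)"
    "Z i \<subseteq> ?C" if "i \<le> q" for i
    using Z that irreducible_in_subtopology by metis+
  obtain g where g: "\<forall>i<Suc q. polyfun I (g i)" "alg_indep_on (\<Union>(Z q)) (Suc q) g"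
    using chain_alg_indep[of q I Z q] Z' strict by auto
  have "Suc q \<le> card V"
  proof (rule alg_indep_on_bound[OF g(2) _ V(1) \<Psi>])
    fix f x assume f: "polyfun I f" "\<And>u. f (\<Psi> u) = 0" and x: "x \<in> \<Union>(Z q)"
    have xC: "x \<in> \<Union>?C" using x Z'(3)[of q] by blast
    have "f (\<lambda>i. c * y i) = 0" if "y \<in> S" for c y
      using f that by (rule dominant)
    then show "f x = 0" using xC by - (rule polyfun_vanishes_on_closure[OF S f(1)], blast+)
  qed (use g(1) in auto)
  then show "enat q \<le> enat r" using V(2) by simp
qed

section \<open>Lower bounds from a triangular differential\<close>

text \<open>
  Near the origin a polynomial is governed by its homogeneous component \<open>G\<close> of lowest degree \<open>e\<close>. In
  the remainder \<open>R\<close> the variable \<open>None\<close> stands for \<open>t\<close>.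
\<close>
lemma polyfun_lowest_component:
  assumes P: "polyfun V P" and nz: "P y \<noteq> 0"
  obtains e G R where "polyfun V G" "\<exists>y. G y \<noteq> 0" "polyfun (insert None (Some ` V)) R"
    "\<And>t z. P (\<lambda>i. t * z i) = t ^ e * (G z + t * R (case_option t z))"
proof -
  obtain D H where H: "\<And>e. H e \<in> homogeneous_polys V"
    "\<And>e c x. cpoly_eval (H e) (\<lambda>i. c * x i) = c ^ e * cpoly_eval (H e) x"
    "\<And>x. P x = (\<Sum>e\<le>D. cpoly_eval (H e) x)"
    by (rule polyfun_homogeneous_components[OF P]) (rule that)
  have "\<exists>e. e \<le> D \<and> (\<exists>y. cpoly_eval (H e) y \<noteq> 0)"
  proof (rule ccontr)
    assume "\<not> ?thesis"
    then have "P y = 0" by (simp add: H(3))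
    then show False using nz by simp
  qed
  then obtain e where e: "e \<le> D" "\<exists>y. cpoly_eval (H e) y \<noteq> 0"
    and min: "\<And>i y. i < e \<Longrightarrow> cpoly_eval (H i) y = 0"
    using exists_least_iff[of "\<lambda>i. i \<le> D \<and> (\<exists>y. cpoly_eval (H i) y \<noteq> 0)"]
    by (metis le_trans less_imp_le)
  define R :: "('a option \<Rightarrow> complex) \<Rightarrow> complex"
    where "R z = (\<Sum>i\<in>{Suc e..D}. z None ^ (i - Suc e) * cpoly_eval (H i) (\<lambda>j. z (Some j)))" for z
  have "polyfun (insert None (Some ` V)) R"
    unfolding R_def
    by (intro polyfun_intros polyfun_compose[OF polyfun_homogeneous[OF H(1)]]) auto
  moreover have "P (\<lambda>i. t * z i) = t ^ e * (cpoly_eval (H e) z + t * R (case_option t z))" for t z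
  proof -
    have "P (\<lambda>i. t * z i) = (\<Sum>i\<in>{e..D}. t ^ i * cpoly_eval (H i) z)"
      unfolding H(2,3) by (rule sum.mono_neutral_right) (use min in auto)
    also have "\<dots> = t ^ e * cpoly_eval (H e) z + (\<Sum>i\<in>{Suc e..D}. t ^ i * cpoly_eval (H i) z)"
      using e(1) by (rule sum.atLeast_Suc_atMost)
    also have "(\<Sum>i\<in>{Suc e..D}. t ^ i * cpoly_eval (H i) z) =
        (\<Sum>i\<in>{Suc e..D}. t ^ e * t * (t ^ (i - Suc e) * cpoly_eval (H i) z))"
    proof (rule sum.cong)
      fix i assume "i \<in> {Suc e..D}"
      then have "t ^ i = t ^ (Suc e + (i - Suc e))" by simp
      then have "t ^ i = t ^ e * t * t ^ (i - Suc e)" unfolding power_add power_Suc2 .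
      then show "t ^ i * cpoly_eval (H i) z = t ^ e * t * (t ^ (i - Suc e) * cpoly_eval (H i) z)"
        by simp
    qed simp
    also have "\<dots> = t ^ e * t * R (case_option t z)"
      by (simp add: R_def sum_distrib_left)
    finally show ?thesis by (simp add: algebra_simps)
  qed
  ultimately show ?thesis using that[of "cpoly_eval (H e)" R e] e(2) polyfun_homogeneous[OF H(1)] by blast
qed

lemma polyfun_tendsto:
  assumes "polyfun V f" "\<And>i. i \<in> V \<Longrightarrow> ((\<lambda>t. g t i) \<longlongrightarrow> l i) F"
  shows "((\<lambda>t. f (g t)) \<longlongrightarrow> f l) F"
  using assms by (induction rule: polyfun.induct) (auto intro!: tendsto_intros)

text \<open>
  Back substitution, from the last of the \<open>q\<close> equations to the first: changing \<open>u k\<close> does not disturb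
  the equations after the \<open>k\<close>-th. The first \<open>q\<close> equations are solved by a vector in the span of the
  first \<open>q\<close> coordinates, so one matrix serves all coordinate subspaces.
\<close>
lemma triangular_solve:
  fixes L :: "nat \<Rightarrow> (nat \<Rightarrow> complex) \<Rightarrow> complex"
  assumes upd: "\<And>j k u c. j < r \<Longrightarrow> k < r \<Longrightarrow> L j (u(k := u k + c)) = L j u + c * T j k"
    and tri: "\<And>j k. k < j \<Longrightarrow> j < r \<Longrightarrow> T j k = 0" and diag: "\<And>j. j < r \<Longrightarrow> T j j \<noteq> 0"
    and q: "q \<le> r"
  shows "\<exists>u. (\<forall>k\<ge>q. u k = 0) \<and> (\<forall>j<q. L j u = v j)"
proof -
  have "s \<le> q \<Longrightarrow> \<exists>u. (\<forall>k\<ge>q. u k = 0) \<and> (\<forall>j<q. q - s \<le> j \<longrightarrow> L j u = v j)" for s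
  proof (induction s)
    case 0
    then show ?case by (intro exI[of _ "\<lambda>_. 0"]) auto
  next
    case (Suc s)
    then obtain u where u: "\<forall>k\<ge>q. u k = 0" "\<forall>j<q. q - s \<le> j \<longrightarrow> L j u = v j" by auto
    define k where "k = q - Suc s"
    have k: "k < q" "k < r" using Suc.prems q by (auto simp: k_def)
    define c where "c = (v k - L k u) / T k k"
    have "L j (u(k := u k + c)) = v j" if "j < q" "k \<le> j" for j
    proof (cases "j = k")
      case True
      then show ?thesis using upd[of k k u c] k diag[of k] by (simp add: c_def)
    next
      case False
      then have "q - s \<le> j" "k < j" using that by (auto simp: k_def)
      then show ?thesis using upd[of j k u c] tri[of k j] that k q u(2) by auto
    qed
    moreover have "\<forall>i\<ge>q. (u(k := u k + c)) i = 0" using u(1) k(1) by auto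
    ultimately show ?case unfolding k_def[symmetric] by blast
  qed
  from this[of q] show ?thesis by auto
qed

text \<open>
  Independence of the differentials at one point implies algebraic independence. Let \<open>G\<close> be the lowest
  homogeneous component of \<open>P\<close> at the base value \<open>c = h 0\<close>, of degree \<open>e\<close>. Then \<open>P (h (t * u)) / t ^ e\<close>
  tends to \<open>G (L u)\<close> as \<open>t\<close> tends to \<open>0\<close>, and \<open>u\<close> can be chosen such that this limit is nonzero.
\<close>
lemma alg_indep_on_linear_part:
  fixes h :: "nat \<Rightarrow> (nat \<Rightarrow> complex) \<Rightarrow> complex"
  assumes cone: "\<And>u t. u \<in> E \<Longrightarrow> (\<lambda>i. t * u i) \<in> E"
    and deriv: "\<And>u j. u \<in> E \<Longrightarrow> j < q \<Longrightarrow>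
      ((\<lambda>t. h j (\<lambda>i. t * u i)) has_field_derivative L j u) (at 0)"
    and surj: "\<And>v. \<exists>u\<in>E. \<forall>j<q. L j u = v j"
  shows "alg_indep_on E q h"
  unfolding alg_indep_on_def
proof (intro allI impI)
  fix P :: "(nat \<Rightarrow> complex) \<Rightarrow> complex"
  assume P: "polyfun {..<q} P \<and> (\<exists>y. P y \<noteq> 0)"
  then obtain y where y: "P y \<noteq> 0" by blast
  define c where "c j = h j (\<lambda>_. 0)" for j
  define P0 where "P0 x = P (\<lambda>i. c i + x i)" for x
  have P0: "polyfun {..<q} P0"
    unfolding P0_def
    by (rule polyfun_compose[of "{..<q}" P]) (use P in \<open>auto intro!: polyfun_intros\<close>)
  have "P0 (\<lambda>i. y i - c i) \<noteq> 0" using y by (simp add: P0_def)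
  then obtain e G R where G: "polyfun {..<q} G" "\<exists>y. G y \<noteq> 0"
    and R: "polyfun (insert None (Some ` {..<q})) R"
    and eq: "\<And>t z. P0 (\<lambda>i. t * z i) = t ^ e * (G z + t * R (case_option t z))"
    by (rule polyfun_lowest_component[OF P0]) (rule that)
  obtain v where v: "G v \<noteq> 0" using G(2) by blast
  obtain u where u: "u \<in> E" "\<forall>j<q. L j u = v j" using surj by blast
  define z where "z t j = (h j (\<lambda>i. t * u i) - c j) / t" for t j
  have z: "((\<lambda>t. z t j) \<longlongrightarrow> v j) (at 0)" if "j < q" for j
    using deriv[OF u(1) that] u(2) that unfolding has_field_derivative_iff
    by (simp add: z_def c_def)
  have "((\<lambda>t. G (z t) + t * R (case_option t (z t))) \<longlongrightarrow> G v + 0 * R (case_option 0 v)) (at 0)"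
    by (intro tendsto_add tendsto_mult tendsto_ident_at polyfun_tendsto[OF G(1)] polyfun_tendsto[OF R])
       (auto intro: z)
  then have "eventually (\<lambda>t. G (z t) + t * R (case_option t (z t)) \<noteq> 0) (at 0)"
    using v by (intro tendsto_imp_eventually_ne) auto
  then have "eventually (\<lambda>t. G (z t) + t * R (case_option t (z t)) \<noteq> 0 \<and> t \<noteq> 0) (at 0)"
    by (intro eventually_conj eventually_neq_at_within)
  then obtain t where t: "G (z t) + t * R (case_option t (z t)) \<noteq> 0" "t \<noteq> 0"
    using eventually_happens[of _ "at (0 :: complex)"] by auto
  have "P (\<lambda>j. h j (\<lambda>i. t * u i)) = P0 (\<lambda>j. t * z t j)"
    using t(2) by (simp add: P0_def z_def)
  then have "P (\<lambda>j. h j (\<lambda>i. t * u i)) \<noteq> 0" using eq[of t "z t"] t by simp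
  then show "\<exists>x\<in>E. P (\<lambda>i. h i x) \<noteq> 0" using cone[OF u(1)] by blast
qed

text \<open>
  Passing from the chart to the cone adds one independent function, the coordinate \<open>i0\<close>, which records
  the scaling factor. Fixing it at a suitable nonzero value \<open>c\<close> reduces a relation on the cone to one on
  the chart.
\<close>
lemma alg_indep_on_cone:
  assumes indep: "alg_indep_on E q (\<lambda>j u. g j (\<phi> u))"
    and lin: "\<And>j c x. j < q \<Longrightarrow> g j (\<lambda>i. c * x i) = c * g j x"
    and i0: "\<And>u. u \<in> E \<Longrightarrow> \<phi> u i0 = 1"
  shows "alg_indep_on {\<lambda>i. c * \<phi> u i |c u. u \<in> E \<and> c \<noteq> 0} (Suc q) (g(q := \<lambda>x. x i0))"
  unfolding alg_indep_on_def
proof (intro allI impI)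
  fix P :: "(nat \<Rightarrow> complex) \<Rightarrow> complex"
  assume P: "polyfun {..<Suc q} P \<and> (\<exists>y. P y \<noteq> 0)"
  then obtain y where y: "P y \<noteq> 0" by blast
  have "\<exists>p. \<forall>t. (y(q := t)) i = poly p t" for i
  proof (cases "i = q")
    case True
    then show ?thesis by (intro exI[of _ "[:0, 1:]"]) simp
  next
    case False
    then show ?thesis by (intro exI[of _ "[:y i:]"]) simp
  qed
  then obtain c where c: "c \<noteq> 0" "P (y(q := c)) \<noteq> 0"
    using common_nonzero_on_curve[of "{..<Suc q}" P P "\<lambda>t. y(q := t)" "y q" "y q" 0] P y by auto
  define Pc where "Pc x = P (\<lambda>i. if i = q then c else c * x i)" for x
  have "polyfun {..<q} (\<lambda>x. if i = q then c else c * x i)" if "i < Suc q" for i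
    using that by (cases "i = q") (auto intro!: polyfun_intros)
  then have "polyfun {..<q} Pc"
    unfolding Pc_def by - (rule polyfun_compose[of "{..<Suc q}" P], use P in auto)
  moreover have "(\<lambda>i. if i = q then c else c * (y i / c)) = y(q := c)" using c(1) by auto
  then have "Pc (\<lambda>i. y i / c) \<noteq> 0" using c by (simp add: Pc_def)
  ultimately have "\<exists>u\<in>E. Pc (\<lambda>j. g j (\<phi> u)) \<noteq> 0"
    by (rule alg_indep_onD[OF indep])
  then obtain u where u: "u \<in> E" "Pc (\<lambda>j. g j (\<phi> u)) \<noteq> 0" by (rule bexE)
  have "P (\<lambda>i. (g(q := \<lambda>x. x i0)) i (\<lambda>i. c * \<phi> u i)) = Pc (\<lambda>j. g j (\<phi> u))"
    unfolding Pc_def using P lin i0[OF u(1)] by (intro polyfun_cong[of "{..<Suc q}" P]) auto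
  with u c(1) show "\<exists>x\<in>{\<lambda>i. c * \<phi> u i |c u. u \<in> E \<and> c \<noteq> 0}. P (\<lambda>i. (g(q := \<lambda>x. x i0)) i x) \<noteq> 0"
    by (intro bexI[of _ "\<lambda>i. c * \<phi> u i"]) auto
qed

definition coord_subspace :: "nat \<Rightarrow> (nat \<Rightarrow> complex) set" where
  "coord_subspace q = {u. \<forall>k\<ge>q. u k = 0}"

text \<open>
  A polynomial map \<open>\<phi>\<close> into the chart given by \<open>i0\<close>, with linear forms \<open>g\<close> whose pullbacks have the
  differentials \<open>L\<close> at the origin. The matrix of \<open>L\<close> is \<open>T\<close>; its triangular shape ensures that the
  leading \<open>q\<close> by \<open>q\<close> block is invertible for every \<open>q\<close>.
\<close>
locale triangular_parametrization =
  fixes I :: "'v set" and i0 :: 'v and r :: nat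
    and \<phi> :: "(nat \<Rightarrow> complex) \<Rightarrow> 'v \<Rightarrow> complex"
    and g :: "nat \<Rightarrow> ('v \<Rightarrow> complex) \<Rightarrow> complex"
    and L :: "nat \<Rightarrow> (nat \<Rightarrow> complex) \<Rightarrow> complex" and T :: "nat \<Rightarrow> nat \<Rightarrow> complex"
  assumes i0: "i0 \<in> I" and \<phi>_i0: "\<And>u. \<phi> u i0 = 1" and \<phi>_supp: "\<And>u i. i \<notin> I \<Longrightarrow> \<phi> u i = 0"
    and \<phi>_poly: "\<And>i. i \<in> I \<Longrightarrow> polyfun {..<r} (\<lambda>u. \<phi> u i)"
    and g_poly: "\<And>j. j < r \<Longrightarrow> polyfun I (g j)"
    and g_lin: "\<And>j c x. j < r \<Longrightarrow> g j (\<lambda>i. c * x i) = c * g j x"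
    and deriv: "\<And>u j. j < r \<Longrightarrow>
      ((\<lambda>t. g j (\<phi> (\<lambda>i. t * u i))) has_field_derivative L j u) (at 0)"
    and upd: "\<And>j k u c. j < r \<Longrightarrow> k < r \<Longrightarrow> L j (u(k := u k + c)) = L j u + c * T j k"
    and tri: "\<And>j k. k < j \<Longrightarrow> j < r \<Longrightarrow> T j k = 0" and diag: "\<And>j. j < r \<Longrightarrow> T j j \<noteq> 0"
begin

lemma \<phi>_homog: "\<phi> ` E \<subseteq> homog_vectors I"
proof -
  have "\<exists>i. \<phi> u i \<noteq> 0" for u using \<phi>_i0[of u] by (intro exI[of _ i0]) simp
  then show ?thesis using \<phi>_supp by (auto simp: homog_vectors_def)
qed

lemma indep_on_coord_subspace:
  assumes "q \<le> r" shows "alg_indep_on (coord_subspace q) q (\<lambda>j u. g j (\<phi> u))"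
proof (rule alg_indep_on_linear_part)
  show "\<exists>u\<in>coord_subspace q. \<forall>j<q. L j u = v j" for v
    using triangular_solve[of r L T q v] upd tri diag assms unfolding coord_subspace_def by blast
  show "((\<lambda>t. g j (\<phi> (\<lambda>i. t * u i))) has_field_derivative L j u) (at 0)" if "j < q" for u j
    using that assms by (intro deriv) auto
qed (auto simp: coord_subspace_def)

definition stratum :: "nat \<Rightarrow> ('v \<Rightarrow> complex) set set" where
  "stratum q = proj_closure I (\<phi> ` coord_subspace q)"

lemma \<phi>_line: "\<exists>p. \<forall>t. \<phi> (\<lambda>k. u k + t * w k) i = poly p t" if "i \<in> I"
proof -
  show ?thesis
    by (rule polyfun_along_curve[OF \<phi>_poly[OF that]]) (rule line_coordinate_poly)
qed

lemma irreducible_stratum: "irreducible_in (zariski_topology I) (stratum q)"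
  unfolding stratum_def
proof (rule irreducible_closure[OF \<phi>_homog])
  show "\<phi> ` coord_subspace q \<noteq> {}" by (auto simp: coord_subspace_def)
  fix x y assume "x \<in> \<phi> ` coord_subspace q" "y \<in> \<phi> ` coord_subspace q"
  then obtain u v where uv: "u \<in> coord_subspace q" "x = \<phi> u" "v \<in> coord_subspace q" "y = \<phi> v" by blast
  show "\<exists>\<gamma>. (\<forall>i\<in>I. \<exists>p. \<forall>t. \<gamma> t i = poly p t) \<and> range \<gamma> \<subseteq> \<phi> ` coord_subspace q \<and> \<gamma> 0 = x \<and> \<gamma> 1 = y"
    using \<phi>_line[of _ u "\<lambda>k. v k - u k"] uv
    by (intro exI[of _ "\<lambda>t. \<phi> (\<lambda>k. u k + t * (v k - u k))"])
       (auto simp: coord_subspace_def intro!: imageI)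
qed

text \<open>
  The cone over the image of the \<open>q\<close>-dimensional coordinate subspace is dominated by \<open>q + 1\<close> parameters.
\<close>
lemma stratum_indep_le:
  assumes indep: "alg_indep_on (\<Union>(stratum q)) s G" and G: "\<And>j. j < s \<Longrightarrow> polyfun I (G j)"
    and q: "q \<le> r"
  shows "s \<le> Suc q"
proof -
  \<comment> \<open>the first \<open>q\<close> variables are the coordinates, and \<open>u q\<close> is the scaling factor\<close>
  define \<Psi> where "\<Psi> u i = u q * \<phi> (\<lambda>k. if k < q then u k else 0) i" for u i
  have "polyfun {..<Suc q} (\<lambda>u. if k < q then u k else 0)" for k
    by (cases "k < q") (auto intro: polyfun_intros)
  then have \<Psi>: "polyfun {..<Suc q} (\<lambda>u. \<Psi> u i)" if "i \<in> I" for i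
    unfolding \<Psi>_def by (intro polyfun_intros polyfun_compose[OF \<phi>_poly[OF that]]) auto
  have "s \<le> card {..<Suc q}"
  proof (rule alg_indep_on_bound[OF indep G _ \<Psi>])
    fix f x assume f: "polyfun I f" "\<And>u. f (\<Psi> u) = 0" and x: "x \<in> \<Union>(stratum q)"
    have zero: "f (\<lambda>i. c * y i) = 0" if y: "y \<in> \<phi> ` coord_subspace q" for c y
    proof -
      obtain u where u: "u \<in> coord_subspace q" "y = \<phi> u" using y by blast
      have "(\<lambda>k. if k < q then (u(q := c)) k else 0) = u" using u(1) by (auto simp: coord_subspace_def)
      then have "\<Psi> (u(q := c)) = (\<lambda>i. c * y i)" by (simp add: \<Psi>_def u(2) fun_eq_iff)
      then show ?thesis using f(2) by metis
    qed
    show "f x = 0"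
      by (rule polyfun_vanishes_on_closure[OF \<phi>_homog f(1) _ x[unfolded stratum_def]]) (rule zero)
  qed auto
  then show ?thesis by simp
qed

lemma stratum_indep:
  assumes q: "q \<le> r"
  shows "alg_indep_on (\<Union>(stratum q)) (Suc q) (g(q := \<lambda>x. x i0))"
proof -
  have "alg_indep_on {\<lambda>i. c * \<phi> u i |c u. u \<in> coord_subspace q \<and> c \<noteq> 0} (Suc q) (g(q := \<lambda>x. x i0))"
    by (rule alg_indep_on_cone[where g = g and \<phi> = \<phi>, OF indep_on_coord_subspace[OF q]])
       (use q g_lin \<phi>_i0 in auto)
  moreover have "{\<lambda>i. c * \<phi> u i |c u. u \<in> coord_subspace q \<and> c \<noteq> 0} \<subseteq> \<Union>(stratum q)"
  proof clarify
    fix c :: complex and u assume u: "u \<in> coord_subspace q" and c: "c \<noteq> 0"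
    have h: "\<phi> u \<in> homog_vectors I" using \<phi>_homog[of UNIV] by auto
    have "proj_point I (\<phi> u) \<in> stratum q"
      using subset_Union_closure(1)[OF \<phi>_homog] u unfolding stratum_def by blast
    moreover have "(\<lambda>i. c * \<phi> u i) \<in> proj_point I (\<phi> u)"
      using h c by (auto simp: proj_point_mem)
    ultimately show "(\<lambda>i. c * \<phi> u i) \<in> \<Union>(stratum q)" by blast
  qed
  ultimately show ?thesis unfolding alg_indep_on_def by (meson subsetD)
qed

lemma stratum_strict:
  assumes "q < r" shows "stratum q \<subset> stratum (Suc q)"
proof
  show "stratum q \<subseteq> stratum (Suc q)"
    unfolding stratum_def by (intro closure_of_mono image_mono) (auto simp: coord_subspace_def)
  show "stratum q \<noteq> stratum (Suc q)"
  proof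
    assume eq: "stratum q = stratum (Suc q)"
    have "alg_indep_on (\<Union>(stratum q)) (Suc (Suc q)) (g(Suc q := \<lambda>x. x i0))"
      using stratum_indep[of "Suc q"] assms eq by simp
    moreover have "polyfun I ((g(Suc q := \<lambda>x. x i0)) j)" if "j < Suc (Suc q)" for j
      using that assms g_poly i0 by (auto intro: polyfun.var)
    ultimately have "Suc (Suc q) \<le> Suc q" using assms by (intro stratum_indep_le) auto
    then show False by simp
  qed
qed

text \<open>
  The closures \<open>stratum 0, \<dots>, stratum r\<close> are the chain. They differ because their cones carry
  different numbers of independent functions.
\<close>
theorem variety_dim_ge:
  assumes S: "range \<phi> \<subseteq> S"
  shows "enat r \<le> variety_dim I (proj_closure I S)"
  unfolding variety_dim_def krull_dim_def
proof (rule Sup_upper, rule CollectI, intro exI conjI allI impI)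
  show "enat r = enat r" ..
  fix q
  let ?C = "proj_closure I S"
  have "stratum q \<subseteq> ?C"
    unfolding stratum_def using S by (intro closure_of_mono image_mono) auto
  moreover have "closedin (zariski_topology I) (stratum q)"
    unfolding stratum_def by (rule closedin_closure_of)
  ultimately have *: "closedin (subtopology (zariski_topology I) ?C) (stratum q) \<and>
      irreducible_in (subtopology (zariski_topology I) ?C) (stratum q)"
    using irreducible_stratum irreducible_in_subtopology[OF closedin_closure_of] by metis
  then show "closedin (subtopology (zariski_topology I) ?C) (stratum q)"
    "irreducible_in (subtopology (zariski_topology I) ?C) (stratum q)" by auto
next
  fix q assume "q < r"
  then show "stratum q \<subset> stratum (Suc q)" by (rule stratum_strict)
qed

text \<open>
  The parameter \<open>u j\<close> and the \<open>r\<close> functions \<open>g i (\<phi> u)\<close> are \<open>r + 1\<close> polynomials in \<open>r\<close> variables, so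
  they satisfy a relation. Read as a polynomial in \<open>u j\<close>, it has a coefficient \<open>q\<close> that is not the
  zero polynomial; wherever the value of \<open>q\<close> is nonzero, \<open>u j\<close> is one of finitely many roots.
\<close>
lemma parameter_generically_finite:
  assumes "j < r"
  shows "\<exists>q. polyfun {..<r} q \<and> (\<exists>y. q y \<noteq> 0) \<and>
    (\<forall>v. q (\<lambda>i. g i (\<phi> v)) \<noteq> 0 \<longrightarrow> finite ((\<lambda>u. u j) ` {u. \<phi> u = \<phi> v}))"
proof -
  define h where "h i u = (if i = r then u j else g i (\<phi> u))" for i and u :: "nat \<Rightarrow> complex"
  have h: "polyfun {..<r} (h i)" if "i \<le> card {..<r}" for i
    using that assms unfolding h_def
    by (cases "i = r") (auto intro!: polyfun.var polyfun_compose[OF g_poly] \<phi>_poly)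
  obtain P where P: "polyfun {..card {..<r}} P" "\<exists>y. P y \<noteq> 0" "\<And>u. P (\<lambda>i. h i u) = 0"
    by (rule polyfuns_dependent[of "{..<r}", OF _ h]) (auto intro: that)
  have "{..card {..<r}} = insert r {..<r}" by auto
  with P(1) have "polyfun (insert r {..<r}) P" by simp
  then obtain D Q where Q: "\<And>i. polyfun {..<r} (Q i)" "\<And>y. P y = (\<Sum>i\<le>D. Q i y * y r ^ i)"
    by (rule polyfun_expand_in_variable) (rule that)
  have "\<exists>a\<le>D. \<exists>y. Q a y \<noteq> 0"
  proof (rule ccontr)
    assume "\<not> ?thesis"
    then have "P y = 0" for y by (simp add: Q(2))
    then show False using P(2) by blast
  qed
  then obtain a where a: "a \<le> D" "\<exists>y. Q a y \<noteq> 0" by blast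
  have root: "(\<Sum>i\<le>D. Q i (\<lambda>i. g i (\<phi> u)) * u j ^ i) = 0" for u
  proof -
    have "Q i (\<lambda>i. h i u) = Q i (\<lambda>i. g i (\<phi> u))" for i
      by (rule polyfun_cong[OF Q(1)]) (simp add: h_def)
    then show ?thesis using P(3)[of u] by (simp add: Q(2)) (simp add: h_def)
  qed
  have "finite ((\<lambda>u. u j) ` {u. \<phi> u = \<phi> v})" if v: "Q a (\<lambda>i. g i (\<phi> v)) \<noteq> 0" for v
  proof -
    define p where "p = (\<Sum>i\<le>D. monom (Q i (\<lambda>i. g i (\<phi> v))) i)"
    have "coeff p a \<noteq> 0" using v a(1) by (simp add: p_def coeff_sum)
    then have "p \<noteq> 0" by auto
    then have "finite {z. poly p z = 0}" by (rule poly_roots_finite)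
    moreover have "poly p (u j) = 0" if "\<phi> u = \<phi> v" for u
      using root[of u] that by (simp add: p_def poly_sum poly_monom)
    then have "(\<lambda>u. u j) ` {u. \<phi> u = \<phi> v} \<subseteq> {z. poly p z = 0}" by auto
    ultimately show ?thesis by (rule rev_finite_subset)
  qed
  then show ?thesis using Q(1)[of a] a(2) by blast
qed

text \<open>
  Multiply the polynomials \<open>q\<close> that belong to the single parameters and homogenize the product to a
  form \<open>H\<close>. Independence of the functions \<open>g\<close> shows that \<open>H\<close> does not vanish identically on the
  image, so its nonzeros are a dense open subset of the irreducible closure, and over this subset
  every parameter takes only finitely many values.
\<close>
theorem generically_finite:
  assumes \<theta>: "A = \<theta> ` coord_subspace r"
    and F: "\<And>u. u \<in> coord_subspace r \<Longrightarrow> F (\<theta> u) = proj_point I (\<phi> u)"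
  shows "generically_finite_to_one A (zariski_topology I) F"
proof -
  have "\<forall>j\<in>{..<r}. \<exists>q. polyfun {..<r} q \<and> (\<exists>y. q y \<noteq> 0) \<and>
    (\<forall>v. q (\<lambda>i. g i (\<phi> v)) \<noteq> 0 \<longrightarrow> finite ((\<lambda>u. u j) ` {u. \<phi> u = \<phi> v}))"
    using parameter_generically_finite by simp
  from bchoice[OF this] obtain Q where Q: "\<And>j. j < r \<Longrightarrow> polyfun {..<r} (Q j)"
    "\<And>j. j < r \<Longrightarrow> \<exists>y. Q j y \<noteq> 0"
    "\<And>j v. j < r \<Longrightarrow> Q j (\<lambda>i. g i (\<phi> v)) \<noteq> 0 \<Longrightarrow> finite ((\<lambda>u. u j) ` {u. \<phi> u = \<phi> v})"
    by auto
  define q where "q y = (\<Prod>j<r. Q j y)" for y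
  have q: "polyfun {..<r} q" unfolding q_def by (intro polyfun_intros Q(1)) auto
  have "\<exists>y. q y \<noteq> 0" unfolding q_def by (rule polyfun_prod_nonzero[of _ "{..<r}"]) (use Q(1,2) in auto)
  then obtain u0 where u0: "u0 \<in> coord_subspace r" "q (\<lambda>j. g j (\<phi> u0)) \<noteq> 0"
    using alg_indep_onD[OF indep_on_coord_subspace[OF order.refl] q] by blast
  have "polyfun I (\<lambda>x. q (\<lambda>j. g j x))" using g_poly by (intro polyfun_compose[OF q]) auto
  then obtain H where H: "H \<in> homogeneous_polys I" "\<And>x. x i0 = 1 \<Longrightarrow> cpoly_eval H x = q (\<lambda>j. g j x)"
    using polyfun_homogenize[OF _ i0] by metis
  have FA: "F ` A = proj_point I ` (\<phi> ` coord_subspace r)"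
    unfolding \<theta> image_image using F by (intro image_cong) auto
  define C where "C = proj_closure I (\<phi> ` coord_subspace r)"
  define B where "B = proj_zeros I {H}"
  define U where "U = C - B"
  let ?W = "subtopology (zariski_topology I) C"
  have clC: "closedin (zariski_topology I) C" unfolding C_def by (rule closedin_closure_of)
  have clB: "closedin (zariski_topology I) B" unfolding B_def closedin_zariski using H(1) by blast
  have topW: "topspace ?W = C" using closedin_subset[OF clC] by auto
  have "openin ?W U"
    unfolding openin_closedin_eq topW U_def
    using clB clC closedin_closed_subtopology[OF clC, of "C \<inter> B"] by (auto simp: Diff_Diff_Int)
  moreover have "?W closure_of U = topspace ?W"
  proof -
    let ?A = "?W closure_of U"
    have clA: "closedin (zariski_topology I) ?A" "?A \<subseteq> C"
      using closedin_closed_subtopology[OF clC, of ?A] closedin_closure_of[of ?W U] by auto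
    have "U \<subseteq> ?A" by (rule closure_of_subset) (unfold topW U_def, blast)
    then have "C \<subseteq> ?A \<union> B" by (auto simp: U_def)
    moreover have "irreducible_in (zariski_topology I) C"
      using irreducible_stratum[of r] unfolding stratum_def C_def .
    moreover have "\<not> C \<subseteq> B"
    proof -
      have "proj_point I (\<phi> u0) \<in> C" unfolding C_def
        using subset_Union_closure(1)[OF \<phi>_homog] u0(1) by blast
      moreover have "proj_point I (\<phi> u0) \<notin> B" unfolding B_def
        using proj_point_in_zeros[of "\<phi> u0" I "{H}"] \<phi>_homog[of UNIV] H u0(2) \<phi>_i0 by auto
      ultimately show ?thesis by blast
    qed
    ultimately have "C \<subseteq> ?A" using clA(1) clB unfolding irreducible_in_def by blast
    then show ?thesis unfolding topW using clA(2) by blast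
  qed
  moreover have "finite {x \<in> A. F x = p}" if p: "p \<in> U" for p
  proof (cases "\<exists>u\<in>coord_subspace r. proj_point I (\<phi> u) = p")
    case False
    then have "{x \<in> A. F x = p} = {}" using F by (auto simp: \<theta>)
    then show ?thesis by - (erule ssubst, rule finite.emptyI)
  next
    case True
    then obtain v where v: "v \<in> coord_subspace r" "proj_point I (\<phi> v) = p" by blast
    have same: "\<phi> u = \<phi> v" if "proj_point I (\<phi> u) = p" for u
    proof -
      have "\<phi> u \<in> proj_point I (\<phi> v)"
        using that v(2) self_in_proj_point[of "\<phi> u" I] \<phi>_homog[of UNIV] by auto
      then obtain c where c: "\<phi> u = (\<lambda>i. c * \<phi> v i)" by (auto simp: proj_point_mem)
      then have "c = 1" using \<phi>_i0[of u] \<phi>_i0[of v] by (metis mult.right_neutral)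
      then show ?thesis using c by simp
    qed
    have "p \<notin> B" using p by (auto simp: U_def)
    then have "cpoly_eval H (\<phi> v) \<noteq> 0" unfolding B_def v(2)[symmetric]
      using proj_point_in_zeros[of "\<phi> v" I "{H}"] \<phi>_homog[of UNIV] H(1) by auto
    then have qy: "q (\<lambda>j. g j (\<phi> v)) \<noteq> 0" using H(2)[of "\<phi> v"] \<phi>_i0 by simp
    define R where "R j = (\<lambda>u. u j) ` {u. \<phi> u = \<phi> v}" for j
    have finR: "finite (R j)" if "j < r" for j
      unfolding R_def using that qy by (intro Q(3)) (auto simp: q_def)
    define K where "K = {u. \<forall>k. (k \<in> {..<r} \<longrightarrow> u k \<in> (\<Union>j<r. R j)) \<and> (k \<notin> {..<r} \<longrightarrow> u k = 0)}"
    have fin: "finite K"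
      unfolding K_def by (rule finite_set_of_finite_funs) (use finR in auto)
    have "{x \<in> A. F x = p} \<subseteq> \<theta> ` K"
    proof clarify
      fix x assume "x \<in> A" "p = F x"
      then obtain u where u: "u \<in> coord_subspace r" "x = \<theta> u" "proj_point I (\<phi> u) = p"
        using F by (auto simp: \<theta>)
      have "u j \<in> R j" if "j < r" for j
        using same[OF u(3)] by (auto simp: R_def)
      then have "u \<in> K" using u(1) by (auto simp: K_def coord_subspace_def)
      then show "x \<in> \<theta> ` K" using u(2) by blast
    qed
    then show ?thesis by (rule finite_subset) (intro finite_imageI fin)
  qed
  ultimately show ?thesis
    unfolding generically_finite_to_one_def Let_def FA C_def[symmetric] by blast
qed

end

section \<open>Univariate mixtures\<close>

lemma single_power:
  "Poly_Mapping.single (Poly_Mapping.single v n) c ^ j =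
     (Poly_Mapping.single (Poly_Mapping.single v (n * j)) (c ^ j) :: nat cpoly)"
  by (induction j) (simp_all add: mult_single flip: single_add)

lemma trunc_exp_single:
  "trunc_exp d (Poly_Mapping.single (Poly_Mapping.single v n) c) =
     (\<Sum>j\<le>d. Poly_Mapping.single (Poly_Mapping.single v (n * j)) (c ^ j / fact j))"
  by (simp add: trunc_exp_def single_power mult_single)

text \<open>
  The \<open>a\<close>-th moment of a Gaussian with mean \<open>m\<close> and variance \<open>s\<close>, for \<open>a \<le> d\<close>; the summation bound \<open>d\<close>
  is inherited from the truncated exponential series.
\<close>
definition gauss_moment :: "nat \<Rightarrow> nat \<Rightarrow> complex \<Rightarrow> complex \<Rightarrow> complex" where
  "gauss_moment d a m s =
     fact a * (\<Sum>j\<le>d. if 2 * j \<le> a then m ^ (a - 2 * j) / fact (a - 2 * j) * ((s / 2) ^ j / fact j) else 0)"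

lemma moment_indices_univariate: "moment_indices 1 d = Poly_Mapping.single 0 ` {..d}"
proof (intro equalityI subsetI)
  fix a assume a: "a \<in> moment_indices 1 d"
  then have "Poly_Mapping.keys a \<subseteq> {0}" by (auto simp: moment_indices_def)
  then have "a = Poly_Mapping.single 0 (Poly_Mapping.lookup a 0)"
    by (intro poly_mapping_eqI) (auto simp: lookup_single when_def in_keys_iff)
  moreover have "Poly_Mapping.lookup a 0 \<le> d"
    using a lookup_le_mdeg[of a 0] by (simp add: moment_indices_def)
  ultimately show "a \<in> Poly_Mapping.single 0 ` {..d}" by blast
qed (auto simp: moment_indices_def mdeg_def split: if_splits)

lemmas moment_indices_univariate' = moment_indices_univariate[unfolded One_nat_def]

lemma inj_single: "inj_on (Poly_Mapping.single i :: nat \<Rightarrow> _) A"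
  by (rule inj_onI) (metis lookup_single_eq)

lemma lookup_cmult:
  fixes p :: "nat cpoly"
  shows "Poly_Mapping.lookup (Poly_Mapping.single 0 c * p) b = c * Poly_Mapping.lookup p b"
  by (auto simp: map.rep_eq when_def simp flip: mult_map_scale_conv_mult)

lemma moments_univariate:
  assumes a: "a \<le> d"
  shows "moments 1 d k (w, \<mu>, \<sigma>) (Poly_Mapping.single 0 a) =
    (\<Sum>l<k. w l * gauss_moment d a (\<mu> l 0) (\<sigma> l 0 0))"
proof -
  have single_iff: "Poly_Mapping.single 0 (i + 2 * j) = Poly_Mapping.single (0::nat) a \<longleftrightarrow> i + 2 * j = a" for i j :: nat
    by (metis lookup_single_eq)
  have coeff: "Poly_Mapping.lookup (trunc_exp d (linear_form 1 m) * trunc_exp d (half_quadratic_form 1 s))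
      (Poly_Mapping.single 0 a) * fact a = gauss_moment d a (m 0) (s 0 0)" for m s
  proof -
    have "linear_form 1 m = Poly_Mapping.single (Poly_Mapping.single 0 1) (m 0)"
      by (simp add: linear_form_def)
    moreover have "half_quadratic_form 1 s = Poly_Mapping.single (Poly_Mapping.single 0 2) (s 0 0 / 2)"
      by (simp add: half_quadratic_form_def numeral_2_eq_2 del: single_numeral flip: single_add)
    ultimately have "trunc_exp d (linear_form 1 m) * trunc_exp d (half_quadratic_form 1 s) =
        (\<Sum>i\<le>d. \<Sum>j\<le>d. Poly_Mapping.single (Poly_Mapping.single 0 (i + 2 * j))
           (m 0 ^ i / fact i * ((s 0 0 / 2) ^ j / fact j)))"
      by (simp only: trunc_exp_single sum_product mult_single single_add mult_1)
    then have "Poly_Mapping.lookup (trunc_exp d (linear_form 1 m) * trunc_exp d (half_quadratic_form 1 s))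
        (Poly_Mapping.single 0 a) =
        (\<Sum>i\<le>d. \<Sum>j\<le>d. if i + 2 * j = a then m 0 ^ i / fact i * ((s 0 0 / 2) ^ j / fact j) else 0)"
      by (simp only: lookup_sum lookup_single when_def single_iff)
    also have "\<dots> = (\<Sum>j\<le>d. \<Sum>i\<le>d. if i + 2 * j = a then m 0 ^ i / fact i * ((s 0 0 / 2) ^ j / fact j) else 0)"
      by (rule sum.swap)
    also have "\<dots> = (\<Sum>j\<le>d. if 2 * j \<le> a then m 0 ^ (a - 2 * j) / fact (a - 2 * j) * ((s 0 0 / 2) ^ j / fact j) else 0)"
    proof (rule sum.cong)
      fix j
      have "(\<Sum>i\<le>d. if i + 2 * j = a then m 0 ^ i / fact i * ((s 0 0 / 2) ^ j / fact j) else 0) =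
        (\<Sum>i\<le>d. if i = a - 2 * j then (if 2 * j \<le> a then m 0 ^ i / fact i * ((s 0 0 / 2) ^ j / fact j) else 0) else 0)"
        by (rule sum.cong) auto
      also have "\<dots> = (if a - 2 * j \<le> d \<and> 2 * j \<le> a then m 0 ^ (a - 2 * j) / fact (a - 2 * j) * ((s 0 0 / 2) ^ j / fact j) else 0)"
        by simp
      finally show "(\<Sum>i\<le>d. if i + 2 * j = a then m 0 ^ i / fact i * ((s 0 0 / 2) ^ j / fact j) else 0) =
        (if 2 * j \<le> a then m 0 ^ (a - 2 * j) / fact (a - 2 * j) * ((s 0 0 / 2) ^ j / fact j) else 0)"
        using a by (auto split: if_splits)
    qed simp
    finally show ?thesis by (simp add: gauss_moment_def)
  qed
  have "Poly_Mapping.single 0 a \<in> moment_indices 1 d"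
    using a by (auto simp: moment_indices_univariate')
  then show ?thesis
    by (simp add: moments_def mixture_gen_fun_def lookup_sum mult.assoc lookup_cmult sum_distrib_left
        flip: coeff) (simp add: mult_ac)
qed

lemma gauss_moment_zero_variance: "gauss_moment d a m 0 = m ^ a"
proof -
  have "(\<Sum>j\<le>d. if 2 * j \<le> a then m ^ (a - 2 * j) / fact (a - 2 * j) * ((0 / 2) ^ j / fact j) else 0) =
    (\<Sum>j\<le>d. if j = 0 then m ^ a / fact a else (0::complex))"
    by (rule sum.cong) auto
  then show ?thesis by (simp add: gauss_moment_def)
qed

text \<open>
  To first order at variance zero, only the terms with \<open>j = 0\<close> and \<open>j = 1\<close> contribute: the heat
  equation identifies the derivative in the variance with half the second derivative in the mean.
\<close>
lemma gauss_moment_deriv: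
  assumes a: "a \<le> d"
  shows "((\<lambda>t. gauss_moment d a (m + t * m') (t * s')) has_field_derivative
     m' * (of_nat a * m ^ (a - 1)) + s' / 2 * (of_nat (a * (a - 1)) * m ^ (a - 2))) (at 0)"
proof -
  define D where "D j = (if j = 0 then of_nat a * m' * m ^ (a - 1) / fact a
    else if j = 1 \<and> 2 \<le> a then m ^ (a - 2) / fact (a - 2) * (s' / 2) else 0)" for j :: nat
  have D: "((\<lambda>t. if 2 * j \<le> a then (m + t * m') ^ (a - 2 * j) / fact (a - 2 * j) * ((t * s' / 2) ^ j / fact j) else 0)
      has_field_derivative D j) (at 0)" for j
  proof -
    consider "j = 0" | "j = 1" | "2 \<le> j" by linarith
    then show ?thesis
    proof cases
      case 1
      then show ?thesis by (auto simp: D_def intro!: derivative_eq_intros)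
    next
      case 2
      then show ?thesis by (auto simp: D_def mult_ac intro!: derivative_eq_intros)
    next
      case 3
      have "((\<lambda>t. (m + t * m') ^ (a - 2 * j) / fact (a - 2 * j) * ((t * s' / 2) ^ j / fact j))
        has_field_derivative 0) (at 0)"
        using 3 by (auto intro!: derivative_eq_intros simp: power_0_left)
      then show ?thesis using 3 by (cases "2 * j \<le> a") (simp_all add: D_def)
    qed
  qed
  have "(\<Sum>j\<le>d. D j) = of_nat a * m' * m ^ (a - 1) / fact a +
      (if 2 \<le> a then m ^ (a - 2) / fact (a - 2) * (s' / 2) else 0)"
  proof (cases "2 \<le> a")
    case True
    have "(\<Sum>j\<le>d. D j) = (\<Sum>j\<in>{0, 1}. D j)"
      by (rule sum.mono_neutral_right) (use True a in \<open>auto simp: D_def\<close>)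
    then show ?thesis using True by (simp add: D_def)
  next
    case False
    have "(\<Sum>j\<le>d. D j) = (\<Sum>j\<in>{0}. D j)"
      by (rule sum.mono_neutral_right) (use False a in \<open>auto simp: D_def\<close>)
    then show ?thesis using False by (simp add: D_def)
  qed
  moreover have "fact a * (if 2 \<le> a then m ^ (a - 2) / fact (a - 2) * (s' / 2) else 0) =
      s' / 2 * (of_nat (a * (a - 1)) * m ^ (a - 2))"
  proof (cases "2 \<le> a")
    case True
    then obtain b where b: "a = Suc (Suc b)" using Suc_le_D numeral_2_eq_2 by (metis Suc_le_D Suc_le_mono)
    show ?thesis by (simp add: b field_simps)
  next
    case False
    then have "a = 0 \<or> a = 1" by auto
    then show ?thesis using False by auto
  qed
  ultimately have "fact a * (\<Sum>j\<le>d. D j) =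
      m' * (of_nat a * m ^ (a - 1)) + s' / 2 * (of_nat (a * (a - 1)) * m ^ (a - 2))"
    by (simp add: distrib_left)
  moreover have "((\<lambda>t. gauss_moment d a (m + t * m') (t * s')) has_field_derivative fact a * (\<Sum>j\<le>d. D j)) (at 0)"
    unfolding gauss_moment_def by (intro DERIV_cmult DERIV_sum D)
  ultimately show ?thesis by simp
qed

lemma poly_pderiv_sum:
  fixes A :: "complex poly"
  assumes "degree A \<le> d"
  shows "poly A x = (\<Sum>a\<le>d. coeff A a * x ^ a)"
    and "poly (pderiv A) x = (\<Sum>a\<le>d. coeff A a * (of_nat a * x ^ (a - 1)))"
    and "poly (pderiv (pderiv A)) x = (\<Sum>a\<le>d. coeff A a * (of_nat (a * (a - 1)) * x ^ (a - 2)))"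
proof -
  define B where "B = (\<Sum>a\<le>d. monom (coeff A a) a)"
  have B: "A = B" unfolding B_def using poly_as_sum_of_monoms'[OF assms] by simp
  have p: "pderiv (\<Sum>a\<in>S. f a) = (\<Sum>a\<in>S. pderiv (f a))" for f :: "nat \<Rightarrow> complex poly" and S
    by (induction S rule: infinite_finite_induct) (simp_all add: pderiv_add)
  have "poly B x = (\<Sum>a\<le>d. coeff A a * x ^ a)"
    "poly (pderiv B) x = (\<Sum>a\<le>d. coeff A a * (of_nat a * x ^ (a - 1)))"
    "poly (pderiv (pderiv B)) x = (\<Sum>a\<le>d. coeff A a * (of_nat (a * (a - 1)) * x ^ (a - 2)))"
    by (simp_all add: B_def p pderiv_monom poly_sum poly_monom mult_ac numeral_2_eq_2 of_nat_diff)
  then show "poly A x = (\<Sum>a\<le>d. coeff A a * x ^ a)"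
    "poly (pderiv A) x = (\<Sum>a\<le>d. coeff A a * (of_nat a * x ^ (a - 1)))"
    "poly (pderiv (pderiv A)) x = (\<Sum>a\<le>d. coeff A a * (of_nat (a * (a - 1)) * x ^ (a - 2)))"
    using B by simp_all
qed

text \<open>The expectation of \<open>A\<close>, as a linear form in the moments.\<close>
definition moment_functional :: "nat \<Rightarrow> complex poly \<Rightarrow> ((nat \<Rightarrow>\<^sub>0 nat) \<Rightarrow> complex) \<Rightarrow> complex" where
  "moment_functional d A x = (\<Sum>a\<le>d. coeff A a * x (Poly_Mapping.single 0 a))"

lemma mixture_functional_deriv:
  assumes A: "degree A \<le> d"
  shows "((\<lambda>t. \<Sum>a\<le>d. coeff A a * (\<Sum>l<k. (w l + t * w' l) * gauss_moment d a (m l + t * m' l) (t * s' l)))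
    has_field_derivative (\<Sum>l<k. w' l * poly A (m l) +
      w l * (m' l * poly (pderiv A) (m l) + s' l / 2 * poly (pderiv (pderiv A)) (m l)))) (at 0)"
proof -
  have "((\<lambda>t. (w l + t * w' l) * gauss_moment d a (m l + t * m' l) (t * s' l)) has_field_derivative
      w' l * m l ^ a + w l * (m' l * (of_nat a * m l ^ (a - 1)) + s' l / 2 * (of_nat (a * (a - 1)) * m l ^ (a - 2)))) (at 0)"
    if "a \<le> d" for l a
    by (rule derivative_eq_intros gauss_moment_deriv[OF that] refl)+
       (simp add: gauss_moment_zero_variance algebra_simps)
  then have "((\<lambda>t. \<Sum>a\<le>d. coeff A a * (\<Sum>l<k. (w l + t * w' l) * gauss_moment d a (m l + t * m' l) (t * s' l)))
    has_field_derivative (\<Sum>a\<le>d. coeff A a * (\<Sum>l<k. w' l * m l ^ a +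
      w l * (m' l * (of_nat a * m l ^ (a - 1)) + s' l / 2 * (of_nat (a * (a - 1)) * m l ^ (a - 2)))))) (at 0)"
    by (intro DERIV_sum DERIV_cmult) auto
  also have "(\<Sum>a\<le>d. coeff A a * (\<Sum>l<k. w' l * m l ^ a +
      w l * (m' l * (of_nat a * m l ^ (a - 1)) + s' l / 2 * (of_nat (a * (a - 1)) * m l ^ (a - 2))))) =
    (\<Sum>l<k. w' l * poly A (m l) +
      w l * (m' l * poly (pderiv A) (m l) + s' l / 2 * poly (pderiv (pderiv A)) (m l)))"
    unfolding poly_pderiv_sum[OF A] sum_distrib_left
    by (subst sum.swap) (simp add: sum.distrib sum_subtractf sum_distrib_left algebra_simps)
  finally show ?thesis .
qed

text \<open>
  The nodes are \<open>0, 0, 0, 1, 1, 1, 2, 2, 2, \<dots>\<close>: the means of the components at the base point, each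
  repeated three times.
\<close>
definition newton_poly :: "nat \<Rightarrow> complex poly" where
  "newton_poly j = (\<Prod>b<j. [:- of_nat (b div 3), 1:])"

lemma degree_newton_poly: "degree (newton_poly j) \<le> j"
  unfolding newton_poly_def
proof (induction j)
  case (Suc j)
  have "degree ((\<Prod>b<j. [:- of_nat (b div 3), 1:]) * [:- of_nat (j div 3), 1 :: complex:]) \<le> j + 1"
    by (rule order_trans[OF degree_mult_le add_mono[OF Suc]]) simp
  then show ?case by simp
qed simp

lemma newton_poly_Suc: "newton_poly (Suc j) = newton_poly j * [:- of_nat (j div 3), 1:]"
  unfolding newton_poly_def by (rule prod.lessThan_Suc)

lemma newton_poly_split:
  "newton_poly (3 * l + e) = newton_poly (3 * l) * [:- of_nat l, 1:] ^ e" if "e \<le> 3"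
  using that
proof (induction e)
  case (Suc e)
  then have "(3 * l + e) div 3 = l" by simp
  then show ?case using Suc
    by (simp only: add_Suc_right newton_poly_Suc power_Suc2 mult.assoc Suc_leD)
qed simp

lemma newton_poly_dvd: "i \<le> j \<Longrightarrow> newton_poly i dvd newton_poly j"
  unfolding newton_poly_def by (intro prod_dvd_prod_subset) auto

lemma higher_pderiv_root_power:
  fixes M :: "complex poly"
  assumes "e < 3"
  shows "poly ((pderiv ^^ e) ([:- x, 1:] ^ e * M)) x = fact e * poly M x"
    and "poly ((pderiv ^^ e) ([:- x, 1:] ^ Suc e * M)) x = 0"
proof -
  define X where "X = [:- x, 1:]"
  have X: "poly X x = 0" "pderiv X = 1" by (simp_all add: X_def pderiv_pCons)
  have "e = 0 \<or> e = 1 \<or> e = 2" using assms by auto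
  then show "poly ((pderiv ^^ e) ([:- x, 1:] ^ e * M)) x = fact e * poly M x"
    "poly ((pderiv ^^ e) ([:- x, 1:] ^ Suc e * M)) x = 0"
    unfolding X_def[symmetric]
    by (auto simp: X pderiv_mult pderiv_add numeral_2_eq_2 algebra_simps)
qed

text \<open>
  The values of \<open>A\<close>, \<open>A'\<close> and \<open>A''\<close> at the nodes, in the order of the nodes. They are the derivatives
  of the expectation of \<open>A\<close> in weight, mean and variance of the component \<open>i div 3\<close>, up to factors.
\<close>
definition hermite_datum :: "nat \<Rightarrow> complex poly \<Rightarrow> complex" where
  "hermite_datum i A = poly ((pderiv ^^ (i mod 3)) A) (of_nat (i div 3))"

lemma hermite_datum_newton_poly_below:
  assumes "i < j" shows "hermite_datum i (newton_poly j) = 0"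
proof -
  define l where "l = i div 3"
  define e where "e = i mod 3"
  have i: "i = 3 * l + e" "e < 3" by (auto simp: l_def e_def)
  have "newton_poly (3 * l + Suc e) dvd newton_poly j" using assms i by (intro newton_poly_dvd) auto
  then obtain M where "newton_poly j = newton_poly (3 * l + Suc e) * M" by (auto elim: dvdE)
  then have "newton_poly j = [:- of_nat l, 1:] ^ Suc e * (newton_poly (3 * l) * M)"
    using newton_poly_split[of "Suc e" l] i(2) by (simp add: mult_ac)
  then show ?thesis using higher_pderiv_root_power(2)[OF i(2), of "of_nat l"]
    by (simp add: hermite_datum_def flip: l_def e_def)
qed

lemma hermite_datum_newton_poly_diag: "hermite_datum i (newton_poly i) \<noteq> 0"
proof -
  define l where "l = i div 3"
  define e where "e = i mod 3"
  have i: "i = 3 * l + e" "e < 3" by (auto simp: l_def e_def)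
  have "newton_poly i = [:- of_nat l, 1:] ^ e * newton_poly (3 * l)"
    using newton_poly_split[of e l] i by (simp add: mult_ac)
  moreover have "poly (newton_poly (3 * l)) (of_nat l) \<noteq> 0"
    by (auto simp: newton_poly_def poly_prod)
  ultimately show ?thesis using higher_pderiv_root_power(1)[OF i(2), of "of_nat l"]
    by (simp add: hermite_datum_def flip: l_def e_def)
qed

text \<open>
  The weights sum to \<open>1\<close>, so the weight of component \<open>0\<close> is determined by the others. The remaining
  parameters are numbered in the order of the nodes with the first one omitted: \<open>u (3 * l - 1)\<close>,
  \<open>u (3 * l)\<close> and \<open>u (3 * l + 1)\<close> belong to the weight, mean and variance of component \<open>l\<close>.
\<close>
definition weight_shift :: "nat \<Rightarrow> (nat \<Rightarrow> complex) \<Rightarrow> nat \<Rightarrow> complex" where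
  "weight_shift k u l = (if l = 0 then - (\<Sum>i\<in>{0<..<k}. u (3 * i - 1)) else u (3 * l - 1))"

text \<open>The base point \<open>u = 0\<close> has equal weights, the means \<open>0, \<dots>, k - 1\<close> and vanishing variances.\<close>
definition univariate_params :: "nat \<Rightarrow> (nat \<Rightarrow> complex) \<Rightarrow> gauss_param" where
  "univariate_params k u =
     ((\<lambda>l. if l < k then 1 / of_nat k + weight_shift k u l else 0),
      (\<lambda>l i. if l < k \<and> i = 0 then of_nat l + u (3 * l) else 0),
      (\<lambda>l i j. if l < k \<and> i = 0 \<and> j = 0 then u (3 * l + 1) else 0))"

lemma sum_weight_shift: "1 \<le> k \<Longrightarrow> (\<Sum>l<k. weight_shift k u l) = 0"
proof -
  assume "1 \<le> k"
  then have "{..<k} = insert 0 {0<..<k}" by auto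
  then show ?thesis by (simp add: weight_shift_def)
qed

lemma div_mod_3 [simp]:
  "Suc (3 * l) div 3 = l" "Suc (3 * l) mod 3 = 1"
  "Suc (Suc (3 * l)) div 3 = l" "Suc (Suc (3 * l)) mod 3 = 2"
  by presburger+

lemma univariate_params_image:
  assumes k: "1 \<le> k"
  shows "gauss_params 1 k = univariate_params k ` coord_subspace (3 * k - 1)"
proof (intro equalityI subsetI)
  fix \<theta> assume "\<theta> \<in> univariate_params k ` coord_subspace (3 * k - 1)"
  then obtain u where u: "\<theta> = univariate_params k u" by blast
  have "(\<Sum>l<k. 1 / of_nat k + weight_shift k u l) = (1 :: complex)"
    using k sum_weight_shift[OF k, of u] by (simp add: sum.distrib)
  then show "\<theta> \<in> gauss_params 1 k"
    by (auto simp: u univariate_params_def gauss_params_def)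
next
  fix \<theta> assume \<theta>: "\<theta> \<in> gauss_params 1 k"
  obtain w \<mu> \<sigma> where eq: "\<theta> = (w, \<mu>, \<sigma>)" by (cases \<theta>)
  define u where "u i = (let l = Suc i div 3; e = Suc i mod 3 in
    if l < k then (if e = 0 then w l - 1 / of_nat k else if e = 1 then \<mu> l 0 - of_nat l else \<sigma> l 0 0) else 0)" for i
  have u: "u (3 * l) = (if l < k then \<mu> l 0 - of_nat l else 0)"
    "u (3 * l + 1) = (if l < k then \<sigma> l 0 0 else 0)" for l
    by (simp_all add: u_def Let_def flip: add_Suc_right Suc_eq_plus1)
  have uw: "u (3 * l - 1) = w l - 1 / of_nat k" if "0 < l" "l < k" for l
  proof -
    have "Suc (3 * l - 1) = 3 * l" using that by simp
    then show ?thesis using that by (simp add: u_def Let_def)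
  qed
  have ws: "1 / of_nat k + weight_shift k u l = w l" if "l < k" for l
  proof (cases "l = 0")
    case False
    then show ?thesis using uw[of l] that by (simp add: weight_shift_def)
  next
    case True
    have "{..<k} = insert 0 {0<..<k}" using k by auto
    moreover have "(\<Sum>l<k. w l) = 1" using \<theta> by (auto simp: eq gauss_params_def)
    ultimately have "w 0 = 1 - (\<Sum>i\<in>{0<..<k}. w i)" by (simp add: algebra_simps)
    moreover have "(\<Sum>i\<in>{0<..<k}. u (3 * i - 1)) = (\<Sum>i\<in>{0<..<k}. w i - 1 / of_nat k)"
      using uw by (intro sum.cong) (auto simp del: One_nat_def)
    moreover have "\<dots> = (\<Sum>i\<in>{0<..<k}. w i) - (of_nat k - 1) / of_nat k"
      using k by (simp add: sum_subtractf of_nat_diff)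
    ultimately have "1 / of_nat k + weight_shift k u l = 1 / of_nat k - (1 - w 0 - (of_nat k - 1) / of_nat k)"
      using True by (simp add: weight_shift_def)
    also have "\<dots> = w l" using True k by (simp add: field_simps)
    finally show ?thesis .
  qed
  have "u \<in> coord_subspace (3 * k - 1)"
    by (auto simp: coord_subspace_def u_def Let_def)
  moreover have "\<theta> = univariate_params k u"
    using \<theta> ws u by (auto simp: eq univariate_params_def gauss_params_def fun_eq_iff)
  ultimately show "\<theta> \<in> univariate_params k ` coord_subspace (3 * k - 1)" by blast
qed

definition cut :: "nat \<Rightarrow> (nat \<Rightarrow> complex) \<Rightarrow> nat \<Rightarrow> complex" where
  "cut r u = (\<lambda>i. if i < r then u i else 0)"

lemma polyfun_cut: "polyfun {..<r} (\<lambda>u. cut r u i)"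
  by (cases "i < r") (auto simp: cut_def intro!: polyfun_intros)

text \<open>
  The successors account for the omitted weight of component \<open>0\<close>. The numerical factors are the base
  weight \<open>1 / k\<close>, which multiplies the derivatives in mean and variance, and the \<open>1 / 2\<close> from the heat
  equation.
\<close>
definition tangent_coeff :: "nat \<Rightarrow> nat \<Rightarrow> nat \<Rightarrow> complex" where
  "tangent_coeff k j i = hermite_datum (Suc i) (newton_poly (Suc j)) *
     (if Suc i mod 3 = 0 then 1 else if Suc i mod 3 = 1 then 1 / of_nat k else 1 / (2 * of_nat k))"

lemma sum_group_by_three: "(\<Sum>i<3 * k. f i) = (\<Sum>l<k. f (3 * l) + f (3 * l + 1) + f (3 * l + 2))"
  for f :: "nat \<Rightarrow> complex"
  by (induction k) (simp_all add: numeral_eq_Suc)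

text \<open>
  The dependent weight of component \<open>0\<close> drops out of the differential because the polynomial vanishes
  at the node \<open>0\<close>.
\<close>
lemma tangent_sum:
  fixes j :: nat
  assumes k: "1 \<le> k"
  defines "N \<equiv> newton_poly (Suc j)"
  shows "(\<Sum>l<k. weight_shift k u l * poly N (of_nat l) + 1 / of_nat k *
      (u (3 * l) * poly (pderiv N) (of_nat l) + u (3 * l + 1) / 2 * poly (pderiv (pderiv N)) (of_nat l))) =
    (\<Sum>i<3 * k - 1. tangent_coeff k j i * u i)"
proof -
  define F where "F i = (if i = 0 then 0 else tangent_coeff k j (i - 1) * u (i - 1))" for i
  have "poly N 0 = 0"
    using hermite_datum_newton_poly_below[of 0 "Suc j"] by (simp add: N_def hermite_datum_def)
  then have "weight_shift k u l * poly N (of_nat l) + 1 / of_nat k *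
      (u (3 * l) * poly (pderiv N) (of_nat l) + u (3 * l + 1) / 2 * poly (pderiv (pderiv N)) (of_nat l)) =
      F (3 * l) + F (3 * l + 1) + F (3 * l + 2)" for l
  proof -
    have "F (3 * l) = weight_shift k u l * poly N (of_nat l)"
    proof (cases "l = 0")
      case True
      then show ?thesis using \<open>poly N 0 = 0\<close> by (simp add: F_def)
    next
      case False
      then have "Suc (3 * l - 1) = 3 * l" by simp
      then show ?thesis using False
        by (simp add: F_def weight_shift_def tangent_coeff_def hermite_datum_def N_def)
    qed
    moreover have "F (3 * l + 1) = 1 / of_nat k * (u (3 * l) * poly (pderiv N) (of_nat l))"
      by (simp add: F_def tangent_coeff_def hermite_datum_def N_def)
    moreover have "F (3 * l + 2) = 1 / of_nat k * (u (3 * l + 1) / 2 * poly (pderiv (pderiv N)) (of_nat l))"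
    proof -
      show ?thesis
        by (simp add: F_def tangent_coeff_def hermite_datum_def N_def) (simp add: numeral_2_eq_2 mult_ac)
    qed
    ultimately show ?thesis by (simp add: distrib_left)
  qed
  then have "(\<Sum>l<k. weight_shift k u l * poly N (of_nat l) + 1 / of_nat k *
      (u (3 * l) * poly (pderiv N) (of_nat l) + u (3 * l + 1) / 2 * poly (pderiv (pderiv N)) (of_nat l))) =
      (\<Sum>i<3 * k. F i)"
    by (simp add: sum_group_by_three)
  also have "\<dots> = (\<Sum>i<Suc (3 * k - 1). F i)" using k by simp
  also have "\<dots> = (\<Sum>i<3 * k - 1. tangent_coeff k j i * u i)"
    unfolding sum.lessThan_Suc_shift by (simp add: F_def)
  finally show ?thesis .
qed

lemma sum_fun_upd_add:
  fixes u T :: "nat \<Rightarrow> complex"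
  assumes "q < n"
  shows "(\<Sum>i<n. T i * (u(q := u q + c)) i) = (\<Sum>i<n. T i * u i) + c * T q"
proof -
  have "(\<Sum>i<n. T i * (u(q := u q + c)) i) = (\<Sum>i<n. T i * u i + (if i = q then c * T q else 0))"
    by (rule sum.cong) (auto simp: algebra_simps)
  then show ?thesis using assms by (simp add: sum.distrib)
qed

lemma polyfun_moments_univariate:
  assumes a: "a \<in> moment_indices 1 d" and V: "\<And>i. polyfun V (\<lambda>u. g u i)"
  shows "polyfun V (\<lambda>u. moments 1 d k (univariate_params k (g u)) a)"
proof -
  obtain b where b: "b \<le> d" "a = Poly_Mapping.single 0 b"
    using a by (auto simp: moment_indices_univariate')
  have "polyfun V (\<lambda>u. weight_shift k (g u) l)" for l
    using V polyfun_diff[OF polyfun.const[of V 0] polyfun_sum[of "{0<..<k}" V "\<lambda>i u. g u (3 * i - 1)"]]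
    by (cases "l = 0") (auto simp: weight_shift_def)
  moreover have "polyfun V (\<lambda>u. (if 2 * j \<le> b then (of_nat l + g u (3 * l)) ^ (b - 2 * j) / fact (b - 2 * j) *
      ((g u (3 * l + 1) / 2) ^ j / fact j) else 0))" for j l
    using V by (cases "2 * j \<le> b") (auto intro!: polyfun_intros)
  ultimately show ?thesis
    unfolding b(2) univariate_params_def moments_univariate[OF b(1)]
    by (auto simp: gauss_moment_def simp del: add_Suc_right Suc_eq_plus1[symmetric] One_nat_def intro!: polyfun_intros)
qed

text \<open>
  Using only the first \<open>r\<close> parameters and the first \<open>r\<close> nonconstant Newton polynomials, whose degrees are
  at most \<open>r\<close>, treats all \<open>d\<close> and \<open>k\<close> alike, whether \<open>d\<close> or \<open>3 * k - 1\<close> is the smaller number.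
\<close>
lemma triangular_parametrization_univariate:
  assumes k: "1 \<le> k" and r: "r \<le> d" "r \<le> 3 * k - 1"
  shows "triangular_parametrization (moment_indices 1 d) 0 r
    (\<lambda>u. moments 1 d k (univariate_params k (cut r u)))
    (\<lambda>j. moment_functional d (newton_poly (Suc j)))
    (\<lambda>j u. \<Sum>i<3 * k - 1. tangent_coeff k j i * cut r u i) (tangent_coeff k)"
proof
  have param: "univariate_params k u \<in> gauss_params 1 k" for u
  proof -
    have "univariate_params k u = univariate_params k (cut (3 * k - 1) u)"
      by (auto simp: univariate_params_def weight_shift_def cut_def fun_eq_iff intro!: sum.cong)
    moreover have "cut (3 * k - 1) u \<in> coord_subspace (3 * k - 1)" by (auto simp: cut_def coord_subspace_def)
    ultimately show ?thesis unfolding univariate_params_image[OF k] by blast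
  qed
  show "(0 :: nat \<Rightarrow>\<^sub>0 nat) \<in> moment_indices 1 d" by (simp add: moment_indices_def mdeg_def)
  show "moments 1 d k (univariate_params k (cut r u)) 0 = 1" for u
    by (rule moments_zero[OF param])
  show "moments 1 d k (univariate_params k (cut r u)) i = 0" if "i \<notin> moment_indices 1 d" for u i
    using that by (simp add: moments_def)
  show "polyfun {..<r} (\<lambda>u. moments 1 d k (univariate_params k (cut r u)) i)"
    if "i \<in> moment_indices 1 d" for i
    by (rule polyfun_moments_univariate[OF that polyfun_cut])
  show "polyfun (moment_indices 1 d) (moment_functional d (newton_poly (Suc j)))" for j
    unfolding moment_functional_def[abs_def]
    by (intro polyfun_intros) (auto simp: moment_indices_univariate')
  show "moment_functional d (newton_poly (Suc j)) (\<lambda>i. c * x i) = c * moment_functional d (newton_poly (Suc j)) x" for j c x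
    by (simp add: moment_functional_def sum_distrib_left mult_ac)
  show "((\<lambda>t. moment_functional d (newton_poly (Suc j)) (moments 1 d k (univariate_params k (cut r (\<lambda>i. t * u i)))))
      has_field_derivative (\<Sum>i<3 * k - 1. tangent_coeff k j i * cut r u i)) (at 0)" if j: "j < r" for j u
  proof -
    have cut: "cut r (\<lambda>i. t * u i) = (\<lambda>i. t * cut r u i)" for t by (auto simp: cut_def)
    have ws: "weight_shift k (\<lambda>i. t * cut r u i) l = t * weight_shift k (cut r u) l" for t l
      by (simp add: weight_shift_def sum_distrib_left)
    have mom: "moment_functional d A (moments 1 d k (univariate_params k (cut r (\<lambda>i. t * u i)))) =
        (\<Sum>a\<le>d. coeff A a * (\<Sum>l<k. (1 / of_nat k + t * weight_shift k (cut r u) l) *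
          gauss_moment d a (of_nat l + t * cut r u (3 * l)) (t * cut r u (3 * l + 1))))" for A t
      unfolding moment_functional_def univariate_params_def
      by (intro sum.cong refl) (simp add: moments_univariate[unfolded One_nat_def] cut ws)
    have "degree (newton_poly (Suc j)) \<le> d" using degree_newton_poly[of "Suc j"] j r by simp
    from mixture_functional_deriv[OF this, where k = k and w = "\<lambda>_. 1 / of_nat k"
        and w' = "weight_shift k (cut r u)" and m = of_nat and m' = "\<lambda>l. cut r u (3 * l)"
        and s' = "\<lambda>l. cut r u (3 * l + 1)"]
    show ?thesis
      unfolding tangent_sum[OF k] mom .
  qed
  show "(\<Sum>i<3 * k - 1. tangent_coeff k j i * cut r (u(q := u q + c)) i) =
      (\<Sum>i<3 * k - 1. tangent_coeff k j i * cut r u i) + c * tangent_coeff k j q"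
    if "j < r" "q < r" for j q u c
  proof -
    have "cut r (u(q := u q + c)) = (cut r u)(q := cut r u q + c)" using that by (auto simp: cut_def)
    then show ?thesis using sum_fun_upd_add[of q "3 * k - 1" "tangent_coeff k j" "cut r u" c] that r by simp
  qed
  show "tangent_coeff k j q = 0" if "q < j" "j < r" for j q
    using hermite_datum_newton_poly_below[of "Suc q" "Suc j"] that by (simp add: tangent_coeff_def)
  show "tangent_coeff k j j \<noteq> 0" if "j < r" for j
    using hermite_datum_newton_poly_diag[of "Suc j"] k by (simp add: tangent_coeff_def)
qed

lemma gauss_secant_eq_closure:
  "gauss_secant k n d = proj_closure (moment_indices n d) (moments n d k ` gauss_params n k)"
  unfolding gauss_secant_def image_image by (simp add: moment_map_def[abs_def])

lemma moments_subset: "moments n d k ` gauss_params n k \<subseteq> homog_vectors (moment_indices n d)"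
  using moments_in_homog_vectors by blast

theorem dim_univariate_secant:
  assumes k: "1 \<le> k"
  shows "variety_dim (moment_indices 1 d) (gauss_secant k 1 d) = enat (min d (3 * k - 1))"
proof (rule antisym)
  let ?S = "moments 1 d k ` gauss_params 1 k"
  have "variety_dim (moment_indices 1 d) (proj_closure (moment_indices 1 d) ?S) \<le> enat d"
  proof (rule variety_dim_le[OF moments_subset, where \<Psi> = "\<lambda>u. u"])
    show "finite (moment_indices 1 d)" "card (moment_indices 1 d) = Suc d"
      unfolding moment_indices_univariate by (simp_all add: card_image[OF inj_single])
  qed (auto intro: polyfun.var)
  moreover have "variety_dim (moment_indices 1 d) (proj_closure (moment_indices 1 d) ?S) \<le> enat (3 * k - 1)"
  proof (rule variety_dim_le[OF moments_subset])
    let ?\<Psi> = "\<lambda>u a. u (3 * k - 1) * moments 1 d k (univariate_params k (cut (3 * k - 1) u)) a"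
    show "finite {..<3 * k}" "card {..<3 * k} = Suc (3 * k - 1)" using k by auto
    show "polyfun {..<3 * k} (\<lambda>u. ?\<Psi> u i)" if "i \<in> moment_indices 1 d" for i
      using k by (intro polyfun_intros polyfun_moments_univariate[OF that] polyfun_mono[OF polyfun_cut]) auto
    fix f :: "((nat \<Rightarrow>\<^sub>0 nat) \<Rightarrow> complex) \<Rightarrow> complex" and x c
    assume f: "\<And>u. f (?\<Psi> u) = 0" and x: "x \<in> ?S"
    obtain u where u: "u \<in> coord_subspace (3 * k - 1)" "x = moments 1 d k (univariate_params k u)"
      using x unfolding univariate_params_image[OF k] by blast
    have "cut (3 * k - 1) (u(3 * k - 1 := c)) = u" using u(1) by (auto simp: cut_def coord_subspace_def)
    then show "f (\<lambda>i. c * x i) = 0" using f[of "u(3 * k - 1 := c)"] u(2) by simp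
  qed
  ultimately show "variety_dim (moment_indices 1 d) (gauss_secant k 1 d) \<le> enat (min d (3 * k - 1))"
    unfolding gauss_secant_eq_closure by (cases "d \<le> 3 * k - 1") (auto simp: min_def)
next
  define r where "r = min d (3 * k - 1)"
  interpret triangular_parametrization "moment_indices 1 d" 0 r
    "\<lambda>u. moments 1 d k (univariate_params k (cut r u))"
    "\<lambda>j. moment_functional d (newton_poly (Suc j))"
    "\<lambda>j u. \<Sum>i<3 * k - 1. tangent_coeff k j i * cut r u i" "tangent_coeff k"
    by (rule triangular_parametrization_univariate[OF k]) (auto simp: r_def)
  have "cut r u \<in> coord_subspace (3 * k - 1)" for u
    by (auto simp: cut_def coord_subspace_def r_def)
  then show "enat (min d (3 * k - 1)) \<le> variety_dim (moment_indices 1 d) (gauss_secant k 1 d)"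
    unfolding gauss_secant_eq_closure r_def[symmetric]
    unfolding univariate_params_image[OF k] by (intro variety_dim_ge) blast
qed

theorem univariate_generically_finite:
  assumes k: "1 \<le> k" and d: "3 * k - 1 \<le> d"
  shows "generically_finite_to_one (gauss_params 1 k) (zariski_topology (moment_indices 1 d)) (moment_map 1 d k)"
proof -
  define r where "r = 3 * k - 1"
  interpret triangular_parametrization "moment_indices 1 d" 0 r
    "\<lambda>u. moments 1 d k (univariate_params k (cut r u))"
    "\<lambda>j. moment_functional d (newton_poly (Suc j))"
    "\<lambda>j u. \<Sum>i<3 * k - 1. tangent_coeff k j i * cut r u i" "tangent_coeff k"
    by (rule triangular_parametrization_univariate[OF k]) (use d in \<open>auto simp: r_def\<close>)
  show ?thesis
  proof (rule generically_finite)
    show "gauss_params 1 k = univariate_params k ` coord_subspace r"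
      unfolding r_def by (rule univariate_params_image[OF k])
    show "moment_map 1 d k (univariate_params k u) =
      proj_point (moment_indices 1 d) (moments 1 d k (univariate_params k (cut r u)))"
      if "u \<in> coord_subspace r" for u
    proof -
      have "cut r u = u" using that by (auto simp: cut_def coord_subspace_def)
      then show ?thesis by (simp add: moment_map_def)
    qed
  qed
qed

section \<open>Linear and quadratic forms\<close>

abbreviation cnst :: "complex \<Rightarrow> nat cpoly" where
  "cnst c \<equiv> Poly_Mapping.single 0 c"

abbreviation unit_exp :: "nat \<Rightarrow> nat \<Rightarrow>\<^sub>0 nat" where
  "unit_exp i \<equiv> Poly_Mapping.single i 1"

abbreviation pvar :: "nat \<Rightarrow> nat cpoly" where
  "pvar i \<equiv> Poly_Mapping.single (unit_exp i) 1"

definition lin_exps :: "nat \<Rightarrow> (nat \<Rightarrow>\<^sub>0 nat) set" where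
  "lin_exps n = unit_exp ` {..<n}"

definition quad_exps :: "nat \<Rightarrow> (nat \<Rightarrow>\<^sub>0 nat) set" where
  "quad_exps n = (\<lambda>(i, j). unit_exp i + unit_exp j) ` ({..<n} \<times> {..<n})"

lemma finite_lin_quad_exps [simp]: "finite (lin_exps n)" "finite (quad_exps n)"
  by (simp_all add: lin_exps_def quad_exps_def)

definition lin :: "nat \<Rightarrow> nat cpoly \<Rightarrow> bool" where
  "lin n p \<longleftrightarrow> Poly_Mapping.keys p \<subseteq> lin_exps n"

definition quad :: "nat \<Rightarrow> nat cpoly \<Rightarrow> bool" where
  "quad n p \<longleftrightarrow> Poly_Mapping.keys p \<subseteq> quad_exps n"

lemma mdeg_unit_exp: "mdeg (unit_exp i) = 1"
  by (simp add: mdeg_def)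

lemma unit_exp_eq_iff: "unit_exp i = unit_exp j \<longleftrightarrow> i = j"
  by (metis lookup_single_eq lookup_single_not_eq one_neq_zero)

lemma mdeg_lin_exps: "a \<in> lin_exps n \<Longrightarrow> mdeg a = 1"
  by (auto simp: lin_exps_def mdeg_unit_exp simp del: One_nat_def)

lemma mdeg_quad_exps: "a \<in> quad_exps n \<Longrightarrow> mdeg a = 2"
  by (auto simp: quad_exps_def mdeg_unit_exp mdeg_add simp del: One_nat_def)

lemma unit_exp_add_eq_iff:
  "unit_exp i + unit_exp j = unit_exp p + unit_exp q \<longleftrightarrow> i = p \<and> j = q \<or> i = q \<and> j = p"
proof
  assume eq: "unit_exp i + unit_exp j = unit_exp p + unit_exp q"
  have "Poly_Mapping.lookup (unit_exp i + unit_exp j) i = Poly_Mapping.lookup (unit_exp p + unit_exp q) i"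
    using eq by simp
  then have "i = p \<or> i = q"
    by (auto simp: lookup_add lookup_single when_def split: if_splits)
  then show "i = p \<and> j = q \<or> i = q \<and> j = p"
  proof
    assume "i = p"
    then show ?thesis using eq by (simp add: unit_exp_eq_iff del: One_nat_def)
  next
    assume "i = q"
    then have "unit_exp j = unit_exp p" using eq by (simp add: add.commute)
    then show ?thesis using \<open>i = q\<close> by (simp add: unit_exp_eq_iff del: One_nat_def)
  qed
qed (auto simp: add.commute)

lemma expand_over_superset:
  fixes p :: "nat cpoly"
  assumes "finite A" "Poly_Mapping.keys p \<subseteq> A"
  shows "p = (\<Sum>a\<in>A. Poly_Mapping.single a (Poly_Mapping.lookup p a))"
  using assms by (intro poly_mapping_eqI) (auto simp: lookup_sum lookup_single when_def in_keys_iff)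

lemma keys_sum_single:
  assumes "finite A"
  shows "Poly_Mapping.keys (\<Sum>a\<in>A. Poly_Mapping.single (f a) (c a)) \<subseteq> f ` A"
proof
  fix b assume b: "b \<in> Poly_Mapping.keys (\<Sum>a\<in>A. Poly_Mapping.single (f a) (c a))"
  show "b \<in> f ` A"
  proof (rule ccontr)
    assume "b \<notin> f ` A"
    then have "Poly_Mapping.lookup (\<Sum>a\<in>A. Poly_Mapping.single (f a) (c a)) b = 0"
      unfolding lookup_sum by (intro sum.neutral) (auto simp: lookup_single when_def)
    then show False using b by (simp add: in_keys_iff)
  qed
qed

lemma lin_linear_form: "lin n (linear_form n m)"
  unfolding lin_def linear_form_def lin_exps_def by (rule keys_sum_single) simp

lemma lin_eq_linear_form:
  assumes "lin n p"
  obtains m where "\<And>i. \<not> i < n \<Longrightarrow> m i = 0" "linear_form n m = p"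
proof
  let ?m = "\<lambda>i. if i < n then Poly_Mapping.lookup p (unit_exp i) else 0"
  have inj: "inj_on unit_exp {..<n}" by (rule inj_onI) (simp add: unit_exp_eq_iff del: One_nat_def)
  have "p = (\<Sum>a\<in>lin_exps n. Poly_Mapping.single a (Poly_Mapping.lookup p a))"
    using assms by (intro expand_over_superset) (auto simp: lin_def)
  also have "\<dots> = linear_form n ?m"
    unfolding lin_exps_def linear_form_def by (simp add: sum.reindex[OF inj] del: One_nat_def)
  finally show "linear_form n ?m = p" ..
qed auto

lemma quad_half_quadratic_form: "quad n (half_quadratic_form n s)"
  unfolding quad_def half_quadratic_form_def quad_exps_def sum.cartesian_product
  using keys_sum_single[of "{..<n} \<times> {..<n}" "\<lambda>(i, j). unit_exp i + unit_exp j" "\<lambda>(i, j). s i j / 2"]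
  by (simp add: case_prod_unfold)

text \<open>
  A mixed monomial arises twice in the double sum over a symmetric matrix and a square only once; with
  the factor \<open>1 / 2\<close> of the half quadratic form, the diagonal entries are twice the coefficients.
\<close>
lemma quad_eq_half_quadratic_form:
  assumes q: "quad n q"
  obtains s where "\<And>i j. \<not> (i < n \<and> j < n) \<Longrightarrow> s i j = 0" "\<And>i j. s i j = s j i"
    "half_quadratic_form n s = q"
proof
  let ?s = "\<lambda>i j. if i < n \<and> j < n then (if i = j then 2 else 1) * Poly_Mapping.lookup q (unit_exp i + unit_exp j) else 0"
  show "half_quadratic_form n ?s = q"
  proof (rule poly_mapping_eqI)
    fix b
    have lk: "Poly_Mapping.lookup (half_quadratic_form n ?s) b =
        (\<Sum>i<n. \<Sum>j<n. if unit_exp i + unit_exp j = b then ?s i j / 2 else 0)"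
      unfolding half_quadratic_form_def lookup_sum lookup_single when_def ..
    show "Poly_Mapping.lookup (half_quadratic_form n ?s) b = Poly_Mapping.lookup q b"
    proof (cases "b \<in> quad_exps n")
      case False
      then have "Poly_Mapping.lookup q b = 0" using q by (auto simp: quad_def in_keys_iff)
      moreover have "Poly_Mapping.lookup (half_quadratic_form n ?s) b = 0"
        using False quad_half_quadratic_form[of n ?s] by (auto simp: quad_def in_keys_iff simp del: One_nat_def)
      ultimately show ?thesis by simp
    next
      case True
      then obtain p r where pr: "p < n" "r < n" "b = unit_exp p + unit_exp r" by (auto simp: quad_exps_def)
      show ?thesis
      proof (cases "p = r")
        case True
        have "(\<Sum>i<n. \<Sum>j<n. if unit_exp i + unit_exp j = b then ?s i j / 2 else 0) =
          (\<Sum>i<n. \<Sum>j<n. if j = p then (if i = p then Poly_Mapping.lookup q b else 0) else 0)"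
          unfolding pr(3) unit_exp_add_eq_iff using True by (intro sum.cong refl) auto
        also have "\<dots> = Poly_Mapping.lookup q b" using pr by simp
        finally show ?thesis using lk by simp
      next
        case False
        have "(\<Sum>i<n. \<Sum>j<n. if unit_exp i + unit_exp j = b then ?s i j / 2 else 0) =
          (\<Sum>i<n. \<Sum>j<n. (if j = r then (if i = p then Poly_Mapping.lookup q b / 2 else 0) else 0) +
             (if j = p then (if i = r then Poly_Mapping.lookup q b / 2 else 0) else 0))"
          unfolding pr(3) unit_exp_add_eq_iff using False by (intro sum.cong refl) (auto simp: add.commute)
        also have "\<dots> = Poly_Mapping.lookup q b" using pr by (simp add: sum.distrib)
        finally show ?thesis using lk by simp
      qed
    qed
  qed
qed (auto simp: add.commute)

lemma lin_add: "lin n p \<Longrightarrow> lin n q \<Longrightarrow> lin n (p + q)"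
  and quad_add: "quad n p \<Longrightarrow> quad n q \<Longrightarrow> quad n (p + q)"
  using keys_add[of p q] by (auto simp: lin_def quad_def)

lemma keys_cmult: "Poly_Mapping.keys (cnst c * p) \<subseteq> Poly_Mapping.keys p"
  by (auto simp: in_keys_iff lookup_cmult)

lemma lin_cmult: "lin n p \<Longrightarrow> lin n (cnst c * p)"
  and quad_cmult: "quad n p \<Longrightarrow> quad n (cnst c * p)"
  using keys_cmult[of c p] by (auto simp: lin_def quad_def)

lemma lin_diff: "lin n p \<Longrightarrow> lin n q \<Longrightarrow> lin n (p - q)"
  and quad_diff: "quad n p \<Longrightarrow> quad n q \<Longrightarrow> quad n (p - q)"
  using keys_diff[of p q] by (auto simp: lin_def quad_def)

lemma quad_mult:
  assumes "lin n p" "lin n q" shows "quad n (p * q)"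
  using keys_mult[of p q] assms by (fastforce simp: lin_def quad_def lin_exps_def quad_exps_def)

section \<open>The mixture of two Gaussians up to degree three\<close>

text \<open>Membership in the \<open>m\<close>-th power of the ideal generated by the variables.\<close>
definition order_ge :: "nat \<Rightarrow> nat cpoly \<Rightarrow> bool" where
  "order_ge m p \<longleftrightarrow> (\<forall>a\<in>Poly_Mapping.keys p. m \<le> mdeg a)"

lemma order_ge_lookup: "order_ge m p \<Longrightarrow> mdeg a < m \<Longrightarrow> Poly_Mapping.lookup p a = 0"
  by (metis in_keys_iff not_le order_ge_def)

lemma order_ge_0: "order_ge 0 p"
  by (simp add: order_ge_def)

lemma order_ge_add: "order_ge m p \<Longrightarrow> order_ge m q \<Longrightarrow> order_ge m (p + q)"
  using keys_add[of p q] by (auto simp: order_ge_def)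

lemma order_ge_mult: "order_ge m p \<Longrightarrow> order_ge k q \<Longrightarrow> order_ge (m + k) (p * q)"
  using keys_mult[of p q] by (fastforce simp: order_ge_def mdeg_add)

lemma order_ge_lin: "lin n p \<Longrightarrow> order_ge 1 p"
  and order_ge_quad: "quad n p \<Longrightarrow> order_ge 2 p"
  using mdeg_lin_exps mdeg_quad_exps unfolding lin_def quad_def order_ge_def by fastforce+

text \<open>The part of \<open>exp M * exp S\<close> of degree at most three, for \<open>M\<close> linear and \<open>S\<close> quadratic.\<close>
definition taylor3 :: "nat cpoly \<Rightarrow> nat cpoly \<Rightarrow> nat cpoly" where
  "taylor3 M S = 1 + M + (cnst (1 / 2) * M ^ 2 + S) + (cnst (1 / 6) * M ^ 3 + M * S)"

lemma trunc_exp_3: "trunc_exp 3 f = 1 + f + cnst (1 / 2) * f ^ 2 + cnst (1 / 6) * f ^ 3"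
proof -
  have "{..3 :: nat} = {0, 1, 2, 3}" by auto
  then show ?thesis by (simp add: trunc_exp_def fact_numeral add_ac)
qed

lemma trunc_exp_product:
  assumes L: "lin n L" and Q: "quad n Q"
  obtains R where "order_ge 4 R" "trunc_exp 3 L * trunc_exp 3 Q = taylor3 L Q + R"
proof
  let ?h = "cnst (1 / 2)" and ?s = "cnst (1 / 6)"
  let ?R = "(L * L) * Q * (?h + ?s * L) + Q * Q * ((?h + ?s * Q) * (1 + L + ?h * L ^ 2 + ?s * L ^ 3))"
  have LL: "order_ge 2 (L * L)" using order_ge_mult[OF order_ge_lin[OF L] order_ge_lin[OF L]] by (simp add: numeral_2_eq_2)
  have "order_ge 4 ((L * L) * Q)" using order_ge_mult[OF LL order_ge_quad[OF Q]] by simp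
  from order_ge_mult[OF this order_ge_0] have 1: "order_ge 4 ((L * L) * Q * (?h + ?s * L))" by simp
  have "order_ge 4 (Q * Q)" using order_ge_mult[OF order_ge_quad[OF Q] order_ge_quad[OF Q]] by simp
  from order_ge_mult[OF this order_ge_0]
  have "order_ge 4 (Q * Q * ((?h + ?s * Q) * (1 + L + ?h * L ^ 2 + ?s * L ^ 3)))" by simp
  with 1 show "order_ge 4 ?R" by (rule order_ge_add)
  show "trunc_exp 3 L * trunc_exp 3 Q = taylor3 L Q + ?R"
    unfolding trunc_exp_3 taylor3_def by (simp add: algebra_simps power2_eq_square power3_eq_cube)
qed

text \<open>
  Centring at the mean, in a form that requires only ring arithmetic; \<open>h\<close> and \<open>s\<close> are to be \<open>1 / 2\<close> and
  \<open>1 / 6\<close>. Write \<open>L0 = M - b * D\<close> and \<open>L1 = M + a * D\<close>. The terms of second order in \<open>D\<close> are those of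
  the between-component covariance and go into \<open>S\<close>. What remains in degree three is divisible by \<open>D\<close>,
  because a third central moment vanishes if the means coincide.
\<close>
lemma mixture_identity:
  fixes a b h s L0 L1 Q0 Q1 :: "'a :: comm_ring_1"
  assumes "b = 1 - a" "h = 3 * s"
  defines "M \<equiv> a * L0 + b * L1" and "D \<equiv> L1 - L0"
  defines "S \<equiv> a * Q0 + b * Q1 + a * b * h * D ^ 2"
    and "R \<equiv> a * b * (Q1 - Q0 + (a - b) * s * D ^ 2)"
  shows "a * (1 + L0 + (h * L0 ^ 2 + Q0) + (s * L0 ^ 3 + L0 * Q0)) +
      b * (1 + L1 + (h * L1 ^ 2 + Q1) + (s * L1 ^ 3 + L1 * Q1)) =
    1 + M + (h * M ^ 2 + S) + (s * M ^ 3 + M * S) + D * R"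
  unfolding M_def D_def S_def R_def assms(1,2)
  by (simp add: algebra_simps power2_eq_square power3_eq_cube)

definition factorials :: "nat \<Rightarrow> (nat \<Rightarrow>\<^sub>0 nat) \<Rightarrow> complex" where
  "factorials n a = (\<Prod>i<n. fact (Poly_Mapping.lookup a i))"

lemma factorials_nonzero: "factorials n a \<noteq> 0"
  by (simp add: factorials_def)

definition cubic_moments :: "nat \<Rightarrow> nat cpoly \<Rightarrow> (nat \<Rightarrow>\<^sub>0 nat) \<Rightarrow> complex" where
  "cubic_moments n p a = (if a \<in> moment_indices n 3 then factorials n a * Poly_Mapping.lookup p a else 0)"

text \<open>
  The part of \<open>exp M * (1 + S + D * R)\<close> of degree at most three, where \<open>M\<close> and \<open>D\<close> are
  linear and \<open>S\<close> and \<open>R\<close> quadratic.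
\<close>
definition normal_form :: "nat cpoly \<Rightarrow> nat cpoly \<Rightarrow> nat cpoly \<Rightarrow> nat cpoly \<Rightarrow> nat cpoly" where
  "normal_form M S D R = taylor3 M S + D * R"

lemma moments_two_gaussians:
  fixes w :: "nat \<Rightarrow> complex" and \<mu> :: "nat \<Rightarrow> nat \<Rightarrow> complex" and \<sigma> and n :: nat
  assumes w: "w 1 = 1 - w 0"
  defines "L \<equiv> \<lambda>l. linear_form n (\<mu> l)" and "Q \<equiv> \<lambda>l. half_quadratic_form n (\<sigma> l)"
  defines "D \<equiv> L 1 - L 0"
  shows "moments n 3 2 (w, \<mu>, \<sigma>) = cubic_moments n (normal_form
    (cnst (w 0) * L 0 + cnst (w 1) * L 1)
    (cnst (w 0) * Q 0 + cnst (w 1) * Q 1 + cnst (w 0 * w 1 / 2) * D ^ 2)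
    D
    (cnst (w 0 * w 1) * (Q 1 - Q 0 + cnst ((w 0 - w 1) / 6) * D ^ 2)))"
    (is "_ = cubic_moments n ?G")
proof -
  obtain R where R: "\<And>l. order_ge 4 (R l)"
    "\<And>l. trunc_exp 3 (L l) * trunc_exp 3 (Q l) = taylor3 (L l) (Q l) + R l"
  proof -
    have "\<forall>l. \<exists>R. order_ge 4 R \<and> trunc_exp 3 (L l) * trunc_exp 3 (Q l) = taylor3 (L l) (Q l) + R"
      unfolding L_def Q_def by (meson trunc_exp_product lin_linear_form quad_half_quadratic_form)
    from choice[OF this] show ?thesis using that by blast
  qed
  have "mixture_gen_fun n 3 2 (w, \<mu>, \<sigma>) =
      cnst (w 0) * (trunc_exp 3 (L 0) * trunc_exp 3 (Q 0)) + cnst (w 1) * (trunc_exp 3 (L 1) * trunc_exp 3 (Q 1))"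
    by (simp add: mixture_gen_fun_def L_def Q_def numeral_2_eq_2 mult.assoc)
  also have "\<dots> = (cnst (w 0) * taylor3 (L 0) (Q 0) + cnst (w 1) * taylor3 (L 1) (Q 1)) +
      (cnst (w 0) * R 0 + cnst (w 1) * R 1)"
    unfolding R(2) by (simp add: algebra_simps)
  also have "cnst (w 0) * taylor3 (L 0) (Q 0) + cnst (w 1) * taylor3 (L 1) (Q 1) = ?G"
  proof -
    have one: "cnst 1 = 1" by simp
    have b: "cnst (w 1) = 1 - cnst (w 0)" unfolding w single_diff one ..
    have h: "cnst (1 / 2) = 3 * cnst (1 / 6)"
      using mult_single[of 0 "3 :: complex" "0 :: nat \<Rightarrow>\<^sub>0 nat" "1 / 6"] by simp
    have c1: "cnst (w 0 * w 1 / 2) = cnst (w 0) * cnst (w 1) * cnst (1 / 2)"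
      "cnst (w 0 * w 1) = cnst (w 0) * cnst (w 1)"
      "cnst ((w 0 - w 1) / 6) = (cnst (w 0) - cnst (w 1)) * cnst (1 / 6)"
      by (simp_all add: mult_single flip: single_diff)
    show ?thesis
      unfolding normal_form_def taylor3_def c1 D_def by (rule mixture_identity[OF b h])
  qed
  finally have gen: "mixture_gen_fun n 3 2 (w, \<mu>, \<sigma>) = ?G + (cnst (w 0) * R 0 + cnst (w 1) * R 1)" .
  have "order_ge 4 (cnst (w 0) * R 0 + cnst (w 1) * R 1)"
    using order_ge_add[OF order_ge_mult[OF order_ge_0 R(1)] order_ge_mult[OF order_ge_0 R(1)]] by simp
  then have "Poly_Mapping.lookup (cnst (w 0) * R 0 + cnst (w 1) * R 1) a = 0" if "a \<in> moment_indices n 3" for a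
    using that by (intro order_ge_lookup) (auto simp: moment_indices_def)
  then show ?thesis
    by (auto simp: fun_eq_iff moments_def cubic_moments_def factorials_def gen lookup_add)
qed

text \<open>
  For the inclusion from right to left, take equal weights. Then the means \<open>M - D / 2\<close> and \<open>M + D / 2\<close>
  and the half covariance forms \<open>S - D\<^sup>2 / 8 - 2 R\<close> and \<open>S - D\<^sup>2 / 8 + 2 R\<close> realize the given normal form.
\<close>
lemma moments_two_gaussians_image:
  "moments n 3 2 ` gauss_params n 2 =
     {cubic_moments n (normal_form M S D R) |M S D R. lin n M \<and> quad n S \<and> lin n D \<and> quad n R}"
proof (intro equalityI subsetI)
  fix x assume "x \<in> moments n 3 2 ` gauss_params n 2"
  then obtain w \<mu> \<sigma> where x: "x = moments n 3 2 (w, \<mu>, \<sigma>)" "(w, \<mu>, \<sigma>) \<in> gauss_params n 2" by auto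
  then have "w 0 + w 1 = 1" by (auto simp: gauss_params_def numeral_2_eq_2)
  then have w: "w 1 = 1 - w 0" by (simp add: algebra_simps)
  let ?D = "linear_form n (\<mu> 1) - linear_form n (\<mu> 0)"
  have D: "lin n ?D" by (intro lin_diff lin_linear_form)
  then have D2: "quad n (?D ^ 2)" unfolding power2_eq_square by (intro quad_mult)
  have "quad n (cnst (w 0) * half_quadratic_form n (\<sigma> 0) + cnst (w 1) * half_quadratic_form n (\<sigma> 1) +
      cnst (w 0 * w 1 / 2) * ?D ^ 2)"
    "quad n (cnst (w 0 * w 1) * (half_quadratic_form n (\<sigma> 1) - half_quadratic_form n (\<sigma> 0) +
      cnst ((w 0 - w 1) / 6) * ?D ^ 2))"
    by (intro quad_add quad_cmult quad_diff quad_half_quadratic_form D2)+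
  moreover have "lin n (cnst (w 0) * linear_form n (\<mu> 0) + cnst (w 1) * linear_form n (\<mu> 1))"
    by (intro lin_add lin_cmult lin_linear_form)
  ultimately show "x \<in> {cubic_moments n (normal_form M S D R) |M S D R. lin n M \<and> quad n S \<and> lin n D \<and> quad n R}"
    unfolding x(1) moments_two_gaussians[OF w] using D by blast
next
  fix x assume "x \<in> {cubic_moments n (normal_form M S D R) |M S D R. lin n M \<and> quad n S \<and> lin n D \<and> quad n R}"
  then obtain M S D R where x: "x = cubic_moments n (normal_form M S D R)"
    and M: "lin n M" and S: "quad n S" and D: "lin n D" and R: "quad n R" by blast
  let ?h = "cnst (1 / 2)"
  let ?L = "\<lambda>l :: nat. if l = 0 then M - ?h * D else M + ?h * D"
  let ?Q = "\<lambda>l :: nat. if l = 0 then S - cnst (1 / 8) * (D * D) - cnst 2 * R else S - cnst (1 / 8) * (D * D) + cnst 2 * R"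
  have LQ: "lin n (?L l)" "quad n (?Q l)" for l
    using M S R quad_mult[OF D D] D
    by (auto simp del: single_numeral intro!: lin_add lin_diff lin_cmult quad_add quad_diff quad_cmult)
  have "\<forall>l. \<exists>m. (\<forall>i. \<not> i < n \<longrightarrow> m i = 0) \<and> linear_form n m = ?L l"
    using lin_eq_linear_form[OF LQ(1)] by (metis (lifting))
  from choice[OF this] obtain \<mu>' where \<mu>': "\<And>l i. \<not> i < n \<Longrightarrow> \<mu>' l i = 0"
    "\<And>l. linear_form n (\<mu>' l) = ?L l" by blast
  have "\<forall>l. \<exists>s. (\<forall>i j. \<not> (i < n \<and> j < n) \<longrightarrow> s i j = 0) \<and> (\<forall>i j. s i j = s j i) \<and> half_quadratic_form n s = ?Q l"
    using quad_eq_half_quadratic_form[OF LQ(2)] by (metis (lifting))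
  from choice[OF this] obtain \<sigma>' where
    \<sigma>': "\<And>l i j. \<not> (i < n \<and> j < n) \<Longrightarrow> \<sigma>' l i j = 0" "\<And>l i j. \<sigma>' l i j = \<sigma>' l j i"
      "\<And>l. half_quadratic_form n (\<sigma>' l) = ?Q l"
    by blast
  define w :: "nat \<Rightarrow> complex" where "w l = (if l < 2 then 1 / 2 else 0)" for l
  define \<mu> where "\<mu> l = (if l < 2 then \<mu>' l else (\<lambda>_. 0))" for l :: nat
  define \<sigma> where "\<sigma> l = (if l < 2 then \<sigma>' l else (\<lambda>_ _. 0))" for l :: nat
  have "(w, \<mu>, \<sigma>) \<in> gauss_params n 2"
    using \<mu>'(1) \<sigma>'(1,2) by (auto simp: gauss_params_def w_def \<mu>_def \<sigma>_def numeral_2_eq_2)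
  moreover have "moments n 3 2 (w, \<mu>, \<sigma>) = x"
  proof -
    have w: "w 1 = 1 - w 0" by (simp add: w_def)
    have L: "linear_form n (\<mu> 0) = M - ?h * D" "linear_form n (\<mu> 1) = M + ?h * D"
      by (simp_all add: \<mu>_def \<mu>'(2))
    have Q: "half_quadratic_form n (\<sigma> 0) = S - cnst (1 / 8) * (D * D) - cnst 2 * R"
      "half_quadratic_form n (\<sigma> 1) = S - cnst (1 / 8) * (D * D) + cnst 2 * R"
      by (simp_all add: \<sigma>_def \<sigma>'(3))
    have w01: "w 0 = 1 / 2" "w 1 = 1 / 2" by (simp_all add: w_def)
    have lk: "p = q" if "\<And>b. Poly_Mapping.lookup p b = Poly_Mapping.lookup q b" for p q :: "nat cpoly"
      using that by (rule poly_mapping_eqI)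
    have 1: "?h * (M - ?h * D) + ?h * (M + ?h * D) = M"
      by (rule lk, simp only: lookup_add lookup_minus lookup_cmult power2_eq_square, simp add: field_simps)
    have 2: "(M + ?h * D) - (M - ?h * D) = D"
      by (rule lk, simp only: lookup_add lookup_minus lookup_cmult power2_eq_square, simp add: field_simps)
    have 3: "?h * (S - cnst (1 / 8) * (D * D) - cnst 2 * R) + ?h * (S - cnst (1 / 8) * (D * D) + cnst 2 * R)
        + cnst (1 / 2 * (1 / 2) / 2) * D ^ 2 = S"
      by (rule lk, simp only: lookup_add lookup_minus lookup_cmult power2_eq_square, simp add: field_simps)
    have 4: "cnst (1 / 2 * (1 / 2)) * ((S - cnst (1 / 8) * (D * D) + cnst 2 * R) - (S - cnst (1 / 8) * (D * D) - cnst 2 * R)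
        + cnst ((1 / 2 - 1 / 2) / 6) * D ^ 2) = R"
      by (rule lk, simp only: lookup_add lookup_minus lookup_cmult power2_eq_square, simp add: field_simps)
    show ?thesis unfolding moments_two_gaussians[OF w] L Q w01 x 2 1 3 4 ..
  qed
  ultimately show "x \<in> moments n 3 2 ` gauss_params n 2" by blast
qed

section \<open>Parametrizing the third-order moments\<close>

text \<open>
  The first of these rules would rewrite the exponent vector of the variable with index \<open>0\<close> to the
  number \<open>1\<close>, since \<^typ>\<open>nat \<Rightarrow>\<^sub>0 nat\<close> is itself a semiring of polynomials.
\<close>
declare single_one [simp del] One_nat_def [simp del]

definition line_exps :: "nat \<Rightarrow> (nat \<Rightarrow>\<^sub>0 nat) set" where
  "line_exps n = (\<lambda>i. unit_exp i + (unit_exp 1 + unit_exp 1)) ` {1..<n}"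

text \<open>
  The parameters are indexed by the moments that they control to first order. A coefficient of \<open>M\<close> or
  \<open>S\<close> belongs to its own monomial. The base point for \<open>D * R\<close> is \<open>t\<^sub>0 * t\<^sub>1\<^sup>2\<close>: the coefficient of
  \<open>t\<^sub>i\<close> in \<open>D\<close>, with \<open>i \<ge> 1\<close>, belongs to \<open>t\<^sub>i * t\<^sub>1\<^sup>2\<close>, and the coefficient of \<open>b\<close> in \<open>R\<close> to
  \<open>t\<^sub>0 * b\<close>. These cubic monomials are distinct, as only the latter contain \<open>t\<^sub>0\<close>.
\<close>
definition param_exps :: "nat \<Rightarrow> (nat \<Rightarrow>\<^sub>0 nat) set" where
  "param_exps n = (lin_exps n \<union> quad_exps n) \<union> (line_exps n \<union> (\<lambda>b. unit_exp 0 + b) ` quad_exps n)"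

lemma finite_line_exps [simp]: "finite (line_exps n)"
  by (simp add: line_exps_def)

lemma finite_param_exps [simp]: "finite (param_exps n)"
  by (simp add: param_exps_def)

lemma card_quad_exps: "2 * card (quad_exps n) = n * (n + 1)"
proof -
  let ?P = "SIGMA j:{..<n}. {..j}"
  let ?f = "\<lambda>(i, j). unit_exp i + unit_exp j"
  have "quad_exps n = ?f ` ?P"
  proof (intro equalityI subsetI)
    fix b assume "b \<in> quad_exps n"
    then obtain i j where ij: "i < n" "j < n" "b = unit_exp i + unit_exp j" by (auto simp: quad_exps_def)
    show "b \<in> ?f ` ?P"
    proof (cases "j \<le> i")
      case True
      then show ?thesis using ij by (intro image_eqI[of _ _ "(i, j)"]) auto
    next
      case False
      then show ?thesis using ij by (intro image_eqI[of _ _ "(j, i)"]) (auto simp: add.commute)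
    qed
  next
    fix b assume "b \<in> ?f ` ?P"
    then obtain i j where "i < n" "j \<le> i" "b = unit_exp i + unit_exp j" by auto
    then show "b \<in> quad_exps n" unfolding quad_exps_def by (intro image_eqI[of _ _ "(i, j)"]) auto
  qed
  moreover have "inj_on ?f ?P"
    by (rule inj_onI) (auto simp: unit_exp_add_eq_iff)
  ultimately have "card (quad_exps n) = card ?P" by (simp add: card_image)
  also have "\<dots> = (\<Sum>j<n. Suc j)" by simp
  also have "2 * \<dots> = n * (n + 1)" by (induction n) simp_all
  finally show ?thesis .
qed

lemma mdeg_param_parts:
  "a \<in> line_exps n \<Longrightarrow> mdeg a = 3" "a \<in> (\<lambda>b. unit_exp 0 + b) ` quad_exps n \<Longrightarrow> mdeg a = 3"
  using mdeg_quad_exps by (auto simp: line_exps_def mdeg_add mdeg_unit_exp)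

lemma lookup_0_line_exps: "a \<in> line_exps n \<Longrightarrow> Poly_Mapping.lookup a 0 = 0"
  by (auto simp: line_exps_def lookup_add lookup_single when_def)

lemma lookup_0_shifted: "a \<in> (\<lambda>b. unit_exp 0 + b) ` B \<Longrightarrow> Poly_Mapping.lookup a 0 \<noteq> 0"
  by (auto simp: lookup_add)

lemma param_exps_disjoint:
  "lin_exps n \<inter> quad_exps n = {}"
  "(lin_exps n \<union> quad_exps n) \<inter> (line_exps n \<union> (\<lambda>b. unit_exp 0 + b) ` quad_exps n) = {}"
  "line_exps n \<inter> (\<lambda>b. unit_exp 0 + b) ` quad_exps n = {}"
proof -
  show "lin_exps n \<inter> quad_exps n = {}"
    using mdeg_lin_exps mdeg_quad_exps by fastforce
  show "(lin_exps n \<union> quad_exps n) \<inter> (line_exps n \<union> (\<lambda>b. unit_exp 0 + b) ` quad_exps n) = {}"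
    using mdeg_lin_exps mdeg_quad_exps mdeg_param_parts by fastforce
  show "line_exps n \<inter> (\<lambda>b. unit_exp 0 + b) ` quad_exps n = {}"
    using lookup_0_line_exps lookup_0_shifted by blast
qed

lemma inj_exps:
  "inj_on unit_exp A" "inj_on (\<lambda>i. unit_exp i + c) A" "inj_on (\<lambda>b. c + b) B"
  for c :: "nat \<Rightarrow>\<^sub>0 nat"
  by (simp_all add: inj_on_def unit_exp_eq_iff)

lemma card_param_exps: "1 \<le> n \<Longrightarrow> card (param_exps n) = n * (n + 3) - 1"
proof -
  assume n: "1 \<le> n"
  have "card (param_exps n) = (card (lin_exps n) + card (quad_exps n)) +
      (card (line_exps n) + card ((\<lambda>b. unit_exp 0 + b) ` quad_exps n))"
    unfolding param_exps_def using param_exps_disjoint[of n] by (simp add: card_Un_disjoint)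
  also have "\<dots> = (n + card (quad_exps n)) + ((n - 1) + card (quad_exps n))"
    unfolding lin_exps_def line_exps_def by (simp add: card_image inj_exps)
  also have "\<dots> = 2 * card (quad_exps n) + (2 * n - 1)" using n by simp
  finally show ?thesis using n unfolding card_quad_exps by (simp add: algebra_simps)
qed

lemma sum_param_exps:
  fixes f :: "(nat \<Rightarrow>\<^sub>0 nat) \<Rightarrow> nat cpoly"
  shows "(\<Sum>a\<in>param_exps n. f a) = (\<Sum>a\<in>lin_exps n. f a) + (\<Sum>a\<in>quad_exps n. f a) +
    (\<Sum>i\<in>{1..<n}. f (unit_exp i + (unit_exp 1 + unit_exp 1))) + (\<Sum>b\<in>quad_exps n. f (unit_exp 0 + b))"
proof -
  have "(\<Sum>a\<in>param_exps n. f a) = (sum f (lin_exps n) + sum f (quad_exps n)) +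
      (sum f (line_exps n) + sum f ((\<lambda>b. unit_exp 0 + b) ` quad_exps n))"
    unfolding param_exps_def using param_exps_disjoint[of n] by (simp add: sum.union_disjoint)
  then show ?thesis
    unfolding line_exps_def by (simp add: sum.reindex inj_exps)
qed

definition lin_part :: "nat \<Rightarrow> ((nat \<Rightarrow>\<^sub>0 nat) \<Rightarrow> complex) \<Rightarrow> nat cpoly" where
  "lin_part n U = (\<Sum>b\<in>lin_exps n. Poly_Mapping.single b (U b))"

definition quad_part :: "nat \<Rightarrow> ((nat \<Rightarrow>\<^sub>0 nat) \<Rightarrow> complex) \<Rightarrow> nat cpoly" where
  "quad_part n U = (\<Sum>b\<in>quad_exps n. Poly_Mapping.single b (U b))"

definition line_part :: "nat \<Rightarrow> ((nat \<Rightarrow>\<^sub>0 nat) \<Rightarrow> complex) \<Rightarrow> nat cpoly" where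
  "line_part n U = (\<Sum>i\<in>{1..<n}. Poly_Mapping.single (unit_exp i) (U (unit_exp i + (unit_exp 1 + unit_exp 1))))"

definition cofactor_part :: "nat \<Rightarrow> ((nat \<Rightarrow>\<^sub>0 nat) \<Rightarrow> complex) \<Rightarrow> nat cpoly" where
  "cofactor_part n U = (\<Sum>b\<in>quad_exps n. Poly_Mapping.single b (U (unit_exp 0 + b)))"

text \<open>
  The coefficient of \<open>t\<^sub>0\<close> in \<open>D\<close> is normalized to \<open>1\<close>, which removes the freedom of scaling \<open>D\<close> against
  \<open>R\<close>.
\<close>
definition normal_param :: "nat \<Rightarrow> ((nat \<Rightarrow>\<^sub>0 nat) \<Rightarrow> complex) \<Rightarrow> nat cpoly" where
  "normal_param n U = normal_form (lin_part n U) (quad_part n U) (pvar 0 + line_part n U)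
     (pvar 1 * pvar 1 + cofactor_part n U)"

lemma lin_quad_parts:
  "lin n (lin_part n U)" "quad n (quad_part n U)" "lin n (line_part n U)" "quad n (cofactor_part n U)"
proof -
  show "lin n (lin_part n U)" "quad n (quad_part n U)" "quad n (cofactor_part n U)"
    unfolding lin_def quad_def lin_part_def quad_part_def cofactor_part_def
    by (rule order_trans[OF keys_sum_single], simp, simp)+
  show "lin n (line_part n U)"
    unfolding lin_def line_part_def
    by (rule order_trans[OF keys_sum_single]) (auto simp: lin_exps_def)
qed

lemma lin_pvar: "i < n \<Longrightarrow> lin n (pvar i)"
  by (auto simp: lin_def lin_exps_def)

lemma normal_param_is_moment:
  assumes "2 \<le> n"
  shows "cubic_moments n (normal_param n U) \<in> moments n 3 2 ` gauss_params n 2"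
proof -
  have "lin n (pvar 0)" "lin n (pvar 1)" using assms by (simp_all add: lin_pvar)
  then have "lin n (pvar 0 + line_part n U)" "quad n (pvar 1 * pvar 1 + cofactor_part n U)"
    by (simp_all add: lin_add quad_add quad_mult lin_quad_parts)
  then show ?thesis
    unfolding moments_two_gaussians_image normal_param_def using lin_quad_parts by blast
qed

text \<open>The left-hand side is the linear term of \<open>normal_param n (t * U)\<close> in \<open>t\<close>.\<close>
lemma tangent_is_identity:
  "lin_part n U + quad_part n U + line_part n U * (pvar 1 * pvar 1) + pvar 0 * cofactor_part n U =
     (\<Sum>a\<in>param_exps n. Poly_Mapping.single a (U a))"
  unfolding sum_param_exps lin_part_def quad_part_def line_part_def cofactor_part_def
  by (simp add: sum_distrib_left sum_distrib_right mult_single)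

lemma parts_scale:
  "lin_part n (\<lambda>a. t * U a) = cnst t * lin_part n U"
  "quad_part n (\<lambda>a. t * U a) = cnst t * quad_part n U"
  "line_part n (\<lambda>a. t * U a) = cnst t * line_part n U"
  "cofactor_part n (\<lambda>a. t * U a) = cnst t * cofactor_part n U"
  by (simp_all add: lin_part_def quad_part_def line_part_def cofactor_part_def sum_distrib_left mult_single)

lemma normal_param_deriv:
  assumes a: "a \<in> param_exps n"
  shows "((\<lambda>t. Poly_Mapping.lookup (normal_param n (\<lambda>b. t * U b)) a) has_field_derivative U a) (at 0)"
proof -
  let ?M = "lin_part n U" and ?S = "quad_part n U" and ?D = "line_part n U" and ?R = "cofactor_part n U"
  let ?P = "pvar 1 * pvar 1" and ?T = "pvar 0"
  define A0 where "A0 = 1 + ?T * ?P"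
  define A1 where "A1 = ?M + ?S + ?D * ?P + ?T * ?R"
  define A2 where "A2 = cnst (1 / 2) * ?M ^ 2 + ?M * ?S + ?D * ?R"
  define A3 where "A3 = cnst (1 / 6) * ?M ^ 3"
  have "normal_param n (\<lambda>b. t * U b) = A0 + cnst t * A1 + cnst t * (cnst t * A2) + cnst t * (cnst t * (cnst t * A3))" for t
    unfolding normal_param_def normal_form_def taylor3_def parts_scale A0_def A1_def A2_def A3_def
    by (simp add: algebra_simps power2_eq_square power3_eq_cube)
  then have "Poly_Mapping.lookup (normal_param n (\<lambda>b. t * U b)) a = Poly_Mapping.lookup A0 a +
      t * Poly_Mapping.lookup A1 a + t * (t * Poly_Mapping.lookup A2 a) + t * (t * (t * Poly_Mapping.lookup A3 a))" for t
    by (simp add: lookup_add lookup_cmult)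
  moreover have "Poly_Mapping.lookup A1 a = U a"
    using a unfolding A1_def tangent_is_identity by (simp add: lookup_sum lookup_single when_def)
  ultimately show ?thesis by (auto intro!: derivative_eq_intros)
qed

text \<open>
  Polynomials with coefficients that depend polynomially on parameters. Thanks to the common finite
  support, the coefficients of a product are sums over an index set independent of the parameters.
\<close>
definition polyfam :: "'v set \<Rightarrow> (('v \<Rightarrow> complex) \<Rightarrow> nat cpoly) \<Rightarrow> bool" where
  "polyfam V F \<longleftrightarrow> (\<exists>B. finite B \<and> (\<forall>u. Poly_Mapping.keys (F u) \<subseteq> B)) \<and>
     (\<forall>a. polyfun V (\<lambda>u. Poly_Mapping.lookup (F u) a))"

lemma polyfam_const: "polyfam V (\<lambda>u. p)"
  unfolding polyfam_def by (auto intro: polyfun.const exI[of _ "Poly_Mapping.keys p"])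

lemma polyfam_single: "polyfun V f \<Longrightarrow> polyfam V (\<lambda>u. Poly_Mapping.single a (f u))"
  unfolding polyfam_def
proof (intro conjI allI)
  fix b assume "polyfun V f"
  then show "polyfun V (\<lambda>u. Poly_Mapping.lookup (Poly_Mapping.single a (f u)) b)"
    by (cases "a = b") (auto simp: lookup_single intro: polyfun.const)
qed (auto intro: exI[of _ "{a}"])

lemma polyfam_add:
  assumes "polyfam V F" "polyfam V G" shows "polyfam V (\<lambda>u. F u + G u)"
proof -
  obtain B C where "finite B" "\<And>u. Poly_Mapping.keys (F u) \<subseteq> B" "finite C" "\<And>u. Poly_Mapping.keys (G u) \<subseteq> C"
    using assms unfolding polyfam_def by auto
  then have "finite (B \<union> C)" "Poly_Mapping.keys (F u + G u) \<subseteq> B \<union> C" for u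
    using keys_add[of "F u" "G u"] by blast+
  then have "\<exists>B. finite B \<and> (\<forall>u. Poly_Mapping.keys (F u + G u) \<subseteq> B)" by blast
  then show ?thesis
    using assms unfolding polyfam_def lookup_add by (auto intro: polyfun.add)
qed

lemma polyfam_mult:
  assumes "polyfam V F" "polyfam V G" shows "polyfam V (\<lambda>u. F u * G u)"
proof -
  obtain B C where B: "finite B" "\<And>u. Poly_Mapping.keys (F u) \<subseteq> B"
    and C: "finite C" "\<And>u. Poly_Mapping.keys (G u) \<subseteq> C"
    using assms unfolding polyfam_def by auto
  have eq: "F u * G u = (\<Sum>b\<in>B. \<Sum>c\<in>C. Poly_Mapping.single (b + c) (Poly_Mapping.lookup (F u) b * Poly_Mapping.lookup (G u) c))" for u
  proof -
    have "F u * G u = (\<Sum>b\<in>B. Poly_Mapping.single b (Poly_Mapping.lookup (F u) b)) *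
        (\<Sum>c\<in>C. Poly_Mapping.single c (Poly_Mapping.lookup (G u) c))"
      using expand_over_superset[OF B(1) B(2)[of u]] expand_over_superset[OF C(1) C(2)[of u]] by simp
    then show ?thesis by (simp add: sum_product mult_single)
  qed
  have "finite ((\<lambda>(b, c). b + c) ` (B \<times> C))" using B(1) C(1) by simp
  moreover have "Poly_Mapping.keys (F u * G u) \<subseteq> (\<lambda>(b, c). b + c) ` (B \<times> C)" for u
    using keys_mult[of "F u" "G u"] B(2)[of u] C(2)[of u] by fastforce
  ultimately have "\<exists>B. finite B \<and> (\<forall>u. Poly_Mapping.keys (F u * G u) \<subseteq> B)" by blast
  moreover have "polyfun V (\<lambda>u. Poly_Mapping.lookup (F u * G u) a)" for a
  proof -
    have "polyfun V (\<lambda>u. if b + c = a then Poly_Mapping.lookup (F u) b * Poly_Mapping.lookup (G u) c else 0)" for b c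
      using assms unfolding polyfam_def by (cases "b + c = a") (auto intro: polyfun.const polyfun.mult)
    then show ?thesis unfolding eq lookup_sum lookup_single when_def by (intro polyfun_sum) auto
  qed
  ultimately show ?thesis unfolding polyfam_def by blast
qed

lemma polyfam_sum: "(\<And>i. i \<in> A \<Longrightarrow> polyfam V (F i)) \<Longrightarrow> polyfam V (\<lambda>u. \<Sum>i\<in>A. F i u)"
  by (induction A rule: infinite_finite_induct) (auto intro: polyfam_const polyfam_add)

lemma polyfun_normal_param:
  assumes V: "\<And>a. a \<in> param_exps n \<Longrightarrow> polyfun V (\<lambda>u. W u a)"
  shows "polyfun V (\<lambda>u. cubic_moments n (normal_param n (W u)) a)"
proof -
  have sub: "lin_exps n \<subseteq> param_exps n" "quad_exps n \<subseteq> param_exps n"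
    "\<And>i. i \<in> {1..<n} \<Longrightarrow> unit_exp i + (unit_exp 1 + unit_exp 1) \<in> param_exps n"
    "\<And>b. b \<in> quad_exps n \<Longrightarrow> unit_exp 0 + b \<in> param_exps n"
    unfolding param_exps_def line_exps_def by blast+
  have parts: "polyfam V (\<lambda>u. lin_part n (W u))" "polyfam V (\<lambda>u. quad_part n (W u))"
    "polyfam V (\<lambda>u. line_part n (W u))" "polyfam V (\<lambda>u. cofactor_part n (W u))"
    unfolding lin_part_def quad_part_def line_part_def cofactor_part_def
    using sub by (intro polyfam_sum polyfam_single V; blast)+
  have "polyfam V (\<lambda>u. normal_param n (W u))"
    unfolding normal_param_def normal_form_def taylor3_def power2_eq_square power3_eq_cube
    by (intro polyfam_add polyfam_mult polyfam_const parts)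
  then have "polyfun V (\<lambda>u. Poly_Mapping.lookup (normal_param n (W u)) a)" by (simp add: polyfam_def)
  then show ?thesis
    by (cases "a \<in> moment_indices n 3") (auto simp: cubic_moments_def intro!: polyfun_intros)
qed

text \<open>
  Dividing \<open>D\<close> by its coefficient of \<open>t\<^sub>0\<close> and multiplying \<open>R\<close> with it leaves \<open>D * R\<close> unchanged. The value
  of \<open>U\<close> at \<open>0\<close> is free because \<open>0\<close> is not among the indices of the parameters; it will hold the scaling
  factor of the cone.
\<close>
lemma normal_form_normalized:
  assumes M: "lin n M" and S: "quad n S" and D: "lin n D" and R: "quad n R" and n: "2 \<le> n"
    and d: "Poly_Mapping.lookup D (unit_exp 0) \<noteq> 0"
  shows "\<exists>U. U 0 = c \<and> normal_param n U = normal_form M S D R"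
proof -
  let ?d = "Poly_Mapping.lookup D (unit_exp 0)"
  let ?e = "unit_exp 1 + unit_exp 1"
  define D' where "D' = cnst (1 / ?d) * D"
  define R' where "R' = cnst ?d * R - pvar 1 * pvar 1"
  have "lin n D'" unfolding D'_def by (rule lin_cmult[OF D])
  have "lin n (pvar 1)" using n by (intro lin_pvar) auto
  then have R': "quad n R'" unfolding R'_def by (intro quad_diff quad_cmult R quad_mult)
  define U where "U a = (if a = 0 then c else if mdeg a = 1 then Poly_Mapping.lookup M a
    else if mdeg a = 2 then Poly_Mapping.lookup S a
    else if Poly_Mapping.lookup a 0 = 0 then Poly_Mapping.lookup D' (a - ?e)
    else Poly_Mapping.lookup R' (a - unit_exp 0))" for a
  have nz: "a \<noteq> 0" if "0 < mdeg a" for a :: "nat \<Rightarrow>\<^sub>0 nat" using that by (auto simp: mdeg_def)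
  have "lin_part n U = M"
  proof -
    have "lin_part n U = (\<Sum>b\<in>lin_exps n. Poly_Mapping.single b (Poly_Mapping.lookup M b))"
      unfolding lin_part_def using nz by (intro sum.cong refl) (auto simp: U_def mdeg_lin_exps)
    then show ?thesis using expand_over_superset[of "lin_exps n" M] M by (simp add: lin_def)
  qed
  moreover have "quad_part n U = S"
  proof -
    have "quad_part n U = (\<Sum>b\<in>quad_exps n. Poly_Mapping.single b (Poly_Mapping.lookup S b))"
      unfolding quad_part_def using nz by (intro sum.cong refl) (auto simp: U_def mdeg_quad_exps)
    then show ?thesis using expand_over_superset[of "quad_exps n" S] S by (simp add: quad_def)
  qed
  moreover have "cofactor_part n U = R'"
  proof -
    have "U (unit_exp 0 + b) = Poly_Mapping.lookup R' b" if "b \<in> quad_exps n" for b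
    proof -
      have "mdeg (unit_exp 0 + b) = 3" "Poly_Mapping.lookup (unit_exp 0 + b) 0 \<noteq> 0"
        using mdeg_param_parts(2)[of "unit_exp 0 + b" n] that by (auto simp: lookup_add)
      then show ?thesis using nz[of "unit_exp 0 + b"] by (simp add: U_def)
    qed
    then show ?thesis using expand_over_superset[of "quad_exps n" R'] R'
      by (simp add: quad_def cofactor_part_def)
  qed
  moreover have "pvar 0 + line_part n U = D'"
  proof -
    have "U (unit_exp i + ?e) = Poly_Mapping.lookup D' (unit_exp i)" if "i \<in> {1..<n}" for i
    proof -
      have "unit_exp i + ?e \<in> line_exps n" using that unfolding line_exps_def by blast
      then have "mdeg (unit_exp i + ?e) = 3" "Poly_Mapping.lookup (unit_exp i + ?e) 0 = 0"
        using mdeg_param_parts(1) lookup_0_line_exps by blast+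
      then show ?thesis using nz[of "unit_exp i + ?e"] unfolding U_def by (simp)
    qed
    then have "line_part n U = (\<Sum>i\<in>{1..<n}. Poly_Mapping.single (unit_exp i) (Poly_Mapping.lookup D' (unit_exp i)))"
      unfolding line_part_def by (intro sum.cong) auto
    moreover have "pvar 0 = Poly_Mapping.single (unit_exp 0) (Poly_Mapping.lookup D' (unit_exp 0))"
      using d by (simp add: D'_def lookup_cmult)
    moreover have "{..<n} = insert 0 {1..<n}" using n by auto
    ultimately have "pvar 0 + line_part n U = (\<Sum>i<n. Poly_Mapping.single (unit_exp i) (Poly_Mapping.lookup D' (unit_exp i)))"
      by (simp)
    also have "\<dots> = (\<Sum>a\<in>lin_exps n. Poly_Mapping.single a (Poly_Mapping.lookup D' a))"
      unfolding lin_exps_def by (simp add: sum.reindex inj_exps)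
    also have "\<dots> = D'" using expand_over_superset[of "lin_exps n" D'] \<open>lin n D'\<close> by (simp add: lin_def)
    finally show ?thesis .
  qed
  moreover have "D' * (pvar 1 * pvar 1 + R') = D * R"
  proof -
    have "D' * (pvar 1 * pvar 1 + R') = cnst (1 / ?d) * cnst ?d * (D * R)"
      unfolding D'_def R'_def by (simp add: algebra_simps)
    also have "cnst (1 / ?d) * cnst ?d = 1" using d by (simp add: mult_single single_one)
    finally show ?thesis by simp
  qed
  ultimately have "normal_param n U = normal_form M S D R"
    by (simp add: normal_param_def normal_form_def)
  moreover have "U 0 = c" by (simp add: U_def)
  ultimately show ?thesis by blast
qed

text \<open>
  Normal forms in which \<open>t\<^sub>0\<close> does not occur in \<open>D\<close> are not reached by the parametrization, but they are
  limits of normal forms that are: replace \<open>D\<close> by \<open>D + t * t\<^sub>0\<close>.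
\<close>
theorem dim_secant_cubic:
  assumes n: "2 \<le> n"
  shows "variety_dim (moment_indices n 3) (gauss_secant 2 n 3) = enat (n * (n + 3) - 1)"
proof (rule antisym)
  let ?I = "moment_indices n 3"
  let ?S = "moments n 3 2 ` gauss_params n 2"
  define r where "r = card (param_exps n)"
  have r: "r = n * (n + 3) - 1" unfolding r_def using n by (intro card_param_exps) auto
  have param_nz: "0 \<notin> param_exps n"
  proof
    assume "0 \<in> param_exps n"
    then have "mdeg (0 :: nat \<Rightarrow>\<^sub>0 nat) \<noteq> 0"
      using mdeg_lin_exps mdeg_quad_exps mdeg_param_parts unfolding param_exps_def by fastforce
    then show False by (simp add: mdeg_def)
  qed
  show "variety_dim ?I (gauss_secant 2 n 3) \<le> enat (n * (n + 3) - 1)"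
    unfolding gauss_secant_eq_closure r[symmetric]
  proof (rule variety_dim_le[OF moments_subset])
    let ?\<Psi> = "\<lambda>U a. U 0 * cubic_moments n (normal_param n U) a"
    let ?V = "insert 0 (param_exps n)"
    show "finite ?V" "card ?V = Suc r" using param_nz by (simp_all add: r_def)
    show "polyfun ?V (\<lambda>U. ?\<Psi> U a)" for a
      by (intro polyfun.mult polyfun.var polyfun_normal_param) auto
    fix f :: "((nat \<Rightarrow>\<^sub>0 nat) \<Rightarrow> complex) \<Rightarrow> complex" and x c
    assume f: "polyfun ?I f" "\<And>U. f (?\<Psi> U) = 0" and x: "x \<in> ?S"
    obtain M S D R where x: "x = cubic_moments n (normal_form M S D R)"
      and M: "lin n M" and S: "quad n S" and D: "lin n D" and R: "quad n R"
      using x unfolding moments_two_gaussians_image by blast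
    have zero: "f (\<lambda>a. c * cubic_moments n (normal_form M S E R) a) = 0"
      if E: "lin n E" "Poly_Mapping.lookup E (unit_exp 0) \<noteq> 0" for E
    proof -
      obtain U where "U 0 = c" "normal_param n U = normal_form M S E R"
        using normal_form_normalized[OF M S E(1) R n E(2)] by blast
      then show ?thesis using f(2)[of U] by simp
    qed
    define \<gamma> where "\<gamma> t a = c * cubic_moments n (normal_form M S (D + cnst t * pvar 0) R) a" for t a
    have curve: "\<exists>p. \<forall>t. \<gamma> t a = poly p t" for a
    proof (cases "a \<in> ?I")
      case True
      have nf: "normal_form M S (D + cnst t * pvar 0) R = normal_form M S D R + cnst t * (pvar 0 * R)" for t
        by (simp only: normal_form_def distrib_right mult.assoc add.assoc)
      have "Poly_Mapping.lookup (normal_form M S (D + cnst t * pvar 0) R) a =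
          Poly_Mapping.lookup (normal_form M S D R) a + t * Poly_Mapping.lookup (pvar 0 * R) a" for t
        unfolding nf lookup_add lookup_cmult ..
      then show ?thesis using True
        by (intro exI[of _ "[:c * (factorials n a * Poly_Mapping.lookup (normal_form M S D R) a),
              c * (factorials n a * Poly_Mapping.lookup (pvar 0 * R) a):]"])
           (simp add: \<gamma>_def cubic_moments_def algebra_simps)
    qed (auto simp: \<gamma>_def cubic_moments_def intro: exI[of _ 0])
    show "f (\<lambda>a. c * x a) = 0"
    proof (rule ccontr)
      assume "f (\<lambda>a. c * x a) \<noteq> 0"
      moreover have "\<gamma> 0 = (\<lambda>a. c * x a)" by (rule ext) (simp add: \<gamma>_def x)
      ultimately have nz: "f (\<gamma> 0) \<noteq> 0" by simp
      from common_nonzero_on_curve[where \<gamma> = \<gamma>, OF f(1) f(1) curve nz nz, of "- Poly_Mapping.lookup D (unit_exp 0)"]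
      obtain t where t: "t \<noteq> - Poly_Mapping.lookup D (unit_exp 0)" "f (\<gamma> t) \<noteq> 0" by blast
      have "Poly_Mapping.lookup (D + cnst t * pvar 0) (unit_exp 0) = Poly_Mapping.lookup D (unit_exp 0) + t"
        by (simp add: lookup_add lookup_cmult)
      then have "Poly_Mapping.lookup (D + cnst t * pvar 0) (unit_exp 0) \<noteq> 0"
        using t(1) by (simp add: add_eq_0_iff)
      moreover have "lin n (D + cnst t * pvar 0)" using n D by (intro lin_add lin_cmult lin_pvar) auto
      ultimately have "f (\<gamma> t) = 0" unfolding \<gamma>_def by (intro zero)
      then show False using t(2) by simp
    qed
  qed
  \<comment> \<open>for the lower bound the parameters are numbered; any order will do, as the differential is diagonal\<close>
  obtain e where e: "bij_betw e {0..<r} (param_exps n)"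
    unfolding r_def using ex_bij_betw_nat_finite[OF finite_param_exps] by blast
  define ei where "ei = the_inv_into {0..<r} e"
  have ei: "ei a < r" "e (ei a) = a" if "a \<in> param_exps n" for a
    using bij_betw_the_inv_into[OF e] f_the_inv_into_f_bij_betw[OF e] that
    by (auto simp: ei_def bij_betw_def)
  have eiE: "ei (e j) = j" "e j \<in> param_exps n" if "j < r" for j
    using the_inv_into_f_f[OF bij_betw_imp_inj_on[OF e]] e that by (auto simp: ei_def bij_betw_def)
  define W where "W u a = (if a \<in> param_exps n then u (ei a) else (0 :: complex))" for u a
  have sub: "param_exps n \<subseteq> ?I"
  proof
    fix a assume a: "a \<in> param_exps n"
    then have "mdeg a \<le> 3"
      using mdeg_lin_exps mdeg_quad_exps mdeg_param_parts unfolding param_exps_def by fastforce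
    moreover have "Poly_Mapping.keys a \<subseteq> {..<n}"
      using a n unfolding param_exps_def lin_exps_def quad_exps_def line_exps_def
      by (auto simp: keys_add_nat split: if_splits)
    ultimately show "a \<in> ?I" by (simp add: moment_indices_def)
  qed
  interpret triangular_parametrization ?I 0 r "\<lambda>u. cubic_moments n (normal_param n (W u))"
    "\<lambda>j x. x (e j)" "\<lambda>j u. factorials n (e j) * u j" "\<lambda>j k. if j = k then factorials n (e j) else 0"
  proof
    show "(0 :: nat \<Rightarrow>\<^sub>0 nat) \<in> ?I" by (simp add: moment_indices_def mdeg_def)
    show "cubic_moments n (normal_param n (W u)) 0 = 1" for u
    proof -
      obtain \<theta> where "cubic_moments n (normal_param n (W u)) = moments n 3 2 \<theta>" "\<theta> \<in> gauss_params n 2"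
        using normal_param_is_moment[OF n, of "W u"] by blast
      then show ?thesis by (simp add: moments_zero)
    qed
    show "cubic_moments n (normal_param n (W u)) i = 0" if "i \<notin> ?I" for u i
      using that by (simp add: cubic_moments_def)
    show "polyfun {..<r} (\<lambda>u. cubic_moments n (normal_param n (W u)) i)" for i
      by (rule polyfun_normal_param) (use ei in \<open>auto simp: W_def intro: polyfun.var\<close>)
    show "polyfun ?I (\<lambda>x. x (e j))" if "j < r" for j
      using eiE(2)[OF that] sub by (intro polyfun.var) auto
    show "((\<lambda>t. cubic_moments n (normal_param n (W (\<lambda>i. t * u i))) (e j)) has_field_derivative
        factorials n (e j) * u j) (at 0)" if j: "j < r" for u j
    proof -
      have "W (\<lambda>i. t * u i) = (\<lambda>a. t * W u a)" for t by (auto simp: W_def)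
      moreover have "e j \<in> ?I" "W u (e j) = u j" using eiE[OF j] sub by (auto simp: W_def)
      ultimately show ?thesis
        using DERIV_cmult[OF normal_param_deriv[OF eiE(2)[OF j], of "W u"], of "factorials n (e j)"]
        by (simp add: cubic_moments_def)
    qed
  qed (auto simp: algebra_simps factorials_nonzero)
  show "enat (n * (n + 3) - 1) \<le> variety_dim ?I (gauss_secant 2 n 3)"
    unfolding gauss_secant_eq_closure r[symmetric]
    by (rule variety_dim_ge) (use normal_param_is_moment[OF n] in auto)
qed

text \<open>Hence the minimum in the expected dimension is the number of parameters.\<close>
lemma choose_3_bound: "3 \<le> n \<Longrightarrow> n * (n + 3) + 2 \<le> (n + 3) choose 3"
proof (induction n rule: dec_induct)
  case base
  show ?case by (simp add: numeral_eq_Suc)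
next
  case (step n)
  have "(n + 3) choose 2 = (n + 3) * (n + 2) div 2" by (simp add: choose_two)
  moreover have "2 * (2 * n + 4) \<le> (n + 3) * (n + 2)" using step(1) by (simp add: algebra_simps)
  ultimately have "2 * n + 4 \<le> (n + 3) choose 2" by simp
  moreover have "(Suc n + 3) choose 3 = ((n + 3) choose 2) + ((n + 3) choose 3)"
    by (simp add: numeral_3_eq_3 numeral_2_eq_2)
  ultimately show ?case using step by (simp add: algebra_simps)
qed

theorem theorem1:
  shows "(\<forall>d k :: nat. 1 \<le> d \<and> 1 \<le> k \<longrightarrow>
            variety_dim (moment_indices 1 d) (gauss_secant k 1 d) = enat (min d (3 * k - 1)))
       \<and> (\<forall>d k :: nat. 1 \<le> d \<and> 1 \<le> k \<and> 3 * k - 1 \<le> d \<longrightarrow>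
            generically_finite_to_one (gauss_params 1 k) (zariski_topology (moment_indices 1 d))
              (moment_map 1 d k))
       \<and> (\<forall>n N :: nat. 3 \<le> n \<and> N = ((n + 3) choose 3) - 1 \<longrightarrow>
            enat (min N (n * (n + 3) + 1))
              - variety_dim (moment_indices n 3) (gauss_secant 2 n 3) = 2)"
proof (intro conjI allI impI)
  fix d k :: nat
  show "variety_dim (moment_indices 1 d) (gauss_secant k 1 d) = enat (min d (3 * k - 1))"
    if "1 \<le> d \<and> 1 \<le> k"
    using that by (intro dim_univariate_secant) simp
  show "generically_finite_to_one (gauss_params 1 k) (zariski_topology (moment_indices 1 d)) (moment_map 1 d k)"
    if "1 \<le> d \<and> 1 \<le> k \<and> 3 * k - 1 \<le> d"
    using that by (intro univariate_generically_finite) simp_all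
next
  fix n N :: nat
  assume n: "3 \<le> n \<and> N = ((n + 3) choose 3) - 1"
  then have "min N (n * (n + 3) + 1) = n * (n + 3) + 1" using choose_3_bound[of n] by simp
  moreover have "variety_dim (moment_indices n 3) (gauss_secant 2 n 3) = enat (n * (n + 3) - 1)"
    using n by (intro dim_secant_cubic) simp
  moreover have "n * (n + 3) + 1 - (n * (n + 3) - 1) = 2" using n by (cases n) simp_all
  ultimately show "enat (min N (n * (n + 3) + 1)) - variety_dim (moment_indices n 3) (gauss_secant 2 n 3) = 2"
    by (simp only: idiff_enat_enat numeral_eq_enat)
qed

end
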